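(* Let $n,m\ge 2$ be integers. For any $q\in\mathbb{C}$ with $|q|=1$, one has an isomorphism of $C^*$-algebras $\mathcal{M}_q\simeq\mathcal{M}_1$.
   Context: For $q\in\mathbb{C}$, $|q|=1$, $\mathcal{E}_{n,m}^q$ denotes the universal unital $C^*$-algebra generated by elements $s_1,\dots,s_n,t_1,\dots,t_m$ subject to the relations $s_i^*s_j=\delta_{ij}\mathbf 1$, $t_r^*t_l=\delta_{rl}\mathbf 1$, $s_j^*t_r=q\,t_rs_j^*$ for all $i,j\in\{1,\dots,n\}$, $r,l\in\{1,\dots,m\}$. $\mathcal M_q$ is the closed two-sided ideal of $\mathcal{E}_{n,m}^q$ generated by $\mathbf 1-\sum_{j=1}^n s_js_j^*$ and $\mathbf 1-\sum_{r=1}^m t_rt_r^*$; $\mathcal M_1$ is this ideal for $q=1$. *)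

theory Defs
  imports "HOL-Analysis.Analysis" "HOL-Algebra.Ideal" "HOL-Algebra.Module" "HOL-Library.Poly_Mapping"
begin

section \<open>The free unital *-algebra on a set of generators\<close>

text \<open>
  It is the monoid algebra, over the complex numbers, of the free monoid on the letters
  \<open>g\<close> and \<open>g\<^sup>*\<close>, the latter being encoded as \<open>(g, False)\<close> and \<open>(g, True)\<close>.
  Concatenation is written additively because the multiplication of
  \<^typ>\<open>'a \<Rightarrow>\<^sub>0 'b\<close> is the convolution over an additive monoid \<^typ>\<open>'a\<close>.
\<close>

datatype 'g star_word = StarWord (letters: "('g \<times> bool) list")

instantiation star_word :: (type) monoid_add
begin

definition zero_star_word :: "'a star_word" where
  "0 = StarWord []"

definition plus_star_word :: "'a star_word \<Rightarrow> 'a star_word \<Rightarrow> 'a star_word" where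
  "v + w = StarWord (letters v @ letters w)"

instance
  by standard (simp_all add: zero_star_word_def plus_star_word_def)

end

definition word_star :: "'g star_word \<Rightarrow> 'g star_word" where
  "word_star w = StarWord (rev (map (\<lambda>(g, b). (g, \<not> b)) (letters w)))"

lemma word_star_word_star [simp]: "word_star (word_star w) = w"
  by (cases w) (simp add: word_star_def rev_map o_def case_prod_unfold)

lemma word_star_add: "word_star (v + w) = word_star w + word_star v"
  by (simp add: word_star_def plus_star_word_def)

lemma word_star_eq_iff: "word_star v = w \<longleftrightarrow> v = word_star w"
  by auto

lemma inj_word_star: "inj word_star"
  by (metis injI word_star_word_star)

type_synonym 'g free_star_alg = "'g star_word \<Rightarrow>\<^sub>0 complex"

lift_definition fs_star :: "'g free_star_alg \<Rightarrow> 'g free_star_alg"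
  is "\<lambda>x w. cnj (x (word_star w))"
proof -
  fix x :: "'g star_word \<Rightarrow> complex"
  assume "finite {w. x w \<noteq> 0}"
  then have "finite (word_star -` {w. x w \<noteq> 0})"
    by (rule finite_vimageI[OF _ inj_word_star])
  then show "finite {w. cnj (x (word_star w)) \<noteq> 0}"
    by (simp add: vimage_def)
qed

definition fs_scale :: "complex \<Rightarrow> 'g free_star_alg \<Rightarrow> 'g free_star_alg" where
  "fs_scale c x = Poly_Mapping.single 0 c * x"

definition fs_gen :: "'g \<Rightarrow> 'g free_star_alg" where
  "fs_gen g = Poly_Mapping.single (StarWord [(g, False)]) 1"

lemma sum_single: "(x :: 'a \<Rightarrow>\<^sub>0 'b::comm_monoid_add) = (\<Sum>w\<in>Poly_Mapping.keys x. Poly_Mapping.single w (Poly_Mapping.lookup x w))"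
  by (rule poly_mapping_eqI)
    (simp add: lookup_sum lookup_single when_def sum.delta' in_keys_iff)

lemma fs_star_fs_star [simp]: "fs_star (fs_star x) = x"
  by (rule poly_mapping_eqI) (simp add: fs_star.rep_eq)

lemma fs_star_add: "fs_star (x + y) = fs_star x + fs_star y"
  by (rule poly_mapping_eqI) (simp add: fs_star.rep_eq lookup_add)

lemma fs_star_diff: "fs_star (x - y) = fs_star x - fs_star y"
  by (rule poly_mapping_eqI) (simp add: fs_star.rep_eq lookup_minus)

lemma fs_star_single:
  "fs_star (Poly_Mapping.single w c) = Poly_Mapping.single (word_star w) (cnj c)"
  by (rule poly_mapping_eqI)
    (auto simp: fs_star.rep_eq lookup_single when_def)

lemma fs_star_0 [simp]: "fs_star 0 = 0"
  by (rule poly_mapping_eqI) (simp add: fs_star.rep_eq)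

lemma word_star_0 [simp]: "word_star 0 = 0"
  by (simp add: word_star_def zero_star_word_def)

lemma fs_star_1 [simp]: "fs_star 1 = 1"
  by (metis complex_cnj_one fs_star_single single_one word_star_0)

lemma fs_star_sum: "fs_star (sum f I) = (\<Sum>i\<in>I. fs_star (f i))"
  by (induction I rule: infinite_finite_induct) (simp_all add: fs_star_add)

lemma fs_star_mult: "fs_star (x * y) = fs_star y * fs_star x"
proof -
  have "fs_star (x * y) = fs_star ((\<Sum>v\<in>Poly_Mapping.keys x. Poly_Mapping.single v (Poly_Mapping.lookup x v)) *
      (\<Sum>w\<in>Poly_Mapping.keys y. Poly_Mapping.single w (Poly_Mapping.lookup y w)))"
    by (simp only: sum_single[symmetric])
  also have "\<dots> = (\<Sum>v\<in>Poly_Mapping.keys x. \<Sum>w\<in>Poly_Mapping.keys y.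
      fs_star (Poly_Mapping.single w (Poly_Mapping.lookup y w)) * fs_star (Poly_Mapping.single v (Poly_Mapping.lookup x v)))"
    by (simp add: sum_product fs_star_sum mult_single fs_star_single word_star_add mult.commute)
  also have "\<dots> = fs_star (\<Sum>w\<in>Poly_Mapping.keys y. Poly_Mapping.single w (Poly_Mapping.lookup y w)) *
      fs_star (\<Sum>v\<in>Poly_Mapping.keys x. Poly_Mapping.single v (Poly_Mapping.lookup x v))"
    by (simp add: fs_star_sum sum_product sum.swap[of _ "Poly_Mapping.keys x"])
  finally show ?thesis
    by (simp only: sum_single[symmetric])
qed

lemma single_0_commute:
  fixes x :: "'g free_star_alg"
  shows "Poly_Mapping.single 0 c * x = x * Poly_Mapping.single 0 c"
proof -
  have "Poly_Mapping.single 0 c * (\<Sum>w\<in>Poly_Mapping.keys x. Poly_Mapping.single w (Poly_Mapping.lookup x w))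
      = (\<Sum>w\<in>Poly_Mapping.keys x. Poly_Mapping.single w (Poly_Mapping.lookup x w)) * Poly_Mapping.single 0 c"
    by (simp add: sum_distrib_left sum_distrib_right mult_single mult.commute)
  then show ?thesis
    by (simp only: sum_single[symmetric])
qed

lemma fs_scale_mult_left: "fs_scale c x * y = fs_scale c (x * y)"
  by (simp add: fs_scale_def mult.assoc)

lemma fs_scale_mult_right: "x * fs_scale c y = fs_scale c (x * y)"
  by (metis fs_scale_def mult.assoc single_0_commute)

lemma fs_scale_add: "fs_scale c (x + y) = fs_scale c x + fs_scale c y"
  by (simp add: fs_scale_def distrib_left)

lemma fs_scale_diff: "fs_scale c (x - y) = fs_scale c x - fs_scale c y"
  by (simp add: fs_scale_def right_diff_distrib)

lemma fs_scale_add_left: "fs_scale (c + d) x = fs_scale c x + fs_scale d x"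
  by (simp add: fs_scale_def single_add distrib_right)

lemma fs_scale_scale: "fs_scale (c * d) x = fs_scale c (fs_scale d x)"
  by (simp add: fs_scale_def mult_single flip: mult.assoc)

lemma fs_scale_1 [simp]: "fs_scale 1 x = x"
  by (simp add: fs_scale_def)

lemma fs_scale_single: "fs_scale c (Poly_Mapping.single w d) = Poly_Mapping.single w (c * d)"
  by (simp add: fs_scale_def mult_single)

lemma fs_star_scale: "fs_star (fs_scale c x) = fs_scale (cnj c) (fs_star x)"
  by (metis fs_scale_def fs_star_mult fs_star_single single_0_commute word_star_0)


section \<open>*-algebras with a norm, and C*-algebras\<close>

text \<open>The field \<^const>\<open>one\<close> has no meaning for algebras that are not unital.\<close>

record 'a star_algebra = "(complex, 'a) module" +
  adj :: "'a \<Rightarrow> 'a"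
  nrm :: "'a \<Rightarrow> real"

locale cstar_algebra = abelian_group A for A :: "('a, 'r) star_algebra_scheme" (structure) +
  assumes m_closed: "\<lbrakk>x \<in> carrier A; y \<in> carrier A\<rbrakk> \<Longrightarrow> x \<otimes> y \<in> carrier A"
    and m_assoc: "\<lbrakk>x \<in> carrier A; y \<in> carrier A; z \<in> carrier A\<rbrakk> \<Longrightarrow> (x \<otimes> y) \<otimes> z = x \<otimes> (y \<otimes> z)"
    and l_distr: "\<lbrakk>x \<in> carrier A; y \<in> carrier A; z \<in> carrier A\<rbrakk>
      \<Longrightarrow> (x \<oplus> y) \<otimes> z = x \<otimes> z \<oplus> y \<otimes> z"
    and r_distr: "\<lbrakk>x \<in> carrier A; y \<in> carrier A; z \<in> carrier A\<rbrakk>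
      \<Longrightarrow> z \<otimes> (x \<oplus> y) = z \<otimes> x \<oplus> z \<otimes> y"
    and smult_closed: "x \<in> carrier A \<Longrightarrow> c \<odot> x \<in> carrier A"
    and smult_l_distr: "x \<in> carrier A \<Longrightarrow> (c + d) \<odot> x = c \<odot> x \<oplus> d \<odot> x"
    and smult_r_distr: "\<lbrakk>x \<in> carrier A; y \<in> carrier A\<rbrakk> \<Longrightarrow> c \<odot> (x \<oplus> y) = c \<odot> x \<oplus> c \<odot> y"
    and smult_smult: "x \<in> carrier A \<Longrightarrow> (c * d) \<odot> x = c \<odot> (d \<odot> x)"
    and smult_1: "x \<in> carrier A \<Longrightarrow> 1 \<odot> x = x"
    and smult_m_left: "\<lbrakk>x \<in> carrier A; y \<in> carrier A\<rbrakk> \<Longrightarrow> (c \<odot> x) \<otimes> y = c \<odot> (x \<otimes> y)"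
    and smult_m_right: "\<lbrakk>x \<in> carrier A; y \<in> carrier A\<rbrakk> \<Longrightarrow> x \<otimes> (c \<odot> y) = c \<odot> (x \<otimes> y)"
    and adj_closed: "x \<in> carrier A \<Longrightarrow> adj A x \<in> carrier A"
    and adj_adj: "x \<in> carrier A \<Longrightarrow> adj A (adj A x) = x"
    and adj_add: "\<lbrakk>x \<in> carrier A; y \<in> carrier A\<rbrakk> \<Longrightarrow> adj A (x \<oplus> y) = adj A x \<oplus> adj A y"
    and adj_smult: "x \<in> carrier A \<Longrightarrow> adj A (c \<odot> x) = cnj c \<odot> adj A x"
    and adj_mult: "\<lbrakk>x \<in> carrier A; y \<in> carrier A\<rbrakk> \<Longrightarrow> adj A (x \<otimes> y) = adj A y \<otimes> adj A x"
    and nrm_nonneg: "x \<in> carrier A \<Longrightarrow> 0 \<le> nrm A x"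
    and nrm_eq_0_iff: "x \<in> carrier A \<Longrightarrow> nrm A x = 0 \<longleftrightarrow> x = \<zero>"
    and nrm_add: "\<lbrakk>x \<in> carrier A; y \<in> carrier A\<rbrakk> \<Longrightarrow> nrm A (x \<oplus> y) \<le> nrm A x + nrm A y"
    and nrm_smult: "x \<in> carrier A \<Longrightarrow> nrm A (c \<odot> x) = cmod c * nrm A x"
    and nrm_mult: "\<lbrakk>x \<in> carrier A; y \<in> carrier A\<rbrakk> \<Longrightarrow> nrm A (x \<otimes> y) \<le> nrm A x * nrm A y"
    and nrm_cstar: "x \<in> carrier A \<Longrightarrow> nrm A (adj A x \<otimes> x) = (nrm A x)\<^sup>2"
    and nrm_complete: "\<lbrakk>\<And>k. X k \<in> carrier A;
        \<forall>e>0. \<exists>K. \<forall>i\<ge>K. \<forall>j\<ge>K. nrm A (X i \<ominus> X j) < e\<rbrakk>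
      \<Longrightarrow> \<exists>l\<in>carrier A. (\<lambda>k. nrm A (X k \<ominus> l)) \<longlonglongrightarrow> 0"

context cstar_algebra
begin

lemma smult_0_left: "x \<in> carrier A \<Longrightarrow> 0 \<odot> x = \<zero>"
  by (metis add.l_cancel_one smult_closed smult_l_distr add_0)

lemma a_inv_eq_smult: "x \<in> carrier A \<Longrightarrow> \<ominus> x = (-1) \<odot> x"
proof (rule minus_equality)
  assume x: "x \<in> carrier A"
  have "(-1) \<odot> x \<oplus> 1 \<odot> x = (-1 + 1) \<odot> x" using smult_l_distr[OF x, of "-1" 1] by simp
  then show "(-1) \<odot> x \<oplus> x = \<zero>" using x by (simp add: smult_1 smult_0_left)
qed (auto intro: smult_closed)

lemma minus_eq_smult: "y \<in> carrier A \<Longrightarrow> x \<ominus> y = x \<oplus> (-1) \<odot> y"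
  by (simp add: a_minus_def a_inv_eq_smult)

lemma nrm_0: "nrm A \<zero> = 0"
  by (simp add: nrm_eq_0_iff)

lemma nrm_minus_commute: "x \<in> carrier A \<Longrightarrow> y \<in> carrier A \<Longrightarrow> nrm A (x \<ominus> y) = nrm A (y \<ominus> x)"
proof -
  assume x: "x \<in> carrier A" and y: "y \<in> carrier A"
  have "y \<ominus> x = (-1) \<odot> (x \<ominus> y)"
    using x y by (simp add: a_inv_eq_smult[symmetric] a_minus_def minus_add a_comm)
  then show ?thesis using x y by (simp add: nrm_smult)
qed

definition has_limit :: "(nat \<Rightarrow> 'a) \<Rightarrow> 'a \<Rightarrow> bool" where
  "has_limit u l \<longleftrightarrow> (\<forall>k. u k \<in> carrier A) \<and> l \<in> carrier A \<and> (\<lambda>k. nrm A (u k \<ominus> l)) \<longlonglongrightarrow> 0"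

lemma has_limit_sandwich:
  assumes "\<And>k. u k \<in> carrier A" "l \<in> carrier A" "\<And>k. nrm A (u k \<ominus> l) \<le> g k" "g \<longlonglongrightarrow> 0"
  shows "has_limit u l"
  unfolding has_limit_def
  using assms(1,2) tendsto_sandwich[OF _ _ tendsto_const assms(4), of "\<lambda>k. nrm A (u k \<ominus> l)"] assms(3)
  by (auto simp: nrm_nonneg)

lemma nrm_triangle:
  assumes "x \<in> carrier A" "y \<in> carrier A" "z \<in> carrier A"
  shows "nrm A (x \<ominus> z) \<le> nrm A (x \<ominus> y) + nrm A (y \<ominus> z)"
proof -
  have "x \<ominus> z = (x \<ominus> y) \<oplus> (y \<ominus> z)"
    using assms by (simp add: a_minus_def a_ac r_neg1 r_neg2)
  then show ?thesis using assms nrm_add by simp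
qed

lemma has_limit_unique:
  assumes "has_limit u l" "has_limit u l'"
  shows "l = l'"
proof -
  have c: "\<And>k. u k \<in> carrier A" "l \<in> carrier A" "l' \<in> carrier A"
    using assms by (auto simp: has_limit_def)
  have "(\<lambda>k. nrm A (u k \<ominus> l) + nrm A (u k \<ominus> l')) \<longlonglongrightarrow> 0 + 0"
    using assms unfolding has_limit_def by (intro tendsto_add) auto
  moreover have "nrm A (l \<ominus> l') \<le> nrm A (u k \<ominus> l) + nrm A (u k \<ominus> l')" for k
    using nrm_triangle[of l "u k" l'] nrm_minus_commute[of l "u k"] c by simp
  ultimately have "nrm A (l \<ominus> l') \<le> 0"
    using LIMSEQ_le_const by fastforce
  then have "l \<ominus> l' = \<zero>"
    using nrm_nonneg[of "l \<ominus> l'"] nrm_eq_0_iff[of "l \<ominus> l'"] c by simp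
  then have "\<ominus> (\<ominus> l') = l"
    using c by (intro minus_equality) (auto simp: a_minus_def)
  then show ?thesis using c by simp
qed

lemma has_limit_const: "x \<in> carrier A \<Longrightarrow> has_limit (\<lambda>_. x) x"
  by (simp add: has_limit_def a_minus_def r_neg nrm_0)

lemma has_limit_add:
  assumes "has_limit u l" "has_limit v m"
  shows "has_limit (\<lambda>k. u k \<oplus> v k) (l \<oplus> m)"
proof (rule has_limit_sandwich)
  have c: "\<And>k. u k \<in> carrier A" "l \<in> carrier A" "\<And>k. v k \<in> carrier A" "m \<in> carrier A"
    using assms by (auto simp: has_limit_def)
  then show "u k \<oplus> v k \<in> carrier A" "l \<oplus> m \<in> carrier A" for k by auto
  show "nrm A ((u k \<oplus> v k) \<ominus> (l \<oplus> m)) \<le> nrm A (u k \<ominus> l) + nrm A (v k \<ominus> m)" for k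
  proof -
    have "(u k \<oplus> v k) \<ominus> (l \<oplus> m) = (u k \<ominus> l) \<oplus> (v k \<ominus> m)"
      using c by (simp add: a_minus_def minus_add a_ac)
    then show ?thesis using c nrm_add by simp
  qed
  show "(\<lambda>k. nrm A (u k \<ominus> l) + nrm A (v k \<ominus> m)) \<longlonglongrightarrow> 0"
    using tendsto_add[of _ 0 _ _ 0] assms unfolding has_limit_def by fastforce
qed

lemma has_limit_smult:
  assumes "has_limit u l"
  shows "has_limit (\<lambda>k. c \<odot> u k) (c \<odot> l)"
proof (rule has_limit_sandwich)
  have m: "\<And>k. u k \<in> carrier A" "l \<in> carrier A"
    using assms by (auto simp: has_limit_def)
  then show "c \<odot> u k \<in> carrier A" "c \<odot> l \<in> carrier A" for k by (auto intro: smult_closed)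
  show "nrm A (c \<odot> u k \<ominus> c \<odot> l) \<le> cmod c * nrm A (u k \<ominus> l)" for k
  proof -
    have "c \<odot> u k \<ominus> c \<odot> l = c \<odot> (u k \<ominus> l)"
      using m by (simp add: minus_eq_smult smult_closed smult_r_distr flip: smult_smult)
    then show ?thesis using m nrm_smult by simp
  qed
  show "(\<lambda>k. cmod c * nrm A (u k \<ominus> l)) \<longlonglongrightarrow> 0"
    using tendsto_mult_left[of "\<lambda>k. nrm A (u k \<ominus> l)" 0] assms unfolding has_limit_def by fastforce
qed

lemma nrm_adj_le: "x \<in> carrier A \<Longrightarrow> nrm A (adj A x) \<le> nrm A x"
proof -
  have le: "nrm A y \<le> nrm A (adj A y)" if y: "y \<in> carrier A" for y
  proof (cases "nrm A y = 0")
    case True then show ?thesis using y by (simp add: nrm_nonneg adj_closed)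
  next
    case False
    have "nrm A y * nrm A y \<le> nrm A (adj A y) * nrm A y"
      using nrm_mult[OF adj_closed[OF y] y] nrm_cstar[OF y] by (simp add: power2_eq_square)
    then show ?thesis
      using False nrm_nonneg[OF y] by (simp add: less_le)
  qed
  show "x \<in> carrier A \<Longrightarrow> nrm A (adj A x) \<le> nrm A x"
    using le[of "adj A x"] by (simp add: adj_closed adj_adj)
qed

lemma has_limit_adj:
  assumes "has_limit u l"
  shows "has_limit (\<lambda>k. adj A (u k)) (adj A l)"
proof (rule has_limit_sandwich)
  have m: "\<And>k. u k \<in> carrier A" "l \<in> carrier A"
    using assms by (auto simp: has_limit_def)
  then show "adj A (u k) \<in> carrier A" "adj A l \<in> carrier A" for k by (auto intro: adj_closed)
  show "nrm A (adj A (u k) \<ominus> adj A l) \<le> nrm A (u k \<ominus> l)" for k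
  proof -
    have "adj A (u k) \<ominus> adj A l = adj A (u k \<ominus> l)"
      using m by (simp add: minus_eq_smult adj_closed smult_closed adj_add adj_smult)
    then show ?thesis using m nrm_adj_le by simp
  qed
  show "(\<lambda>k. nrm A (u k \<ominus> l)) \<longlonglongrightarrow> 0"
    using assms unfolding has_limit_def by blast
qed

lemma has_limit_mult:
  assumes u: "has_limit u l" and v: "has_limit v m"
  shows "has_limit (\<lambda>k. u k \<otimes> v k) (l \<otimes> m)"
proof (rule has_limit_sandwich)
  have c: "\<And>k. u k \<in> carrier A" "l \<in> carrier A" "\<And>k. v k \<in> carrier A" "m \<in> carrier A"
    using assms by (auto simp: has_limit_def)
  then show "u k \<otimes> v k \<in> carrier A" "l \<otimes> m \<in> carrier A" for k by (auto intro: m_closed)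
  let ?g = "\<lambda>k. (nrm A (u k \<ominus> l) + nrm A l) * nrm A (v k \<ominus> m) + nrm A (u k \<ominus> l) * nrm A m"
  show "nrm A (u k \<otimes> v k \<ominus> l \<otimes> m) \<le> ?g k" for k
  proof -
    have eq: "u k \<otimes> v k \<ominus> l \<otimes> m = u k \<otimes> (v k \<ominus> m) \<oplus> (u k \<ominus> l) \<otimes> m"
    proof -
      have "u k \<otimes> (v k \<ominus> m) \<oplus> (u k \<ominus> l) \<otimes> m =
         u k \<otimes> v k \<oplus> ((\<ominus> (u k \<otimes> m) \<oplus> u k \<otimes> m) \<oplus> \<ominus> (l \<otimes> m))"
        using c by (simp add: minus_eq_smult a_inv_eq_smult m_closed smult_closed l_distr r_distr
            smult_m_left smult_m_right a_assoc)
      also have "\<dots> = u k \<otimes> v k \<ominus> l \<otimes> m"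
        using c by (simp add: l_neg m_closed a_minus_def)
      finally show ?thesis by simp
    qed
    have u': "nrm A (u k) \<le> nrm A (u k \<ominus> l) + nrm A l"
    proof -
      have "u k = (u k \<ominus> l) \<oplus> l" using c by (simp add: a_minus_def a_assoc l_neg)
      then show ?thesis using c nrm_add by (metis minus_closed)
    qed
    have "nrm A (u k \<otimes> v k \<ominus> l \<otimes> m) \<le> nrm A (u k) * nrm A (v k \<ominus> m) + nrm A (u k \<ominus> l) * nrm A m"
      unfolding eq using c nrm_add[of "u k \<otimes> (v k \<ominus> m)" "(u k \<ominus> l) \<otimes> m"]
        nrm_mult[of "u k" "v k \<ominus> m"] nrm_mult[of "u k \<ominus> l" m] by (simp add: m_closed)
    also have "\<dots> \<le> ?g k"
      using u' c by (intro add_right_mono mult_right_mono) (auto intro: nrm_nonneg)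
    finally show ?thesis .
  qed
  have "?g \<longlonglongrightarrow> (0 + nrm A l) * 0 + 0 * nrm A m"
    using u v unfolding has_limit_def by (intro tendsto_intros) auto
  then show "?g \<longlonglongrightarrow> 0" by simp
qed

end

definition cstar_hom ::
  "('a, 'r) star_algebra_scheme \<Rightarrow> ('b, 's) star_algebra_scheme \<Rightarrow> ('a \<Rightarrow> 'b) \<Rightarrow> bool" where
  "cstar_hom A B f \<longleftrightarrow>
     f \<in> carrier A \<rightarrow> carrier B \<and>
     (\<forall>x\<in>carrier A. \<forall>y\<in>carrier A. f (x \<oplus>\<^bsub>A\<^esub> y) = f x \<oplus>\<^bsub>B\<^esub> f y) \<and>
     (\<forall>x\<in>carrier A. \<forall>y\<in>carrier A. f (x \<otimes>\<^bsub>A\<^esub> y) = f x \<otimes>\<^bsub>B\<^esub> f y) \<and>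
     (\<forall>c. \<forall>x\<in>carrier A. f (c \<odot>\<^bsub>A\<^esub> x) = c \<odot>\<^bsub>B\<^esub> f x) \<and>
     (\<forall>x\<in>carrier A. f (adj A x) = adj B (f x))"

text \<open>Bijective *-homomorphisms of C*-algebras are automatically isometric.\<close>

definition cstar_isomorphic ::
  "('a, 'r) star_algebra_scheme \<Rightarrow> ('b, 's) star_algebra_scheme \<Rightarrow> bool"
  (infix \<open>\<simeq>\<^sub>C\<close> 50) where
  "A \<simeq>\<^sub>C B \<longleftrightarrow> (\<exists>f. cstar_hom A B f \<and> bij_betw f (carrier A) (carrier B))"

definition closed_ideal :: "'a set \<Rightarrow> ('a, 'r) star_algebra_scheme \<Rightarrow> bool" where
  "closed_ideal I A \<longleftrightarrow> ideal I A \<and>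
     (\<forall>x l. (\<forall>k::nat. x k \<in> I) \<and> l \<in> carrier A \<and> (\<lambda>k. nrm A (x k \<ominus>\<^bsub>A\<^esub> l)) \<longlonglongrightarrow> 0 \<longrightarrow> l \<in> I)"

definition gen_closed_ideal :: "('a, 'r) star_algebra_scheme \<Rightarrow> 'a set \<Rightarrow> 'a set" where
  "gen_closed_ideal A S = \<Inter>{I. closed_ideal I A \<and> S \<subseteq> I}"


lemma closed_ideal_carrier:
  assumes "ring A"
  shows "closed_ideal (carrier A) A"
  using ring.oneideal[OF assms] by (auto simp: closed_ideal_def)

lemma closed_ideal_gen:
  assumes "ring A" "S \<subseteq> carrier A"
  shows "closed_ideal (gen_closed_ideal A S) A" "S \<subseteq> gen_closed_ideal A S"
proof -
  have "ideal (gen_closed_ideal A S) A"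
    unfolding gen_closed_ideal_def
    by (rule ring.i_Intersect[OF assms(1)])
      (use closed_ideal_carrier[OF assms(1)] assms(2) in \<open>auto simp: closed_ideal_def\<close>)
  moreover have "l \<in> gen_closed_ideal A S"
    if x: "\<forall>k::nat. x k \<in> gen_closed_ideal A S" and l: "l \<in> carrier A"
      "(\<lambda>k. nrm A (x k \<ominus>\<^bsub>A\<^esub> l)) \<longlonglongrightarrow> 0" for x l
    unfolding gen_closed_ideal_def
  proof (rule InterI)
    fix I assume I: "I \<in> {I. closed_ideal I A \<and> S \<subseteq> I}"
    then have "x k \<in> I" for k using x[rule_format, of k] by (simp add: gen_closed_ideal_def)
    moreover have "closed_ideal I A" using I by simp
    ultimately show "l \<in> I"
      using l unfolding closed_ideal_def by (metis (no_types, lifting))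
  qed
  ultimately show "closed_ideal (gen_closed_ideal A S) A"
    unfolding closed_ideal_def by blast
  show "S \<subseteq> gen_closed_ideal A S"
    by (auto simp: gen_closed_ideal_def)
qed

context cstar_algebra
begin

lemma closed_ideal_iff_has_limit:
  "closed_ideal I A \<longleftrightarrow> ideal I A \<and> (\<forall>u l. (\<forall>k. u k \<in> I) \<and> has_limit u l \<longrightarrow> l \<in> I)"
proof -
  have "x k \<in> carrier A" if "ideal I A" "\<forall>k. x k \<in> I" for x :: "nat \<Rightarrow> 'a" and k
    using additive_subgroup.a_subset[OF ideal.axioms(1)[OF that(1)]] that(2) by blast
  then show ?thesis
    unfolding closed_ideal_def has_limit_def by (intro conj_cong all_cong1) auto
qed

lemma closed_ideal_adj:
  assumes "ring A" and I: "closed_ideal I A"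
  shows "closed_ideal {x \<in> carrier A. adj A x \<in> I} A"
proof -
  interpret R: ring A by (rule assms(1))
  interpret I: ideal I A using I by (simp add: closed_ideal_def)
  have adj0: "adj A \<zero> = \<zero>"
    using adj_smult[of \<zero> 0] by (simp add: smult_0_left adj_closed)
  have "ideal {x \<in> carrier A. adj A x \<in> I} A"
  proof (rule idealI[OF assms(1)])
    show "subgroup {x \<in> carrier A. adj A x \<in> I} (add_monoid A)"
    proof (rule add.subgroupI)
      show "{x \<in> carrier A. adj A x \<in> I} \<noteq> {}"
        using adj0 I.zero_closed by (metis (mono_tags, lifting) empty_iff mem_Collect_eq zero_closed)
    next
      fix x assume "x \<in> {x \<in> carrier A. adj A x \<in> I}"
      then have x: "x \<in> carrier A" "adj A x \<in> I" by auto
      have "adj A (\<ominus> x) = \<ominus> adj A x"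
        using x(1) adj_smult[OF x(1), of "-1"] by (simp add: a_inv_eq_smult adj_closed)
      then show "\<ominus> x \<in> {x \<in> carrier A. adj A x \<in> I}"
        using x I.a_inv_closed[OF x(2)] by simp
    next
      fix x y assume "x \<in> {x \<in> carrier A. adj A x \<in> I}" "y \<in> {x \<in> carrier A. adj A x \<in> I}"
      then show "x \<oplus> y \<in> {x \<in> carrier A. adj A x \<in> I}"
        by (simp add: adj_add I.a_closed)
    qed blast
  next
    fix a x assume "a \<in> {x \<in> carrier A. adj A x \<in> I}" and x: "x \<in> carrier A"
    then have a: "a \<in> carrier A" "adj A a \<in> I" by auto
    show "x \<otimes> a \<in> {x \<in> carrier A. adj A x \<in> I}"
      using a x I.I_r_closed[OF a(2) adj_closed[OF x]] by (simp add: adj_mult m_closed)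
    show "a \<otimes> x \<in> {x \<in> carrier A. adj A x \<in> I}"
      using a x I.I_l_closed[OF a(2) adj_closed[OF x]] by (simp add: adj_mult m_closed)
  qed
  moreover have "l \<in> {x \<in> carrier A. adj A x \<in> I}"
    if u: "\<forall>k. u k \<in> {x \<in> carrier A. adj A x \<in> I}" and l: "has_limit u l" for u l
  proof -
    have "adj A (u k) \<in> I" for k using u by blast
    then have "adj A l \<in> I"
      using I has_limit_adj[OF l] unfolding closed_ideal_iff_has_limit by metis
    then show ?thesis using l by (simp add: has_limit_def)
  qed
  ultimately show ?thesis
    unfolding closed_ideal_iff_has_limit by blast
qed

lemma closed_ideal_cstar_algebra:
  assumes "ring A" and I: "closed_ideal I A" and adj: "\<And>x. x \<in> I \<Longrightarrow> adj A x \<in> I"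
  shows "cstar_algebra (A\<lparr>carrier := I\<rparr>)"
proof -
  interpret R: ring A by (rule assms(1))
  interpret I: ideal I A using I by (simp add: closed_ideal_def)
  let ?M = "A\<lparr>carrier := I\<rparr>"
  have sub: "x \<in> carrier A" if "x \<in> I" for x using that I.a_subset by blast
  have smult: "c \<odot> x \<in> I" if "x \<in> I" for c x
  proof -
    have "c \<odot> x = (c \<odot> \<one>) \<otimes> x" using sub[OF that] by (simp add: smult_m_left)
    then show ?thesis using that by (simp add: I.I_l_closed smult_closed)
  qed
  have grp: "abelian_group ?M"
  proof (rule abelian_groupI)
    fix x assume "x \<in> carrier ?M"
    then show "\<exists>y\<in>carrier ?M. y \<oplus>\<^bsub>?M\<^esub> x = \<zero>\<^bsub>?M\<^esub>"
      by (auto intro!: bexI[of _ "\<ominus> x"] simp: sub l_neg)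
  qed (auto simp: sub a_ac)
  interpret M: abelian_group ?M by (rule grp)
  have "\<ominus>\<^bsub>?M\<^esub> x = \<ominus> x" if "x \<in> I" for x
    by (rule M.minus_equality) (use that in \<open>auto simp: sub l_neg\<close>)
  then have minus: "x \<ominus>\<^bsub>?M\<^esub> y = x \<ominus> y" if "x \<in> I" "y \<in> I" for x y
    using that by (simp add: a_minus_def)
  show ?thesis
  proof (unfold_locales, goal_cases)
    case (23 X)
    then have X: "\<And>k. X k \<in> I" by simp
    then have "\<forall>e>0. \<exists>K. \<forall>i\<ge>K. \<forall>j\<ge>K. nrm A (X i \<ominus> X j) < e"
      using 23(2) by (simp add: minus)
    then obtain l where l: "l \<in> carrier A" "(\<lambda>k. nrm A (X k \<ominus> l)) \<longlonglongrightarrow> 0"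
      using nrm_complete[of X] X sub by blast
    then have "l \<in> I" using I X unfolding closed_ideal_def by blast
    then show ?case using l X by (auto simp: minus intro!: bexI[of _ l])
  qed (simp_all add: sub smult adj I.I_l_closed m_assoc l_distr r_distr smult_l_distr smult_r_distr
      smult_smult smult_1 smult_m_left smult_m_right adj_adj adj_add adj_smult adj_mult nrm_nonneg
      nrm_eq_0_iff nrm_add nrm_smult nrm_mult nrm_cstar)
qed

lemma gen_closed_ideal_cstar_algebra:
  assumes "ring A" "S \<subseteq> carrier A" and S: "\<And>x. x \<in> S \<Longrightarrow> adj A x \<in> S"
  shows "cstar_algebra (A\<lparr>carrier := gen_closed_ideal A S\<rparr>)"
proof -
  let ?I = "gen_closed_ideal A S"
  have "S \<subseteq> {x \<in> carrier A. adj A x \<in> ?I}"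
    using assms closed_ideal_gen(2)[OF assms(1,2)] by blast
  then have "?I \<subseteq> {x \<in> carrier A. adj A x \<in> ?I}"
    using closed_ideal_adj[OF assms(1) closed_ideal_gen(1)[OF assms(1,2)]]
    unfolding gen_closed_ideal_def[of A S] by blast
  then show ?thesis
    using closed_ideal_cstar_algebra[OF assms(1) closed_ideal_gen(1)[OF assms(1,2)]] by blast
qed

end


section \<open>The universal unital C*-algebra of a set of relations\<close>

definition cstar_seminorm :: "('g free_star_alg \<Rightarrow> real) \<Rightarrow> bool" where
  "cstar_seminorm p \<longleftrightarrow>
     (\<forall>x. 0 \<le> p x) \<and> (\<forall>x y. p (x + y) \<le> p x + p y) \<and> (\<forall>c x. p (fs_scale c x) = cmod c * p x) \<and>
     (\<forall>x y. p (x * y) \<le> p x * p y) \<and> (\<forall>x. p (fs_star x * x) = (p x)\<^sup>2)"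

text \<open>
  A relation is an element of the free *-algebra which is required to vanish.
  The C*-seminorms vanishing on \<open>R\<close> are exactly the functions \<open>x \<mapsto> \<parallel>\<pi> x\<parallel>\<close> for the
  unital *-homomorphisms \<open>\<pi>\<close> from the free *-algebra to a unital C*-algebra (possibly \<open>0\<close>)
  with \<open>\<pi> r = 0\<close> for all \<open>r \<in> R\<close>; quantifying over seminorms avoids the quantification over
  all C*-algebras. The supremum is finite for the relations considered below
  (see \<open>bdd_above_E_seminorms\<close>).
\<close>

definition rel_seminorms :: "'g free_star_alg set \<Rightarrow> ('g free_star_alg \<Rightarrow> real) set" where
  "rel_seminorms R = {p. cstar_seminorm p \<and> (\<forall>r\<in>R. p r = 0)}"

definition univ_seminorm :: "'g free_star_alg set \<Rightarrow> 'g free_star_alg \<Rightarrow> real" where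
  "univ_seminorm R x = (SUP p\<in>rel_seminorms R. p x)"

text \<open>
  The Hausdorff completion for a C*-seminorm \<open>N\<close>: its elements are classes of \<open>N\<close>-Cauchy
  sequences modulo \<open>N\<close>-null sequences.
\<close>

definition Cau :: "('g free_star_alg \<Rightarrow> real) \<Rightarrow> (nat \<Rightarrow> 'g free_star_alg) set" where
  "Cau N = {X. \<forall>e>0. \<exists>K. \<forall>i\<ge>K. \<forall>j\<ge>K. N (X i - X j) < e}"

definition cls ::
  "('g free_star_alg \<Rightarrow> real) \<Rightarrow> (nat \<Rightarrow> 'g free_star_alg) \<Rightarrow> (nat \<Rightarrow> 'g free_star_alg) set" where
  "cls N X = {Y \<in> Cau N. (\<lambda>k. N (X k - Y k)) \<longlonglongrightarrow> 0}"

definition cls_rep :: "(nat \<Rightarrow> 'g free_star_alg) set \<Rightarrow> nat \<Rightarrow> 'g free_star_alg" where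
  "cls_rep A = (SOME X. X \<in> A)"

type_synonym 'g univ_cstar = "(nat \<Rightarrow> 'g free_star_alg) set star_algebra"

definition cstar_completion :: "('g free_star_alg \<Rightarrow> real) \<Rightarrow> 'g univ_cstar" where
  "cstar_completion N =
    \<lparr>carrier = cls N ` Cau N,
     monoid.mult = (\<lambda>A B. cls N (\<lambda>k. cls_rep A k * cls_rep B k)),
     one = cls N (\<lambda>_. 1),
     zero = cls N (\<lambda>_. 0),
     add = (\<lambda>A B. cls N (\<lambda>k. cls_rep A k + cls_rep B k)),
     smult = (\<lambda>c A. cls N (\<lambda>k. fs_scale c (cls_rep A k))),
     adj = (\<lambda>A. cls N (\<lambda>k. fs_star (cls_rep A k))),
     nrm = (\<lambda>A. lim (\<lambda>k. N (cls_rep A k)))\<rparr>"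

context
  fixes N :: "'g free_star_alg \<Rightarrow> real"
  assumes N: "cstar_seminorm N"
begin

lemma cstar_seminorm_nonneg [simp]: "0 \<le> N x"
  and cstar_seminorm_add: "N (x + y) \<le> N x + N y"
  and cstar_seminorm_scale: "N (fs_scale c x) = cmod c * N x"
  and cstar_seminorm_mult: "N (x * y) \<le> N x * N y"
  and cstar_seminorm_cstar: "N (fs_star x * x) = (N x)\<^sup>2"
  using N unfolding cstar_seminorm_def by auto

lemma cstar_seminorm_0 [simp]: "N 0 = 0"
  using cstar_seminorm_scale[of 0 0] by (simp add: fs_scale_def)

lemma cstar_seminorm_uminus [simp]: "N (- x) = N x"
proof -
  have "fs_scale (-1) x = - x"
    by (simp add: fs_scale_def single_uminus)
  then show ?thesis using cstar_seminorm_scale[of "-1" x] by simp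
qed

lemma cstar_seminorm_minus_commute: "N (x - y) = N (y - x)"
  by (metis cstar_seminorm_uminus minus_diff_eq)

lemma cstar_seminorm_diff: "N (x - y) \<le> N x + N y"
  using cstar_seminorm_add[of x "- y"] by simp

lemma cstar_seminorm_triangle: "N (x - z) \<le> N (x - y) + N (y - z)"
  using cstar_seminorm_add[of "x - y" "y - z"] by simp

lemma cstar_seminorm_abs_diff: "\<bar>N x - N y\<bar> \<le> N (x - y)"
proof -
  have "N x \<le> N (x - y) + N y" "N y \<le> N (y - x) + N x"
    using cstar_seminorm_add[of "x - y" y] cstar_seminorm_add[of "y - x" x] by simp_all
  then show ?thesis unfolding cstar_seminorm_minus_commute[of y x] by linarith
qed

lemma cstar_seminorm_star [simp]: "N (fs_star x) = N x"
proof -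
  have le: "N y \<le> N (fs_star y)" for y
  proof (cases "N y = 0")
    case False
    have "N y * N y \<le> N (fs_star y) * N y"
      using cstar_seminorm_mult[of "fs_star y" y] cstar_seminorm_cstar[of y] by (simp add: power2_eq_square)
    then show ?thesis
      using False cstar_seminorm_nonneg[of y] by (simp add: less_le)
  qed simp
  show ?thesis using le[of x] le[of "fs_star x"] by simp
qed

lemma Cau_const [simp]: "(\<lambda>_. x) \<in> Cau N"
  by (simp add: Cau_def)

lemma Cau_bounded:
  assumes X: "X \<in> Cau N"
  obtains B where "B > 0" "\<And>k. N (X k) \<le> B"
proof -
  have "\<exists>K. \<forall>i\<ge>K. \<forall>j\<ge>K. N (X i - X j) < 1"
    using X unfolding Cau_def by auto
  then obtain K where K: "\<And>i j. i \<ge> K \<Longrightarrow> j \<ge> K \<Longrightarrow> N (X i - X j) < 1"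
    by blast
  define B where "B = 1 + N (X K) + (\<Sum>k<K. N (X k))"
  have "N (X k) \<le> B" for k
  proof (cases "k < K")
    case True
    then have "N (X k) \<le> (\<Sum>k<K. N (X k))"
      by (intro member_le_sum) auto
    then show ?thesis unfolding B_def using cstar_seminorm_nonneg[of "X K"] by linarith
  next
    case False
    then have "N (X k - X K) < 1" using K by auto
    moreover have "N (X k) \<le> N (X k - X K) + N (X K)"
      using cstar_seminorm_add[of "X k - X K" "X K"] by simp
    moreover have "0 \<le> (\<Sum>k<K. N (X k))" by (simp add: sum_nonneg)
    ultimately show ?thesis unfolding B_def by linarith
  qed
  moreover have "0 < B"
    unfolding B_def using cstar_seminorm_nonneg[of "X K"] by (simp add: add_pos_nonneg sum_nonneg)
  ultimately show ?thesis using that by blast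
qed

lemma Cau_add: assumes "X \<in> Cau N" "Y \<in> Cau N" shows "(\<lambda>k. X k + Y k) \<in> Cau N"
  unfolding Cau_def
proof (intro CollectI allI impI)
  fix e :: real assume "e > 0"
  then have e: "e/2 > 0" by simp
  obtain K where K: "\<forall>i\<ge>K. \<forall>j\<ge>K. N (X i - X j) < e/2"
    using assms e unfolding Cau_def by blast
  obtain L where L: "\<forall>i\<ge>L. \<forall>j\<ge>L. N (Y i - Y j) < e/2"
    using assms e unfolding Cau_def by blast
  have "N (X i + Y i - (X j + Y j)) < e" if "i \<ge> max K L" "j \<ge> max K L" for i j
    using cstar_seminorm_add[of "X i - X j" "Y i - Y j"] K[rule_format, of i j] L[rule_format, of i j] that
    by (simp add: algebra_simps)
  then show "\<exists>K. \<forall>i\<ge>K. \<forall>j\<ge>K. N (X i + Y i - (X j + Y j)) < e" by blast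
qed

lemma Cau_lipschitz:
  assumes "X \<in> Cau N" and f: "\<And>x y. N (f x - f y) \<le> c * N (x - y)"
  shows "(\<lambda>k. f (X k)) \<in> Cau N"
  unfolding Cau_def
proof (intro CollectI allI impI)
  fix e :: real assume "e > 0"
  then have e: "e/(\<bar>c\<bar> + 1) > 0" by simp
  obtain K where K: "\<forall>i\<ge>K. \<forall>j\<ge>K. N (X i - X j) < e/(\<bar>c\<bar> + 1)"
    using assms e unfolding Cau_def by blast
  have "N (f (X i) - f (X j)) < e" if "i \<ge> K" "j \<ge> K" for i j
  proof -
    have "N (f (X i) - f (X j)) \<le> c * N (X i - X j)" by (rule f)
    also have "\<dots> \<le> (\<bar>c\<bar> + 1) * N (X i - X j)" by (intro mult_right_mono) auto
    also have "\<dots> < (\<bar>c\<bar> + 1) * (e/(\<bar>c\<bar> + 1))" 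
      using K that by (intro mult_strict_left_mono) auto
    also have "\<dots> = e" by (simp add: add_nonneg_eq_0_iff)
    finally show ?thesis .
  qed
  then show "\<exists>K. \<forall>i\<ge>K. \<forall>j\<ge>K. N (f (X i) - f (X j)) < e" by blast
qed

lemma cstar_seminorm_scale_diff: "N (fs_scale c x - fs_scale c y) \<le> cmod c * N (x - y)"
  by (simp add: cstar_seminorm_scale flip: fs_scale_diff)

lemma cstar_seminorm_star_diff: "N (fs_star x - fs_star y) \<le> 1 * N (x - y)"
  by (simp flip: fs_star_diff)

lemma Cau_scale: "X \<in> Cau N \<Longrightarrow> (\<lambda>k. fs_scale c (X k)) \<in> Cau N"
  by (rule Cau_lipschitz[OF _ cstar_seminorm_scale_diff])

lemma Cau_star: "X \<in> Cau N \<Longrightarrow> (\<lambda>k. fs_star (X k)) \<in> Cau N"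
  by (rule Cau_lipschitz[OF _ cstar_seminorm_star_diff])

lemma cstar_seminorm_mult_diff: "N (x * y - x' * y') \<le> N x * N (y - y') + N (x - x') * N y'"
proof -
  have "x * y - x' * y' = x * (y - y') + (x - x') * y'" by (simp add: algebra_simps)
  then show ?thesis
    using cstar_seminorm_add[of "x * (y - y')" "(x - x') * y'"] cstar_seminorm_mult[of x "y - y'"] cstar_seminorm_mult[of "x - x'" y'] by simp
qed

lemma Cau_mult: assumes X: "X \<in> Cau N" and Y: "Y \<in> Cau N" shows "(\<lambda>k. X k * Y k) \<in> Cau N"
  unfolding Cau_def
proof (intro CollectI allI impI)
  fix e :: real assume "e > 0"
  obtain B where B: "B > 0" "\<And>k. N (X k) \<le> B" using Cau_bounded[OF X] by blast
  obtain C where C: "C > 0" "\<And>k. N (Y k) \<le> C" using Cau_bounded[OF Y] by blast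
  have "e/(2*C) > 0" using C \<open>e > 0\<close> by simp
  then obtain K where K: "\<forall>i\<ge>K. \<forall>j\<ge>K. N (X i - X j) < e/(2*C)"
    using X unfolding Cau_def by blast
  have "e/(2*B) > 0" using B \<open>e > 0\<close> by simp
  then obtain L where L: "\<forall>i\<ge>L. \<forall>j\<ge>L. N (Y i - Y j) < e/(2*B)"
    using Y unfolding Cau_def by blast
  have "N (X i * Y i - X j * Y j) < e" if "i \<ge> max K L" "j \<ge> max K L" for i j
  proof -
    have "N (X i * Y i - X j * Y j) \<le> N (X i) * N (Y i - Y j) + N (X i - X j) * N (Y j)"
      by (rule cstar_seminorm_mult_diff)
    also have "\<dots> \<le> B * N (Y i - Y j) + N (X i - X j) * C"
      by (intro add_mono mult_right_mono mult_left_mono B C) auto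
    also have "\<dots> < B * (e/(2*B)) + (e/(2*C)) * C"
      using K L that B C by (intro add_strict_mono mult_strict_left_mono mult_strict_right_mono) auto
    also have "\<dots> = e" using B C by (simp add: field_simps)
    finally show ?thesis .
  qed
  then show "\<exists>K. \<forall>i\<ge>K. \<forall>j\<ge>K. N (X i * Y i - X j * Y j) < e" by blast
qed

lemma null_sandwich:
  assumes "\<And>k. N (f k) \<le> g k" "g \<longlonglongrightarrow> 0" shows "(\<lambda>k. N (f k)) \<longlonglongrightarrow> 0"
  by (rule tendsto_sandwich[OF _ _ tendsto_const assms(2)]) (auto simp: assms(1))

lemma cls_eqI:
  assumes "X \<in> Cau N" "Y \<in> Cau N" and "(\<lambda>k. N (X k - Y k)) \<longlonglongrightarrow> 0"
  shows "cls N X = cls N Y"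
proof -
  have "(\<lambda>k. N (B k - Z k)) \<longlonglongrightarrow> 0"
    if "(\<lambda>k. N (A k - B k)) \<longlonglongrightarrow> 0" "(\<lambda>k. N (A k - Z k)) \<longlonglongrightarrow> 0" for A B Z
  proof (rule null_sandwich)
    show "N (B k - Z k) \<le> N (A k - B k) + N (A k - Z k)" for k
      using cstar_seminorm_triangle[of "B k" "Z k" "A k"] cstar_seminorm_minus_commute[of "A k" "B k"] by simp
    show "(\<lambda>k. N (A k - B k) + N (A k - Z k)) \<longlonglongrightarrow> 0"
      using tendsto_add[OF that] by simp
  qed
  moreover have "(\<lambda>k. N (Y k - X k)) \<longlonglongrightarrow> 0"
    using assms(3) by (simp add: cstar_seminorm_minus_commute)
  ultimately show ?thesis
    using assms unfolding cls_def by blast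
qed

lemma cls_self: "X \<in> Cau N \<Longrightarrow> X \<in> cls N X"
  by (simp add: cls_def)

lemma rep_cls:
  assumes "X \<in> Cau N"
  shows "cls_rep (cls N X) \<in> Cau N" "(\<lambda>k. N (X k - cls_rep (cls N X) k)) \<longlonglongrightarrow> 0"
proof -
  have "cls_rep (cls N X) \<in> cls N X"
    unfolding cls_rep_def by (rule someI[of _ X]) (rule cls_self[OF assms])
  then show "cls_rep (cls N X) \<in> Cau N" "(\<lambda>k. N (X k - cls_rep (cls N X) k)) \<longlonglongrightarrow> 0"
    by (auto simp: cls_def)
qed

lemma rep_cls': 
  assumes "X \<in> Cau N"
  shows "(\<lambda>k. N (cls_rep (cls N X) k - X k)) \<longlonglongrightarrow> 0"
  using rep_cls(2)[OF assms] by (simp add: cstar_seminorm_minus_commute)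

lemma cls_eq_iff:
  assumes "X \<in> Cau N" "Y \<in> Cau N"
  shows "cls N X = cls N Y \<longleftrightarrow> (\<lambda>k. N (X k - Y k)) \<longlonglongrightarrow> 0"
proof
  assume "cls N X = cls N Y"
  then have "Y \<in> cls N X"
    using cls_self[OF assms(2)] by (rule ssubst)
  then show "(\<lambda>k. N (X k - Y k)) \<longlonglongrightarrow> 0"
    by (simp add: cls_def)
qed (rule cls_eqI[OF assms])

private abbreviation "A \<equiv> cstar_completion N"

lemma carrier_completion: "carrier A = cls N ` Cau N" by (simp add: cstar_completion_def)

lemma completionE: assumes "a \<in> carrier A" obtains X where "X \<in> Cau N" "a = cls N X"
  using assms that unfolding carrier_completion by blast

lemma cls_carrier: "X \<in> Cau N \<Longrightarrow> cls N X \<in> carrier A"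
  by (simp add: carrier_completion)

lemma one_completion: "one A = cls N (\<lambda>_. 1)" by (simp add: cstar_completion_def)
lemma zero_completion: "zero A = cls N (\<lambda>_. 0)" by (simp add: cstar_completion_def)

lemma add_completion:
  assumes "X \<in> Cau N" "Y \<in> Cau N"
  shows "add A (cls N X) (cls N Y) = cls N (\<lambda>k. X k + Y k)"
proof -
  let ?X = "cls_rep (cls N X)" and ?Y = "cls_rep (cls N Y)"
  have *: "(\<lambda>k. N (?X k + ?Y k - (X k + Y k))) \<longlonglongrightarrow> 0"
  proof (rule null_sandwich)
    show "N (?X k + ?Y k - (X k + Y k)) \<le> N (?X k - X k) + N (?Y k - Y k)" for k
      using cstar_seminorm_add[of "?X k - X k" "?Y k - Y k"] by (simp add: algebra_simps)
    show "(\<lambda>k. N (?X k - X k) + N (?Y k - Y k)) \<longlonglongrightarrow> 0"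
      using tendsto_add[OF rep_cls' rep_cls', OF assms] by simp
  qed
  show ?thesis
    by (simp add: cstar_completion_def) (intro cls_eqI Cau_add rep_cls(1) assms *)
qed

lemma mult_completion:
  assumes "X \<in> Cau N" "Y \<in> Cau N"
  shows "monoid.mult A (cls N X) (cls N Y) = cls N (\<lambda>k. X k * Y k)"
proof -
  let ?X = "cls_rep (cls N X)" and ?Y = "cls_rep (cls N Y)"
  obtain B where B: "B > 0" "\<And>k. N (?X k) \<le> B" using Cau_bounded[OF rep_cls(1)[OF assms(1)]] by blast
  obtain C where C: "C > 0" "\<And>k. N (Y k) \<le> C" using Cau_bounded[OF assms(2)] by blast
  have *: "(\<lambda>k. N (?X k * ?Y k - (X k * Y k))) \<longlonglongrightarrow> 0"
  proof (rule null_sandwich)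
    show "N (?X k * ?Y k - (X k * Y k)) \<le> B * N (?Y k - Y k) + N (?X k - X k) * C" for k
    proof -
      have "N (?X k * ?Y k - (X k * Y k)) \<le> N (?X k) * N (?Y k - Y k) + N (?X k - X k) * N (Y k)"
        by (rule cstar_seminorm_mult_diff)
      also have "\<dots> \<le> B * N (?Y k - Y k) + N (?X k - X k) * C"
        by (intro add_mono mult_right_mono mult_left_mono B C) auto
      finally show ?thesis .
    qed
    show "(\<lambda>k. B * N (?Y k - Y k) + N (?X k - X k) * C) \<longlonglongrightarrow> 0"
      using tendsto_add[OF tendsto_mult_left[OF rep_cls'] tendsto_mult_right[OF rep_cls'],
          OF assms(2,1), of B C] by simp
  qed
  show ?thesis
    by (simp add: cstar_completion_def) (intro cls_eqI Cau_mult rep_cls(1) assms *)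
qed

lemma smult_completion:
  assumes "X \<in> Cau N"
  shows "smult A c (cls N X) = cls N (\<lambda>k. fs_scale c (X k))"
proof -
  let ?X = "cls_rep (cls N X)"
  have *: "(\<lambda>k. N (fs_scale c (?X k) - fs_scale c (X k))) \<longlonglongrightarrow> 0"
  proof (rule null_sandwich)
    show "N (fs_scale c (?X k) - fs_scale c (X k)) \<le> cmod c * N (?X k - X k)" for k
      by (rule cstar_seminorm_scale_diff)
    show "(\<lambda>k. cmod c * N (?X k - X k)) \<longlonglongrightarrow> 0"
      using tendsto_mult_left[OF rep_cls'[OF assms]] by simp
  qed
  show ?thesis
    by (simp add: cstar_completion_def) (intro cls_eqI Cau_scale rep_cls(1) assms *)
qed

lemma adj_completion:
  assumes "X \<in> Cau N"
  shows "adj A (cls N X) = cls N (\<lambda>k. fs_star (X k))"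
proof -
  let ?X = "cls_rep (cls N X)"
  have *: "(\<lambda>k. N (fs_star (?X k) - fs_star (X k))) \<longlonglongrightarrow> 0"
    using rep_cls'[OF assms] by (simp flip: fs_star_diff)
  show ?thesis
    by (simp add: cstar_completion_def) (intro cls_eqI Cau_star rep_cls(1) assms *)
qed

lemma cstar_seminorm_convergent: assumes "X \<in> Cau N" shows "convergent (\<lambda>k. N (X k))"
proof -
  have "Cauchy (\<lambda>k. N (X k))"
    unfolding Cauchy_def dist_real_def
  proof (intro allI impI)
    fix e :: real assume "e > 0"
    then obtain K where "\<forall>i\<ge>K. \<forall>j\<ge>K. N (X i - X j) < e"
      using assms unfolding Cau_def by blast
    then show "\<exists>M. \<forall>m\<ge>M. \<forall>n\<ge>M. \<bar>N (X m) - N (X n)\<bar> < e"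
      by (meson cstar_seminorm_abs_diff le_less_trans)
  qed
  then show ?thesis by (simp add: Cauchy_convergent_iff)
qed

lemma nrm_completion:
  assumes "X \<in> Cau N"
  shows "(\<lambda>k. N (X k)) \<longlonglongrightarrow> nrm A (cls N X)"
proof -
  let ?X = "cls_rep (cls N X)"
  have 1: "(\<lambda>k. N (?X k)) \<longlonglongrightarrow> nrm A (cls N X)"
    unfolding cstar_completion_def using cstar_seminorm_convergent[OF rep_cls(1)[OF assms]]
    by (simp add: convergent_LIMSEQ_iff)
  have "(\<lambda>k. N (X k) - N (?X k)) \<longlonglongrightarrow> 0"
    using rep_cls(2)[OF assms] cstar_seminorm_abs_diff
    by (rule_tac Lim_null_comparison[where g="\<lambda>k. N (X k - ?X k)"]) auto
  from tendsto_add[OF this 1] show ?thesis by simp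
qed

lemma nrm_const: "nrm A (cls N (\<lambda>_. x)) = N x"
  using nrm_completion[OF Cau_const] by (simp add: LIMSEQ_const_iff)

lemma ring_completion: "ring A"
proof (rule ringI)
  show "abelian_group A"
  proof (rule abelian_groupI; (elim completionE)?)
    show "\<exists>y\<in>carrier A. y \<oplus>\<^bsub>A\<^esub> x = \<zero>\<^bsub>A\<^esub>" if "X \<in> Cau N" "x = cls N X" for x X
      using that Cau_scale[of X "-1"]
      by (intro bexI[of _ "cls N (\<lambda>k. fs_scale (-1) (X k))"])
        (auto simp: add_completion zero_completion carrier_completion fs_scale_def single_uminus)
  qed (auto simp: add_completion zero_completion Cau_add carrier_completion add_ac)
  show "monoid A"
    by (rule monoidI; (elim completionE)?) (auto simp: mult_completion one_completion Cau_mult carrier_completion mult_ac)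
qed (auto elim!: completionE simp: add_completion mult_completion Cau_add Cau_mult carrier_completion algebra_simps)

lemma minus_completion:
  assumes X: "X \<in> Cau N" and Y: "Y \<in> Cau N"
  shows "cls N X \<ominus>\<^bsub>A\<^esub> cls N Y = cls N (\<lambda>k. X k - Y k)"
proof -
  interpret ring A by (rule ring_completion)
  have *: "(\<lambda>k. - Y k) \<in> Cau N"
    using Cau_scale[OF Y, of "-1"] by (simp add: fs_scale_def single_uminus)
  have "cls N (\<lambda>k. - Y k) \<oplus>\<^bsub>A\<^esub> cls N Y = \<zero>\<^bsub>A\<^esub>"
    using Y * by (simp add: add_completion zero_completion)
  then have "\<ominus>\<^bsub>A\<^esub> cls N Y = cls N (\<lambda>k. - Y k)"
    using Y * by (intro minus_equality) (auto simp: carrier_completion)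
  then show ?thesis
    using X * by (simp add: a_minus_def add_completion)
qed

lemma completion_dense:
  assumes "a \<in> carrier A" "e > 0"
  shows "\<exists>x. nrm A (a \<ominus>\<^bsub>A\<^esub> cls N (\<lambda>_. x)) \<le> e"
proof -
  obtain X where X: "X \<in> Cau N" "a = cls N X" using assms(1) by (rule completionE)
  obtain K where K: "\<forall>i\<ge>K. \<forall>j\<ge>K. N (X i - X j) < e" 
    using X \<open>e > 0\<close> unfolding Cau_def by blast
  have C: "(\<lambda>k. X k - X K) \<in> Cau N"
    using X by (simp add: Cau_def)
  have "nrm A (a \<ominus>\<^bsub>A\<^esub> cls N (\<lambda>_. X K)) \<le> e"
    unfolding X minus_completion[OF X(1) Cau_const]
    by (rule LIMSEQ_le_const2[OF nrm_completion[OF C]]) (use K in \<open>auto intro!: exI[of _ K] less_imp_le\<close>)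
  then show ?thesis by blast
qed

lemma nrm_triangle_completion: 
  assumes "x \<in> carrier A" "y \<in> carrier A" "z \<in> carrier A"
  shows "nrm A (x \<ominus>\<^bsub>A\<^esub> z) \<le> nrm A (x \<ominus>\<^bsub>A\<^esub> y) + nrm A (y \<ominus>\<^bsub>A\<^esub> z)"
proof -
  obtain X Y Z where X: "X \<in> Cau N" "x = cls N X" and Y: "Y \<in> Cau N" "y = cls N Y" and Z: "Z \<in> Cau N" "z = cls N Z"
    using assms by (elim completionE) auto
  have m: "(\<lambda>k. U k - V k) \<in> Cau N" if "U \<in> Cau N" "V \<in> Cau N" for U V
    using Cau_add[OF that(1) Cau_scale[OF that(2), of "-1"]] by (simp add: fs_scale_def single_uminus)
  have "nrm A (cls N (\<lambda>k. X k - Z k)) \<le> nrm A (cls N (\<lambda>k. X k - Y k)) + nrm A (cls N (\<lambda>k. Y k - Z k))"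
    by (rule LIMSEQ_le[OF nrm_completion tendsto_add[OF nrm_completion nrm_completion]]) (auto simp: m X Y Z cstar_seminorm_triangle)
  then show ?thesis using X Y Z by (simp add: minus_completion)
qed

lemma nrm_minus_commute_completion:
  assumes "x \<in> carrier A" "y \<in> carrier A"
  shows "nrm A (x \<ominus>\<^bsub>A\<^esub> y) = nrm A (y \<ominus>\<^bsub>A\<^esub> x)"
proof -
  obtain X Y where X: "X \<in> Cau N" "x = cls N X" and Y: "Y \<in> Cau N" "y = cls N Y"
    using assms by (elim completionE) auto
  have m: "(\<lambda>k. U k - V k) \<in> Cau N" if "U \<in> Cau N" "V \<in> Cau N" for U V
    using Cau_add[OF that(1) Cau_scale[OF that(2), of "-1"]] by (simp add: fs_scale_def single_uminus)
  have "(\<lambda>k. N (X k - Y k)) = (\<lambda>k. N (Y k - X k))" by (simp add: cstar_seminorm_minus_commute)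
  then show ?thesis using nrm_completion[OF m[of X Y]] nrm_completion[OF m[of Y X]] X Y
    by (simp add: minus_completion LIMSEQ_unique)
qed

lemma completion_complete:
  assumes a: "\<And>k. a k \<in> carrier A"
    and C: "\<forall>e>0. \<exists>K. \<forall>i\<ge>K. \<forall>j\<ge>K. nrm A (a i \<ominus>\<^bsub>A\<^esub> a j) < e"
  shows "\<exists>l\<in>carrier A. (\<lambda>k. nrm A (a k \<ominus>\<^bsub>A\<^esub> l)) \<longlonglongrightarrow> 0"
proof -
  interpret ring A by (rule ring_completion)
  have "\<exists>x. nrm A (a k \<ominus>\<^bsub>A\<^esub> cls N (\<lambda>_. x)) \<le> inverse (real (Suc k))" for k
    by (rule completion_dense[OF a]) simp
  then obtain Y where Y: "\<And>k. nrm A (a k \<ominus>\<^bsub>A\<^esub> cls N (\<lambda>_. Y k)) \<le> inverse (real (Suc k))"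
    by metis
  have i: "cls N (\<lambda>_. x) \<in> carrier A" for x by (simp add: carrier_completion)
  have lt: "\<exists>K. \<forall>k\<ge>K. inverse (real (Suc k)) < e" if "e > 0" for e
    using LIMSEQ_inverse_real_of_nat that unfolding LIMSEQ_iff by fastforce
  have YC: "Y \<in> Cau N"
    unfolding Cau_def
  proof (intro CollectI allI impI)
    fix e :: real assume "e > 0"
    then have e: "e/3 > 0" by simp
    obtain K where K: "\<forall>i\<ge>K. \<forall>j\<ge>K. nrm A (a i \<ominus>\<^bsub>A\<^esub> a j) < e/3" using C e by blast
    obtain L where L: "\<forall>k\<ge>L. inverse (real (Suc k)) < e/3" using lt e by blast
    have "N (Y i - Y j) < e" if "i \<ge> max K L" "j \<ge> max K L" for i j
    proof -
      have "N (Y i - Y j) = nrm A (cls N (\<lambda>_. Y i) \<ominus>\<^bsub>A\<^esub> cls N (\<lambda>_. Y j))"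
        by (simp add: minus_completion nrm_const)
      also have "\<dots> \<le> nrm A (cls N (\<lambda>_. Y i) \<ominus>\<^bsub>A\<^esub> a i) + (nrm A (a i \<ominus>\<^bsub>A\<^esub> a j) + nrm A (a j \<ominus>\<^bsub>A\<^esub> cls N (\<lambda>_. Y j)))"
        using nrm_triangle_completion[OF i[of "Y i"] a[of i] i[of "Y j"]] nrm_triangle_completion[OF a[of i] a[of j] i[of "Y j"]] by linarith
      also have "\<dots> < e"
        using K[rule_format, of i j] L[rule_format, of i] L[rule_format, of j] Y[of i] Y[of j] that
          nrm_minus_commute_completion[OF i[of "Y i"] a[of i]] by auto
      finally show ?thesis .
    qed
    then show "\<exists>K. \<forall>i\<ge>K. \<forall>j\<ge>K. N (Y i - Y j) < e" by blast
  qed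
  show ?thesis
  proof (intro bexI[of _ "cls N Y"])
    show "(\<lambda>k. nrm A (a k \<ominus>\<^bsub>A\<^esub> cls N Y)) \<longlonglongrightarrow> 0"
      unfolding LIMSEQ_iff
    proof (intro allI impI)
      fix e :: real assume "e > 0"
      then have e: "e/3 > 0" by simp
      obtain K where K: "\<forall>i\<ge>K. \<forall>j\<ge>K. N (Y i - Y j) < e/3" using YC e unfolding Cau_def by blast
      obtain L where L: "\<forall>k\<ge>L. inverse (real (Suc k)) < e/3" using lt e by blast
      have "norm (nrm A (a k \<ominus>\<^bsub>A\<^esub> cls N Y) - 0) < e" if k: "k \<ge> max K L" for k
      proof -
        have C': "(\<lambda>i. Y k - Y i) \<in> Cau N"
          using YC cstar_seminorm_minus_commute by (simp add: Cau_def)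
        have 1: "nrm A (cls N (\<lambda>_. Y k) \<ominus>\<^bsub>A\<^esub> cls N Y) \<le> e/3"
          unfolding minus_completion[OF Cau_const YC]
          by (rule LIMSEQ_le_const2[OF nrm_completion[OF C']]) (use K k in \<open>auto intro!: exI[of _ K] less_imp_le\<close>)
        have 2: "nrm A (a k \<ominus>\<^bsub>A\<^esub> cls N Y) \<ge> 0"
        proof -
          obtain Z where Z: "Z \<in> Cau N" "a k \<ominus>\<^bsub>A\<^esub> cls N Y = cls N Z"
            using minus_closed[OF a cls_carrier[OF YC]] by (rule completionE)
          show ?thesis unfolding Z by (rule LIMSEQ_le_const[OF nrm_completion[OF Z(1)]]) auto
        qed
        have "nrm A (a k \<ominus>\<^bsub>A\<^esub> cls N Y) \<le> nrm A (a k \<ominus>\<^bsub>A\<^esub> cls N (\<lambda>_. Y k)) + nrm A (cls N (\<lambda>_. Y k) \<ominus>\<^bsub>A\<^esub> cls N Y)"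
          by (rule nrm_triangle_completion[OF a i cls_carrier[OF YC]])
        also have "\<dots> < e" using 1 Y[of k] L[rule_format, of k] k e by auto
        finally show ?thesis using 2 by simp
      qed
      then show "\<exists>no. \<forall>k\<ge>no. norm (nrm A (a k \<ominus>\<^bsub>A\<^esub> cls N Y) - 0) < e" by blast
    qed
  qed (rule cls_carrier[OF YC])
qed

lemma cstar_algebra_completion: "cstar_algebra A"
proof -
  interpret ring A by (rule ring_completion)
  show ?thesis
  proof (unfold_locales, goal_cases)
    case (17 x) then show ?case by (auto elim!: completionE intro: LIMSEQ_le_const[OF nrm_completion])
  next
    case (18 x)
    then obtain X where X: "X \<in> Cau N" "x = cls N X" by (rule completionE)
    have "nrm A x = 0 \<longleftrightarrow> (\<lambda>k. N (X k)) \<longlonglongrightarrow> 0"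
      using nrm_completion[OF X(1)] X(2) LIMSEQ_unique by auto
    also have "\<dots> \<longleftrightarrow> x = \<zero>\<^bsub>A\<^esub>"
      using X by (simp add: zero_completion cls_eq_iff)
    finally show ?case .
  next
    case (19 x y)
    then obtain X Y where X: "X \<in> Cau N" "x = cls N X" and Y: "Y \<in> Cau N" "y = cls N Y"
      by (elim completionE)
    show ?case unfolding X Y add_completion[OF X(1) Y(1)]
      by (rule LIMSEQ_le[OF nrm_completion tendsto_add[OF nrm_completion nrm_completion]]) (auto simp: X Y Cau_add cstar_seminorm_add)
  next
    case (20 x c)
    then obtain X where X: "X \<in> Cau N" "x = cls N X" by (rule completionE)
    show ?case unfolding X smult_completion[OF X(1)]
      by (rule LIMSEQ_unique[OF nrm_completion[OF Cau_scale[OF X(1)]]])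
        (simp add: cstar_seminorm_scale tendsto_mult_left nrm_completion X)
  next
    case (21 x y)
    then obtain X Y where X: "X \<in> Cau N" "x = cls N X" and Y: "Y \<in> Cau N" "y = cls N Y"
      by (elim completionE)
    show ?case unfolding X Y mult_completion[OF X(1) Y(1)]
      by (rule LIMSEQ_le[OF nrm_completion tendsto_mult[OF nrm_completion nrm_completion]]) (auto simp: X Y Cau_mult cstar_seminorm_mult)
  next
    case (22 x)
    then obtain X where X: "X \<in> Cau N" "x = cls N X" by (rule completionE)
    show ?case unfolding X adj_completion[OF X(1)] mult_completion[OF Cau_star[OF X(1)] X(1)]
      by (rule LIMSEQ_unique[OF nrm_completion[OF Cau_mult[OF Cau_star[OF X(1)] X(1)]]])
        (simp add: cstar_seminorm_cstar tendsto_power nrm_completion X)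
  next
    case (23 X) then show ?case by (rule completion_complete)
  qed (auto elim!: completionE simp: add_completion mult_completion smult_completion adj_completion Cau_add Cau_mult Cau_scale Cau_star cls_carrier
     algebra_simps fs_scale_add_left fs_scale_add fs_scale_scale fs_scale_mult_left fs_scale_mult_right
     fs_star_add fs_star_scale fs_star_mult)
qed

end

declare cstar_seminorm_nonneg [simp del] cstar_seminorm_0 [simp del] cstar_seminorm_uminus [simp del]
  cstar_seminorm_star [simp del] Cau_const [simp del]

definition univ_cstar_algebra :: "'g free_star_alg set \<Rightarrow> 'g univ_cstar" where
  "univ_cstar_algebra R = cstar_completion (univ_seminorm R)"

text \<open>The canonical *-homomorphism from the free *-algebra.\<close>

definition univ_embed ::
  "'g free_star_alg set \<Rightarrow> 'g free_star_alg \<Rightarrow> (nat \<Rightarrow> 'g free_star_alg) set" where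
  "univ_embed R x = cls (univ_seminorm R) (\<lambda>_. x)"


lemma rel_seminorms_nonempty: "(\<lambda>_. 0) \<in> rel_seminorms R"
  by (simp add: rel_seminorms_def cstar_seminorm_def)

lemma cstar_seminorm_univ:
  assumes bdd: "\<And>x. bdd_above ((\<lambda>p. p x) ` rel_seminorms R)"
  shows "cstar_seminorm (univ_seminorm R)"
proof -
  let ?N = "univ_seminorm R"
  have ne: "rel_seminorms R \<noteq> {}" using rel_seminorms_nonempty[of R] by blast
  have up: "p x \<le> ?N x" if "p \<in> rel_seminorms R" for p x
    unfolding univ_seminorm_def by (rule cSUP_upper[OF that bdd])
  have least: "?N x \<le> c" if "\<And>p. p \<in> rel_seminorms R \<Longrightarrow> p x \<le> c" for x c
    unfolding univ_seminorm_def by (rule cSUP_least[OF ne that])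
  have p: "0 \<le> p x" "p (x + y) \<le> p x + p y" "p (fs_scale c x) = cmod c * p x"
    "p (x * y) \<le> p x * p y" "p (fs_star x * x) = (p x)\<^sup>2" if "p \<in> rel_seminorms R" for p x y c
    using that by (auto simp: rel_seminorms_def cstar_seminorm_def)
  have nonneg: "0 \<le> ?N x" for x
    using up[OF rel_seminorms_nonempty] by simp
  have scale: "?N (fs_scale c x) \<le> cmod c * ?N x" for c x
    by (rule least) (simp add: p up mult_left_mono)
  show ?thesis
    unfolding cstar_seminorm_def
  proof (intro conjI allI)
    show "?N (x + y) \<le> ?N x + ?N y" for x y
      by (rule least) (meson add_mono order_trans p(2) up)
    show "?N (fs_scale c x) = cmod c * ?N x" for c x
    proof (rule antisym[OF scale])
      show "cmod c * ?N x \<le> ?N (fs_scale c x)"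
      proof (cases "c = 0")
        case False
        have "?N x \<le> cmod (inverse c) * ?N (fs_scale c x)"
          using scale[of "inverse c" "fs_scale c x"] False by (simp flip: fs_scale_scale)
        then show ?thesis using False by (simp add: norm_divide field_simps)
      qed (simp add: nonneg)
    qed
    show "?N (x * y) \<le> ?N x * ?N y" for x y
      by (rule least) (meson mult_mono nonneg order_trans p(1,4) up)
    show "?N (fs_star x * x) = (?N x)\<^sup>2" for x
    proof (rule antisym)
      show "?N (fs_star x * x) \<le> (?N x)\<^sup>2"
        by (rule least) (simp add: p up power_mono)
      have "?N x \<le> sqrt (?N (fs_star x * x))"
        by (rule least) (metis p(1,5) real_le_rsqrt up)
      then show "(?N x)\<^sup>2 \<le> ?N (fs_star x * x)"
        using nonneg by (metis real_sqrt_le_iff real_sqrt_pow2 power_mono)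
    qed
  qed (rule nonneg)
qed

lemma univ_seminorm_upper:
  assumes bdd: "\<And>x. bdd_above ((\<lambda>p. p x) ` rel_seminorms R)" and "p \<in> rel_seminorms R"
  shows "p x \<le> univ_seminorm R x"
  unfolding univ_seminorm_def by (rule cSUP_upper[OF assms(2) bdd])

lemma fs_gen_star_word: "fs_star (fs_gen g) = Poly_Mapping.single (StarWord [(g, True)]) 1"
  by (simp add: fs_gen_def fs_star_single word_star_def)

lemma cstar_seminorm_sum:
  assumes "cstar_seminorm p"
  shows "p (sum f I) \<le> (\<Sum>i\<in>I. p (f i))"
proof (induction I rule: infinite_finite_induct)
  case (insert i I)
  then show ?case using cstar_seminorm_add[OF assms, of "f i" "sum f I"] by simp
qed (simp_all add: cstar_seminorm_0[OF assms])

lemma bdd_above_isometric_gens: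
  assumes R: "\<And>g. fs_star (fs_gen g) * fs_gen g - 1 \<in> R"
  shows "bdd_above ((\<lambda>p. p x) ` rel_seminorms R)"
proof (rule bdd_aboveI2)
  fix p assume "p \<in> rel_seminorms R"
  then have p: "cstar_seminorm p" and r: "\<And>g. p (fs_star (fs_gen g) * fs_gen g - 1) = 0"
    using R by (auto simp: rel_seminorms_def)
  have "p 1 = p 1 * p 1" using cstar_seminorm_cstar[OF p, of 1] by (simp add: power2_eq_square)
  then have one: "p 1 \<le> 1" by auto
  have gen: "p (fs_gen g) \<le> 1" for g
  proof -
    have "(p (fs_gen g))\<^sup>2 \<le> 1"
      using cstar_seminorm_add[OF p, of "fs_star (fs_gen g) * fs_gen g - 1" 1] r[of g] cstar_seminorm_cstar[OF p, of "fs_gen g"] one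
      by simp
    then have "(p (fs_gen g))\<^sup>2 \<le> 1\<^sup>2" by simp
    then show ?thesis by (rule power2_le_imp_le) simp
  qed
  have letter: "p (Poly_Mapping.single (StarWord [l]) 1) \<le> 1" for l
  proof (cases l)
    case (Pair g b)
    show ?thesis using gen[of g] cstar_seminorm_star[OF p, of "fs_gen g"] Pair
      by (cases b) (auto simp: fs_gen_star_word fs_gen_def[symmetric])
  qed
  have word: "p (Poly_Mapping.single (StarWord ls) 1) \<le> 1" for ls
  proof (induction ls)
    case Nil
    then show ?case using one by (simp flip: zero_star_word_def)
  next
    case (Cons l ls)
    have "Poly_Mapping.single (StarWord (l # ls)) 1 =
        Poly_Mapping.single (StarWord [l]) 1 * Poly_Mapping.single (StarWord ls) (1 :: complex)"
      by (simp add: mult_single plus_star_word_def)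
    then have "p (Poly_Mapping.single (StarWord (l # ls)) 1) \<le>
        p (Poly_Mapping.single (StarWord [l]) 1) * p (Poly_Mapping.single (StarWord ls) 1)"
      using cstar_seminorm_mult[OF p] by metis
    also have "\<dots> \<le> 1" using letter Cons by (intro mult_le_one cstar_seminorm_nonneg[OF p])
    finally show ?case .
  qed
  have single: "p (Poly_Mapping.single w c) \<le> cmod c" for w c
  proof -
    have "Poly_Mapping.single w c = fs_scale c (Poly_Mapping.single w 1)"
      by (simp add: fs_scale_single)
    then have "p (Poly_Mapping.single w c) = cmod c * p (Poly_Mapping.single w 1)"
      using cstar_seminorm_scale[OF p] by metis
    also have "\<dots> \<le> cmod c" using word[of "letters w"] by (simp add: mult_left_le)
    finally show ?thesis .
  qed
  have "p x = p (\<Sum>w\<in>Poly_Mapping.keys x. Poly_Mapping.single w (Poly_Mapping.lookup x w))"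
    by (simp only: sum_single[symmetric])
  also have "\<dots> \<le> (\<Sum>w\<in>Poly_Mapping.keys x. p (Poly_Mapping.single w (Poly_Mapping.lookup x w)))"
    by (rule cstar_seminorm_sum[OF p])
  also have "\<dots> \<le> (\<Sum>w\<in>Poly_Mapping.keys x. cmod (Poly_Mapping.lookup x w))"
    by (intro sum_mono single)
  finally show "p x \<le> (\<Sum>w\<in>Poly_Mapping.keys x. cmod (Poly_Mapping.lookup x w))" .
qed

text \<open>
  The universal property. It applies to arbitrary C*-algebras \<^term>\<open>B\<close>; the image of the unit is
  \<open>\<pi> 1\<close>, so \<open>f\<close> is unital whenever \<open>\<pi>\<close> is.
\<close>

theorem univ_cstar_algebra_universal:
  assumes bdd: "\<And>x. bdd_above ((\<lambda>p. p x) ` rel_seminorms R)"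
    and B: "cstar_algebra B"
    and closed: "\<And>x. \<pi> x \<in> carrier B"
    and add: "\<And>x y. \<pi> (x + y) = \<pi> x \<oplus>\<^bsub>B\<^esub> \<pi> y"
    and mult: "\<And>x y. \<pi> (x * y) = \<pi> x \<otimes>\<^bsub>B\<^esub> \<pi> y"
    and scale: "\<And>c x. \<pi> (fs_scale c x) = c \<odot>\<^bsub>B\<^esub> \<pi> x"
    and star: "\<And>x. \<pi> (fs_star x) = adj B (\<pi> x)"
    and rel: "\<And>r. r \<in> R \<Longrightarrow> \<pi> r = \<zero>\<^bsub>B\<^esub>"
  shows "\<exists>f. cstar_hom (univ_cstar_algebra R) B f \<and> (\<forall>x. f (univ_embed R x) = \<pi> x)"
proof -
  interpret B: cstar_algebra B by (rule B)
  let ?N = "univ_seminorm R"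
  note N = cstar_seminorm_univ[of R, OF bdd]
  have "(\<lambda>x. nrm B (\<pi> x)) \<in> rel_seminorms R"
    by (auto simp: rel_seminorms_def cstar_seminorm_def closed add mult scale star rel
        B.nrm_nonneg B.nrm_add B.nrm_smult B.nrm_mult B.nrm_cstar B.nrm_0)
  from univ_seminorm_upper[OF bdd this] have le: "nrm B (\<pi> x) \<le> ?N x" for x .
  have diff: "\<pi> (x - y) = \<pi> x \<ominus>\<^bsub>B\<^esub> \<pi> y" for x y
    using add[of x "fs_scale (-1) y"] scale[of "-1" y] B.minus_eq_smult[OF closed, of "\<pi> x" y]
    by (simp add: fs_scale_def single_uminus)
  have ex: "\<exists>l. B.has_limit (\<lambda>k. \<pi> (X k)) l" if X: "X \<in> Cau ?N" for X
  proof -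
    have "\<forall>e>0. \<exists>K. \<forall>i\<ge>K. \<forall>j\<ge>K. nrm B (\<pi> (X i) \<ominus>\<^bsub>B\<^esub> \<pi> (X j)) < e"
      using X le unfolding Cau_def diff[symmetric] mem_Collect_eq by (meson le_less_trans)
    from B.nrm_complete[of "\<lambda>k. \<pi> (X k)", OF closed this] show ?thesis
      by (auto simp: B.has_limit_def closed)
  qed
  define f where "f a = (SOME l. B.has_limit (\<lambda>k. \<pi> (cls_rep a k)) l)" for a
  have f: "f (cls ?N X) = l" if X: "X \<in> Cau ?N" and l: "B.has_limit (\<lambda>k. \<pi> (X k)) l" for X l
  proof -
    let ?X = "cls_rep (cls ?N X)"
    have "B.has_limit (\<lambda>k. \<pi> (?X k)) (f (cls ?N X))"
      unfolding f_def by (rule someI_ex[OF ex[OF rep_cls(1)[OF N X]]])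
    moreover have "B.has_limit (\<lambda>k. \<pi> (?X k)) l"
    proof (rule B.has_limit_sandwich)
      have lc: "l \<in> carrier B" using l by (simp add: B.has_limit_def)
      then show "l \<in> carrier B" .
      show "nrm B (\<pi> (?X k) \<ominus>\<^bsub>B\<^esub> l) \<le> ?N (?X k - X k) + nrm B (\<pi> (X k) \<ominus>\<^bsub>B\<^esub> l)" for k
        using B.nrm_triangle[OF closed closed lc, of "?X k" "X k"] le[of "?X k - X k"]
        by (simp add: diff)
      show "(\<lambda>k. ?N (?X k - X k) + nrm B (\<pi> (X k) \<ominus>\<^bsub>B\<^esub> l)) \<longlonglongrightarrow> 0"
        using tendsto_add[OF rep_cls'[OF N X], of "\<lambda>k. nrm B (\<pi> (X k) \<ominus>\<^bsub>B\<^esub> l)" 0] l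
        by (simp add: B.has_limit_def)
    qed (rule closed)
    ultimately show ?thesis by (rule B.has_limit_unique)
  qed
  have lim: "B.has_limit (\<lambda>k. \<pi> (X k)) (f (cls ?N X))" if "X \<in> Cau ?N" for X
    using ex[OF that] f[OF that] by auto
  have "cstar_hom (univ_cstar_algebra R) B f"
    unfolding cstar_hom_def univ_cstar_algebra_def
  proof (intro conjI ballI allI funcsetI; (elim completionE[OF N])?; hypsubst)
    show "f (cls ?N X) \<in> carrier B" if "X \<in> Cau ?N" for X
      using lim[OF that] by (simp add: B.has_limit_def)
    show "f (cls ?N X \<oplus>\<^bsub>cstar_completion ?N\<^esub> cls ?N Y) = f (cls ?N X) \<oplus>\<^bsub>B\<^esub> f (cls ?N Y)"
      if "X \<in> Cau ?N" "Y \<in> Cau ?N" for X Y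
      unfolding add_completion[OF N that]
      by (rule f[OF Cau_add[OF N that]]) (unfold add, intro B.has_limit_add lim that)
    show "f (cls ?N X \<otimes>\<^bsub>cstar_completion ?N\<^esub> cls ?N Y) = f (cls ?N X) \<otimes>\<^bsub>B\<^esub> f (cls ?N Y)"
      if "X \<in> Cau ?N" "Y \<in> Cau ?N" for X Y
      unfolding mult_completion[OF N that]
      by (rule f[OF Cau_mult[OF N that]]) (unfold mult, intro B.has_limit_mult lim that)
    show "f (c \<odot>\<^bsub>cstar_completion ?N\<^esub> cls ?N X) = c \<odot>\<^bsub>B\<^esub> f (cls ?N X)"
      if "X \<in> Cau ?N" for X c
      unfolding smult_completion[OF N that]
      by (rule f[OF Cau_scale[OF N that]]) (unfold scale, intro B.has_limit_smult lim that)
    show "f (adj (cstar_completion ?N) (cls ?N X)) = adj B (f (cls ?N X))"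
      if "X \<in> Cau ?N" for X
      unfolding adj_completion[OF N that]
      by (rule f[OF Cau_star[OF N that]]) (unfold star, intro B.has_limit_adj lim that)
  qed
  moreover have "f (univ_embed R x) = \<pi> x" for x
    unfolding univ_embed_def by (rule f[OF Cau_const[OF N] B.has_limit_const[OF closed]])
  ultimately show ?thesis by blast
qed


section \<open>The algebra E and its ideal M\<close>

text \<open>
  The indices of the generators \<open>s\<^sub>i\<close> and \<open>t\<^sub>r\<close> range over finite types \<^typ>\<open>'n\<close> and \<^typ>\<open>'m\<close>,
  so that \<open>n\<close> and \<open>m\<close> are \<open>CARD('n)\<close> and \<open>CARD('m)\<close>.
\<close>

definition s_gen :: "'n \<Rightarrow> ('n + 'm) free_star_alg" where
  "s_gen i = fs_gen (Inl i)"

definition t_gen :: "'m \<Rightarrow> ('n + 'm) free_star_alg" where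
  "t_gen r = fs_gen (Inr r)"

definition E_relations :: "complex \<Rightarrow> ('n + 'm) free_star_alg set" where
  "E_relations q =
     {fs_star (s_gen i) * s_gen j - (if i = j then 1 else 0) | i j. True} \<union>
     {fs_star (t_gen r) * t_gen l - (if r = l then 1 else 0) | r l. True} \<union>
     {fs_star (s_gen j) * t_gen r - fs_scale q (t_gen r * fs_star (s_gen j)) | j r. True}"

definition E_alg :: "complex \<Rightarrow> ('n + 'm) univ_cstar" where
  "E_alg q = univ_cstar_algebra (E_relations q)"

definition M_alg :: "complex \<Rightarrow> ('n::finite + 'm::finite) univ_cstar" where
  "M_alg q = (E_alg q)
    \<lparr>carrier := gen_closed_ideal (E_alg q)
       {univ_embed (E_relations q) (1 - (\<Sum>j\<in>UNIV. s_gen j * fs_star (s_gen j))),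
        univ_embed (E_relations q) (1 - (\<Sum>r\<in>UNIV. t_gen r * fs_star (t_gen r)))}\<rparr>"

lemma bdd_above_E_seminorms: "bdd_above ((\<lambda>p. p x) ` rel_seminorms (E_relations q))"
proof (rule bdd_above_isometric_gens)
  show "fs_star (fs_gen g) * fs_gen g - 1 \<in> E_relations q" for g :: "'a + 'b"
  proof (cases g)
    case (Inl i)
    then show ?thesis by (force simp: E_relations_def s_gen_def)
  next
    case (Inr r)
    then show ?thesis by (force simp: E_relations_def t_gen_def)
  qed
qed

theorem ring_E_alg: "ring (E_alg q)"
  unfolding E_alg_def univ_cstar_algebra_def
  by (rule ring_completion[OF cstar_seminorm_univ[OF bdd_above_E_seminorms]])

theorem cstar_algebra_E_alg: "cstar_algebra (E_alg q)"
  unfolding E_alg_def univ_cstar_algebra_def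
  by (rule cstar_algebra_completion[OF cstar_seminorm_univ[OF bdd_above_E_seminorms]])

theorem cstar_algebra_M_alg: "cstar_algebra (M_alg q :: ('n::finite + 'm::finite) univ_cstar)"
proof -
  let ?R = "E_relations q :: ('n + 'm) free_star_alg set" and ?E = "E_alg q :: ('n + 'm) univ_cstar"
  note N = cstar_seminorm_univ[of ?R, OF bdd_above_E_seminorms]
  have adj: "adj ?E (univ_embed ?R x) = univ_embed ?R (fs_star x)" for x
    by (simp add: E_alg_def univ_cstar_algebra_def univ_embed_def
        adj_completion[OF N Cau_const[OF N]])
  have closed: "univ_embed ?R x \<in> carrier ?E" for x
    by (simp add: E_alg_def univ_cstar_algebra_def univ_embed_def cls_carrier[OF N Cau_const[OF N]])
  show ?thesis
    unfolding M_alg_def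
    by (rule cstar_algebra.gen_closed_ideal_cstar_algebra[OF cstar_algebra_E_alg ring_E_alg])
      (auto simp: closed adj fs_star_diff fs_star_sum fs_star_mult)
qed

end

theory Submission
  imports Defs
begin

text \<open>
  The generators can be modified by phases so that the commutation constant changes. Picture
  Fock space, with basis the pairs of a word in the letters \<open>s\<close> and a word in the letters \<open>t\<close>,
  and let \<open>N\<close> and \<open>N'\<close> be the operators measuring the lengths of the two words. For \<open>\<bar>r\<bar> = 1\<close>
  put \<open>S\<^sub>j = s\<^sub>j r\<^bsup>-min (N + 1) N'\<^esup>\<close> and \<open>T\<^sub>l = t\<^sub>l r\<^bsup>min N N'\<^esup>\<close>. Moving the two phases past
  the generators shows that \<open>S\<^sub>j\<close> and \<open>T\<^sub>l\<close> satisfy the relations with the constant \<open>q r\<close> if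
  \<open>s\<^sub>j\<close> and \<open>t\<^sub>l\<close> satisfy them with the constant \<open>q\<close>, and the modification by \<open>r\<^bsup>-1\<^esup>\<close> undoes
  the one by \<open>r\<close>. There are simpler phases with this effect, such as \<open>r\<^sup>N\<close> on \<open>t\<^sub>l\<close> alone; the
  point of the minimum is that it becomes constant when one of \<open>N\<close>, \<open>N'\<close> is bounded and the
  other one tends to infinity. Hence the phases multiply the ideal \<open>M\<close> into itself, although
  for \<open>r \<noteq> 1\<close> they do not belong to the algebra, having no limit when both \<open>N\<close> and \<open>N'\<close> tend
  to infinity.

  No representation is needed to make this precise. The projection onto \<open>N \<ge> k\<close> and \<open>N' \<ge> l\<close>
  is a polynomial in the generators (\<open>tail_proj k l\<close>); the projections \<open>cutoff L\<close>, the
  complements of \<open>tail_proj L L\<close>, form an approximate unit of \<open>M\<close>. Truncating the exponents at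
  \<open>K\<close> gives elements \<open>deform r K\<close> of the algebra, hence a substitution \<open>\<pi>\<^sub>K\<close> on the free
  *-algebra. It does not respect the relations, but for each \<open>x\<close> and \<open>L\<close> the product of
  \<open>\<pi>\<^sub>K x\<close> with \<open>cutoff L\<close> is independent of \<open>K\<close> once \<open>K\<close> is large (\<open>subst_near_cutoff\<close>), and
  in this sense the relations for \<open>q r\<close> hold in the limit (\<open>deform_s_star_t\<close>).

  The norm of the universal algebra is the largest C*-seminorm that annihilates the relations.
  Taking the limit in \<open>K\<close> and the supremum over \<open>L\<close> of the norm, for \<open>q\<close>, of \<open>\<pi>\<^sub>K x\<close> times
  \<open>cutoff L\<close> gives a C*-seminorm that annihilates the relations for \<open>q r\<close>
  (\<open>deformed_norm_rel_seminorm\<close>); this is the norm of \<open>x\<close> acting on \<open>M\<close> by left multiplication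
  through the deformed generators. Therefore \<open>\<pi>\<^sub>K\<close>, for large \<open>K\<close>, does not increase the norm
  of an element supported on a cutoff (\<open>E_norm_deform_le\<close>). The same holds for the deformation
  by \<open>r\<^bsup>-1\<^esup>\<close>, so that the elements \<open>x\<close> and \<open>\<pi>\<^sub>K x\<close> correspond isometrically. Elements
  supported on a cutoff are dense in the two ideals (\<open>M_alg_dense\<close>), and the closure of the
  correspondence is the graph of an isomorphism (\<open>isometric_correspondence.cstar_isomorphic\<close>).
  With \<open>r = q / q'\<close> this connects any two parameters.
\<close>

section \<open>Substitution homomorphisms of the free *-algebra\<close>

definition letter_image :: "('g \<Rightarrow> 'h free_star_alg) \<Rightarrow> 'g \<times> bool \<Rightarrow> 'h free_star_alg" where
  "letter_image a l = (if snd l then fs_star (a (fst l)) else a (fst l))"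

definition word_image :: "('g \<Rightarrow> 'h free_star_alg) \<Rightarrow> 'g star_word \<Rightarrow> 'h free_star_alg" where
  "word_image a w = prod_list (map (letter_image a) (letters w))"

text \<open>
  The unital *-homomorphism out of the free *-algebra with prescribed values on the
  generators.
\<close>

definition subst :: "('g \<Rightarrow> 'h free_star_alg) \<Rightarrow> 'g free_star_alg \<Rightarrow> 'h free_star_alg" where
  "subst a x = (\<Sum>w\<in>Poly_Mapping.keys x. fs_scale (Poly_Mapping.lookup x w) (word_image a w))"

lemma fs_scale_0_left [simp]: "fs_scale 0 x = 0"
  by (simp add: fs_scale_def)

lemma fs_scale_left_commute: "fs_scale c (fs_scale d x) = fs_scale d (fs_scale c x)"
  by (simp add: mult.commute flip: fs_scale_scale)

lemma word_image_0 [simp]: "word_image a 0 = 1"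
  by (simp add: word_image_def zero_star_word_def)

lemma word_image_add: "word_image a (v + w) = word_image a v * word_image a w"
  by (simp add: word_image_def plus_star_word_def)

lemma fs_star_prod_list: "fs_star (prod_list xs) = prod_list (rev (map fs_star xs))"
  by (induction xs) (simp_all add: fs_star_mult)

lemma word_image_star: "word_image a (word_star w) = fs_star (word_image a w)"
  by (simp add: word_image_def word_star_def fs_star_prod_list rev_map)
    (rule arg_cong[of _ _ "\<lambda>f. prod_list (map f (rev (letters w)))"], auto simp: letter_image_def)

lemma subst_superset:
  assumes "finite W" "Poly_Mapping.keys x \<subseteq> W"
  shows "subst a x = (\<Sum>w\<in>W. fs_scale (Poly_Mapping.lookup x w) (word_image a w))"
  unfolding subst_def using assms
  by (intro sum.mono_neutral_left) (auto simp: in_keys_iff)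

lemma subst_single: "subst a (Poly_Mapping.single w c) = fs_scale c (word_image a w)"
  by (simp add: subst_superset[of "{w}"])

lemma subst_add: "subst a (x + y) = subst a x + subst a y"
proof -
  let ?W = "Poly_Mapping.keys x \<union> Poly_Mapping.keys y"
  have "Poly_Mapping.keys (x + y) \<subseteq> ?W" by (rule Poly_Mapping.keys_add)
  then show ?thesis
    by (simp add: subst_superset[of ?W] lookup_add fs_scale_add_left sum.distrib)
qed

lemma subst_0 [simp]: "subst a 0 = 0"
  by (simp add: subst_def)

lemma subst_1 [simp]: "subst a 1 = 1"
  using subst_single[of a 0 1] by simp

lemma subst_sum: "subst a (sum f I) = (\<Sum>i\<in>I. subst a (f i))"
  by (induction I rule: infinite_finite_induct) (simp_all add: subst_add)

lemma subst_scalar: "subst a (Poly_Mapping.single 0 c) = Poly_Mapping.single 0 c"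
  by (simp add: subst_single fs_scale_def)

lemma fs_star_scalar: "fs_star (Poly_Mapping.single 0 c) = Poly_Mapping.single 0 (cnj c)"
  by (simp add: fs_star_single)

lemma subst_mult: "subst a (x * y) = subst a x * subst a y"
proof -
  let ?s = "\<lambda>x. \<Sum>w\<in>Poly_Mapping.keys x. Poly_Mapping.single w (Poly_Mapping.lookup x w)"
  have "subst a (?s x * ?s y) = subst a (?s x) * subst a (?s y)"
    by (simp add: sum_product subst_sum mult_single subst_single word_image_add fs_scale_scale
        fs_scale_mult_left fs_scale_mult_right fs_scale_left_commute)
  then show ?thesis by (simp only: sum_single[symmetric])
qed

lemma subst_scale: "subst a (fs_scale c x) = fs_scale c (subst a x)"
  by (simp add: fs_scale_def subst_mult subst_scalar)

lemma fs_scale_uminus_1: "fs_scale (-1) x = - x"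
  by (simp add: fs_scale_def single_uminus)

lemma subst_diff: "subst a (x - y) = subst a x - subst a y"
  using subst_add[of a x "- y"] subst_scale[of a "-1" y] by (simp add: fs_scale_uminus_1)

lemma subst_star: "subst a (fs_star x) = fs_star (subst a x)"
proof -
  let ?s = "\<lambda>x. \<Sum>w\<in>Poly_Mapping.keys x. Poly_Mapping.single w (Poly_Mapping.lookup x w)"
  have "subst a (fs_star (?s x)) = fs_star (subst a (?s x))"
    by (simp add: fs_star_sum subst_sum fs_star_single subst_single word_image_star fs_star_scale)
  then show ?thesis by (simp only: sum_single[symmetric])
qed

lemma subst_gen [simp]: "subst a (fs_gen g) = a g"
  by (simp add: fs_gen_def subst_single word_image_def letter_image_def)

lemma free_star_alg_induct [case_names one add scale gen star_gen]:
  assumes one: "P 1"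
    and add: "\<And>x y. P x \<Longrightarrow> P y \<Longrightarrow> P (x + y)"
    and scale: "\<And>c x. P x \<Longrightarrow> P (fs_scale c x)"
    and gen: "\<And>g x. P x \<Longrightarrow> P (fs_gen g * x)"
    and star_gen: "\<And>g x. P x \<Longrightarrow> P (fs_star (fs_gen g) * x)"
  shows "P x"
proof -
  have word: "P (Poly_Mapping.single (StarWord ls) 1)" for ls
  proof (induction ls)
    case Nil
    then show ?case using one by (simp flip: zero_star_word_def)
  next
    case (Cons l ls)
    obtain g b where l: "l = (g, b)" by fastforce
    have "Poly_Mapping.single (StarWord (l # ls)) 1 =
        Poly_Mapping.single (StarWord [l]) 1 * Poly_Mapping.single (StarWord ls) (1 :: complex)"
      by (simp add: mult_single plus_star_word_def)
    also have "Poly_Mapping.single (StarWord [l]) 1 = (if b then fs_star (fs_gen g) else fs_gen g)"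
      by (simp add: l fs_gen_star_word) (simp add: fs_gen_def)
    finally show ?case using gen[OF Cons] star_gen[OF Cons] by simp
  qed
  have single: "P (Poly_Mapping.single w c)" for w c
    using scale[OF word[of "letters w"], of c] by (simp add: fs_scale_single)
  have zero: "P 0" using scale[OF one, of 0] by simp
  have "P (\<Sum>w\<in>W. Poly_Mapping.single w (Poly_Mapping.lookup x w))" for W
    by (induction W rule: infinite_finite_induct) (simp_all add: zero add single)
  then show ?thesis by (subst sum_single[of x]) 
qed

lemma subst_subst: "subst b (subst a x) = subst (\<lambda>g. subst b (a g)) x"
  by (induction x rule: free_star_alg_induct)
    (simp_all add: subst_add subst_scale subst_mult subst_star)

lemma subst_fs_gen: "subst fs_gen x = x"
  by (induction x rule: free_star_alg_induct)
    (simp_all add: subst_add subst_scale subst_mult subst_star)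

section \<open>Computing in all the algebras E at once\<close>

definition E_norm :: "complex \<Rightarrow> ('n + 'm) free_star_alg \<Rightarrow> real" where
  "E_norm q = univ_seminorm (E_relations q)"

definition E_eq :: "complex \<Rightarrow> ('n + 'm) free_star_alg \<Rightarrow> ('n + 'm) free_star_alg \<Rightarrow> bool" where
  "E_eq q x y \<longleftrightarrow> E_norm q (x - y) = 0"

lemma cstar_seminorm_E_norm: "cstar_seminorm (E_norm q)"
  unfolding E_norm_def by (rule cstar_seminorm_univ[OF bdd_above_E_seminorms])

lemmas E_norm_nonneg [simp] = cstar_seminorm_nonneg[OF cstar_seminorm_E_norm]
  and E_norm_add = cstar_seminorm_add[OF cstar_seminorm_E_norm]
  and E_norm_mult = cstar_seminorm_mult[OF cstar_seminorm_E_norm]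
  and E_norm_scale = cstar_seminorm_scale[OF cstar_seminorm_E_norm]
  and E_norm_0 [simp] = cstar_seminorm_0[OF cstar_seminorm_E_norm]
  and E_norm_star = cstar_seminorm_star[OF cstar_seminorm_E_norm]
  and E_norm_cstar = cstar_seminorm_cstar[OF cstar_seminorm_E_norm]
  and E_norm_minus_commute = cstar_seminorm_minus_commute[OF cstar_seminorm_E_norm]

lemma univ_seminorm_relation:
  assumes "r \<in> R"
  shows "univ_seminorm R r = 0"
proof -
  have "(\<lambda>p. p r) ` rel_seminorms R = {0}"
    using assms rel_seminorms_nonempty[of R] by (force simp: rel_seminorms_def)
  then show ?thesis by (simp add: univ_seminorm_def)
qed

lemma E_norm_relation: "r \<in> E_relations q \<Longrightarrow> E_norm q r = 0"
  unfolding E_norm_def by (rule univ_seminorm_relation)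

lemma E_norm_eq_0_mult:
  assumes "E_norm q x = 0"
  shows "E_norm q (y * x) = 0" "E_norm q (x * y) = 0"
  using E_norm_mult[of q y x] E_norm_mult[of q x y] E_norm_nonneg[of q "y * x"] E_norm_nonneg[of q "x * y"]
  unfolding assms by simp_all

lemma E_eq_refl [simp]: "E_eq q x x"
  by (simp add: E_eq_def)

lemma E_eq_sym: "E_eq q x y \<Longrightarrow> E_eq q y x"
  by (simp add: E_eq_def E_norm_minus_commute)

lemma E_eq_trans [trans]: "E_eq q x y \<Longrightarrow> E_eq q y z \<Longrightarrow> E_eq q x z"
  using cstar_seminorm_triangle[OF cstar_seminorm_E_norm, of q x z y] E_norm_nonneg[of q "x - z"]
  by (simp add: E_eq_def)

lemma E_eq_add: "E_eq q x y \<Longrightarrow> E_eq q x' y' \<Longrightarrow> E_eq q (x + x') (y + y')"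
  using E_norm_add[of q "x - y" "x' - y'"] E_norm_nonneg[of q "x + x' - (y + y')"]
  by (simp add: E_eq_def algebra_simps)

lemma E_eq_mult:
  assumes "E_eq q x y" and "E_eq q x' y'"
  shows "E_eq q (x * x') (y * y')"
proof -
  have "E_norm q (x * (x' - y') + (x - y) * y') \<le> 0"
    using E_norm_add[of q "x * (x' - y')" "(x - y) * y'"] E_norm_eq_0_mult(1)[of q "x' - y'" x]
      E_norm_eq_0_mult(2)[of q "x - y" y'] assms by (simp add: E_eq_def)
  then show ?thesis
    using E_norm_nonneg[of q "x * x' - y * y'"] by (simp add: E_eq_def algebra_simps)
qed

lemma E_eq_scale: "E_eq q x y \<Longrightarrow> E_eq q (fs_scale c x) (fs_scale c y)"
  by (simp add: E_eq_def E_norm_scale flip: fs_scale_diff)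

lemma E_eq_star: "E_eq q x y \<Longrightarrow> E_eq q (fs_star x) (fs_star y)"
  by (simp add: E_eq_def E_norm_star flip: fs_star_diff)

lemma E_eq_uminus: "E_eq q x y \<Longrightarrow> E_eq q (- x) (- y)"
  using E_eq_scale[of q x y "-1"] by (simp add: fs_scale_uminus_1)

lemma E_eq_diff: "E_eq q x y \<Longrightarrow> E_eq q x' y' \<Longrightarrow> E_eq q (x - x') (y - y')"
  using E_eq_add[OF _ E_eq_uminus, of q x y x' y'] by simp

lemma E_eq_norm: "E_eq q x y \<Longrightarrow> E_norm q x = E_norm q y"
  using cstar_seminorm_abs_diff[OF cstar_seminorm_E_norm, of q x y] by (simp add: E_eq_def)

text \<open>
  Calculations with projections and phases are tedious modulo null vectors of a seminorm. The
  quotient of the free *-algebra by the null vectors would be a ring in which they become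
  equations, but it depends on the parameter \<open>q\<close>, which a type cannot do. So all \<open>q\<close> on the
  unit circle are treated at once: the type consists of the sections \<open>q \<mapsto> x q\<close> of the bundle
  with these quotients as fibres, and the parameter itself becomes the central unitary section
  \<open>qvar\<close>. It is not an instance of \<open>ring_1\<close> because \<open>0 \<noteq> 1\<close> would mean that the relations can
  be represented.
\<close>

quotient_type ('n, 'm) E_family = "complex \<Rightarrow> ('n + 'm) free_star_alg"
  / "\<lambda>x y. \<forall>q. cmod q = 1 \<longrightarrow> E_eq q (x q) (y q)"
  by (rule equivpI) (auto simp: reflp_def symp_def transp_def intro: E_eq_sym E_eq_trans)

instantiation E_family :: (type, type) "{ring, monoid_mult}"
begin

lift_definition zero_E_family :: "('a, 'b) E_family" is "\<lambda>_. 0" .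
lift_definition one_E_family :: "('a, 'b) E_family" is "\<lambda>_. 1" .
lift_definition plus_E_family :: "('a, 'b) E_family \<Rightarrow> ('a, 'b) E_family \<Rightarrow> ('a, 'b) E_family"
  is "\<lambda>x y q. x q + y q" by (simp add: E_eq_add)
lift_definition uminus_E_family :: "('a, 'b) E_family \<Rightarrow> ('a, 'b) E_family"
  is "\<lambda>x q. - x q" by (simp add: E_eq_uminus)
lift_definition minus_E_family :: "('a, 'b) E_family \<Rightarrow> ('a, 'b) E_family \<Rightarrow> ('a, 'b) E_family"
  is "\<lambda>x y q. x q - y q" by (simp add: E_eq_diff)
lift_definition times_E_family :: "('a, 'b) E_family \<Rightarrow> ('a, 'b) E_family \<Rightarrow> ('a, 'b) E_family"
  is "\<lambda>x y q. x q * y q" by (simp add: E_eq_mult)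

instance
  by standard (transfer; simp add: algebra_simps)+

end


text \<open>
  The constant sections. Equations between them hold for every parameter at once, and the
  parameter enters only through \<open>qvar\<close> in \<open>fam_s_star_t\<close> and its consequences.
\<close>

definition fam :: "('n + 'm) free_star_alg \<Rightarrow> ('n, 'm) E_family" where
  "fam x = abs_E_family (\<lambda>_. x)"

lemma fam_transfer [transfer_rule]: "rel_fun (=) cr_E_family (\<lambda>x _. x) fam"
  by (simp add: rel_fun_def fam_def cr_E_family_def)

lift_definition fam_star :: "('n, 'm) E_family \<Rightarrow> ('n, 'm) E_family"
  is "\<lambda>x q. fs_star (x q)" by (simp add: E_eq_star)

lift_definition qvar :: "('n, 'm) E_family" is "\<lambda>q. Poly_Mapping.single 0 q" .

lemma fam_eq_iff: "fam x = fam y \<longleftrightarrow> (\<forall>q. cmod q = 1 \<longrightarrow> E_eq q x y)"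
  by transfer simp

lemma E_eq_fam: "fam x = fam y \<Longrightarrow> cmod q = 1 \<Longrightarrow> E_eq q x y"
  by (simp add: fam_eq_iff)

lemma fam_eq_qvar_iff: "fam x = qvar * fam y \<longleftrightarrow> (\<forall>q. cmod q = 1 \<longrightarrow> E_eq q x (fs_scale q y))"
  by transfer (simp add: fs_scale_def)

lemma fam_0 [simp]: "fam 0 = 0"
  and fam_1 [simp]: "fam 1 = 1"
  and fam_add: "fam (x + y) = fam x + fam y"
  and fam_diff: "fam (x - y) = fam x - fam y"
  and fam_mult: "fam (x * y) = fam x * fam y"
  and fam_fs_star: "fam (fs_star x) = fam_star (fam x)"
  by (transfer; simp)+

lemma E_norm_fam_0: "fam x = 0 \<Longrightarrow> cmod q = 1 \<Longrightarrow> E_norm q x = 0"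
  using E_eq_fam[of x 0] by (simp add: E_eq_def)

lemma fam_sum: "fam (sum f I) = (\<Sum>i\<in>I. fam (f i))"
  by (induction I rule: infinite_finite_induct) (simp_all add: fam_add)

lemma fam_star_fam_star [simp]: "fam_star (fam_star x) = x"
  and fam_star_0 [simp]: "fam_star 0 = 0"
  and fam_star_1 [simp]: "fam_star 1 = 1"
  and fam_star_add: "fam_star (x + y) = fam_star x + fam_star y"
  and fam_star_diff: "fam_star (x - y) = fam_star x - fam_star y"
  and fam_star_mult: "fam_star (x * y) = fam_star y * fam_star x"
  by (transfer; simp add: fs_star_add fs_star_diff fs_star_mult)+

lemma fam_star_sum: "fam_star (sum f I) = (\<Sum>i\<in>I. fam_star (f i))"
  by (induction I rule: infinite_finite_induct) (simp_all add: fam_star_add)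

lemma fam_cstar: "fam_star x * x = 0 \<Longrightarrow> x = 0"
proof (transfer, intro allI impI)
  fix x :: "complex \<Rightarrow> ('a + 'b) free_star_alg" and q :: complex
  assume "\<forall>q. cmod q = 1 \<longrightarrow> E_eq q (fs_star (x q) * x q) 0" "cmod q = 1"
  then have "E_norm q (fs_star (x q) * x q) = 0" by (simp add: E_eq_def)
  then show "E_eq q (x q) 0" by (simp add: E_norm_cstar E_eq_def)
qed

definition central :: "'a::times \<Rightarrow> bool" where
  "central c \<longleftrightarrow> (\<forall>x. c * x = x * c)"

lemma central_qvar: "central qvar"
  unfolding central_def by (transfer) (simp add: single_0_commute)

lemma central_fam_star: "central c \<Longrightarrow> central (fam_star c)"
  unfolding central_def by (metis fam_star_fam_star fam_star_mult)

lemma central_fam: "central c \<Longrightarrow> central (fam c)"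
  unfolding central_def by transfer simp

lemma qvar_unitary: "fam_star qvar * qvar = 1"
proof (transfer, intro allI impI)
  fix q :: complex assume "cmod q = 1"
  then have "cnj q * q = 1" by (metis complex_norm_square mult.commute of_real_1 power_one)
  then show "E_eq q (fs_star (Poly_Mapping.single 0 q) * Poly_Mapping.single 0 q) (1 :: ('a + 'b) free_star_alg)"
    by (simp add: fs_star_scalar mult_single)
qed

section \<open>Range projections and phases\<close>

text \<open>
  The sum of \<open>w w\<^sup>*\<close> over all words \<open>w\<close> of length \<open>k\<close> in a family \<open>s\<close> of isometries with
  orthogonal ranges, when \<open>s'\<close> is the family of their adjoints: the projection onto the
  vectors with word length at least \<open>k\<close>.
\<close>

primrec range_proj :: "('i::finite \<Rightarrow> 'a::{ring, monoid_mult}) \<Rightarrow> ('i \<Rightarrow> 'a) \<Rightarrow> nat \<Rightarrow> 'a" where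
  "range_proj s s' 0 = 1"
| "range_proj s s' (Suc k) = (\<Sum>j\<in>UNIV. s j * range_proj s s' k * s' j)"

context
  fixes s s' :: "'i::finite \<Rightarrow> 'a::{ring, monoid_mult}"
  assumes iso: "\<And>i j. s' i * s j = (if i = j then 1 else 0)"
begin

lemma range_proj_gen: "range_proj s s' (Suc k) * s j = s j * range_proj s s' k"
  by (simp add: sum_distrib_right mult.assoc iso if_distrib[where f = "(*) _"] cong: if_cong)

lemma range_proj_adj: "s' j * range_proj s s' (Suc k) = range_proj s s' k * s' j"
proof -
  have "s' j * (s i * range_proj s s' k * s' i) = (if j = i then range_proj s s' k * s' i else 0)" for i
  proof -
    have "s' j * (s i * range_proj s s' k * s' i) = (s' j * s i) * (range_proj s s' k * s' i)"
      by (simp only: mult.assoc)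
    then show ?thesis by (simp add: iso)
  qed
  then show ?thesis by (simp add: sum_distrib_left)
qed

lemma range_proj_le:
  "k \<le> l \<Longrightarrow> range_proj s s' k * range_proj s s' l = range_proj s s' l"
  "k \<le> l \<Longrightarrow> range_proj s s' l * range_proj s s' k = range_proj s s' l"
proof (induction k arbitrary: l)
  case (Suc k)
  {
    case 1
    then obtain l' where l: "l = Suc l'" "k \<le> l'" by (cases l) auto
    have "range_proj s s' (Suc k) * range_proj s s' l
        = (\<Sum>j\<in>UNIV. (range_proj s s' (Suc k) * s j) * range_proj s s' l' * s' j)"
      unfolding l range_proj.simps(2)[of s s' l'] by (simp only: sum_distrib_left mult.assoc)
    also have "\<dots> = (\<Sum>j\<in>UNIV. s j * (range_proj s s' k * range_proj s s' l') * s' j)"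
      by (simp only: range_proj_gen mult.assoc)
    finally show ?case using Suc.IH(1)[OF l(2)] l by simp
  next
    case 2
    then obtain l' where l: "l = Suc l'" "k \<le> l'" by (cases l) auto
    have "range_proj s s' l * range_proj s s' (Suc k)
        = (\<Sum>j\<in>UNIV. s j * range_proj s s' l' * (s' j * range_proj s s' (Suc k)))"
      unfolding l range_proj.simps(2)[of s s' l'] by (simp only: sum_distrib_right mult.assoc)
    also have "\<dots> = (\<Sum>j\<in>UNIV. s j * (range_proj s s' l' * range_proj s s' k) * s' j)"
      by (simp only: range_proj_adj mult.assoc)
    finally show ?case using Suc.IH(2)[OF l(2)] l by simp
  }
qed simp_all

lemma range_proj_mult: "range_proj s s' k * range_proj s s' l = range_proj s s' (max k l)"
  using range_proj_le by (cases "k \<le> l") (simp_all add: max_def)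

end

text \<open>
  An element commuting with the \<open>s j\<close> up to a constant commutes with the range projections, as
  the constants from \<open>s j\<close> and from its adjoint cancel.
\<close>

lemma range_proj_commute:
  assumes c: "central c" and "\<And>j. s' j * x = c * x * s' j" and "\<And>j. x * s j = c * s j * x"
  shows "range_proj s s' k * x = x * range_proj s s' k"
proof (induction k)
  case (Suc k)
  have "s j * range_proj s s' k * s' j * x = x * (s j * range_proj s s' k * s' j)" for j
  proof -
    have "s j * range_proj s s' k * s' j * x = s j * range_proj s s' k * (c * x * s' j)"
      by (simp add: mult.assoc assms(2))
    also have "\<dots> = c * s j * (range_proj s s' k * x) * s' j"
      using c unfolding central_def by (metis mult.assoc)
    also have "\<dots> = (c * s j * x) * range_proj s s' k * s' j"
      by (simp add: Suc mult.assoc)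
    also have "\<dots> = (x * s j) * range_proj s s' k * s' j"
      by (simp only: assms(3))
    also have "\<dots> = x * (s j * range_proj s s' k * s' j)"
      by (simp only: mult.assoc)
    finally show ?thesis .
  qed
  then show ?case by (simp add: sum_distrib_left sum_distrib_right)
qed simp

text \<open>
  Modulo an ideal containing the defect \<open>1 - \<Sum>\<^sub>j s\<^sub>j s\<^sub>j\<^sup>*\<close>, the range projections telescope
  to \<open>1\<close>.
\<close>

lemma one_minus_range_proj_mem:
  fixes I :: "'a::ring_1 set"
  assumes add: "\<And>x y. x \<in> I \<Longrightarrow> y \<in> I \<Longrightarrow> x + y \<in> I" and zero: "0 \<in> I"
    and left: "\<And>x y. x \<in> I \<Longrightarrow> y * x \<in> I" and right: "\<And>x y. x \<in> I \<Longrightarrow> x * y \<in> I"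
    and defect: "1 - (\<Sum>j\<in>UNIV. s j * s' j) \<in> I"
  shows "1 - range_proj s s' k \<in> I"
proof (induction k)
  case (Suc k)
  have "1 - range_proj s s' (Suc k)
      = (1 - (\<Sum>j\<in>UNIV. s j * s' j)) + (\<Sum>j\<in>UNIV. s j * (1 - range_proj s s' k) * s' j)"
    by (simp add: algebra_simps sum_subtractf)
  also have "\<dots> \<in> I"
  proof (rule add[OF defect])
    show "(\<Sum>j\<in>J. s j * (1 - range_proj s s' k) * s' j) \<in> I" for J
      by (induction J rule: infinite_finite_induct) (auto intro: zero add left right Suc)
  qed
  finally show ?case .
qed (simp add: zero)

text \<open>
  For commuting projections \<open>c i\<close>, this multiplies a common eigenvector by \<open>\<rho>\<close> to the power of
  the number of those \<open>i < k\<close> for which \<open>c i\<close> has the eigenvalue \<open>1\<close>. The product form makes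
  each property an induction over one factor.
\<close>

primrec phase :: "'a::{ring, monoid_mult} \<Rightarrow> (nat \<Rightarrow> 'a) \<Rightarrow> nat \<Rightarrow> 'a" where
  "phase \<rho> c 0 = 1"
| "phase \<rho> c (Suc k) = phase \<rho> c k * (1 + (\<rho> - 1) * c k)"

lemma phase_Suc_left: "phase \<rho> c (Suc k) = (1 + (\<rho> - 1) * c 0) * phase \<rho> (\<lambda>i. c (Suc i)) k"
  by (induction k) (simp_all add: mult.assoc)

lemma phase_intertwine:
  assumes \<rho>: "central \<rho>" and c: "\<And>i. c i * x = x * c' i"
  shows "phase \<rho> c k * x = x * phase \<rho> c' k"
proof (induction k)
  case (Suc k)
  have "\<rho> * (c k * x) = x * (\<rho> * c' k)" using \<rho> c unfolding central_def by (metis mult.assoc)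
  then have "(1 + (\<rho> - 1) * c k) * x = x * (1 + (\<rho> - 1) * c' k)"
    by (simp add: algebra_simps c)
  then show ?case using Suc by (simp add: mult.assoc) (simp flip: mult.assoc)
qed simp

lemma phase_cut:
  assumes "\<And>i. l \<le> i \<Longrightarrow> c i * x = 0" and "l \<le> k"
  shows "phase \<rho> c k * x = phase \<rho> c l * x"
  using assms(2)
proof (induction k rule: dec_induct)
  case (step k)
  then show ?case using assms(1)[of k] by (simp add: algebra_simps)
qed simp

lemma phase_commute_factor:
  assumes "central \<sigma>" "central \<rho>" and c: "\<And>i j. c i * c j = c j * c i"
  shows "phase \<sigma> c k * (1 + (\<rho> - 1) * c l) = (1 + (\<rho> - 1) * c l) * phase \<sigma> c k"
proof (rule phase_intertwine[OF assms(1)])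
  fix i
  have "c i * (\<rho> * c l) = \<rho> * (c l * c i)"
    using assms(2) c[of i l] unfolding central_def by (metis mult.assoc)
  then show "c i * (1 + (\<rho> - 1) * c l) = (1 + (\<rho> - 1) * c l) * c i"
    by (simp add: algebra_simps c[of i l])
qed

lemma phase_inverse:
  assumes \<rho>: "central \<rho>" "central \<rho>'" "\<rho>' * \<rho> = 1"
    and c: "\<And>i j. c i * c j = c j * c i" "\<And>i. c i * c i = c i"
  shows "phase \<rho>' c k * phase \<rho> c k = 1"
proof (induction k)
  case (Suc k)
  let ?u = "1 + (\<rho> - 1) * c k" and ?u' = "1 + (\<rho>' - 1) * c k"
  have 1: "phase \<rho> c k * ?u = ?u * phase \<rho> c k"
    by (rule phase_commute_factor[OF \<rho>(1) \<rho>(1) c(1)])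
  have *: "c k * (\<rho> * c k) = \<rho> * c k" "\<rho>' * (\<rho> * c k) = c k"
    using \<rho>(1) c(2) unfolding central_def by (metis mult.assoc) (simp add: \<rho>(3) flip: mult.assoc)
  have 2: "?u' * ?u = 1" by (simp add: algebra_simps * c(2))
  have "phase \<rho>' c (Suc k) * phase \<rho> c (Suc k) = phase \<rho>' c k * (?u' * ?u) * phase \<rho> c k"
    by (simp add: 1 mult.assoc)
  then show ?case using Suc by (simp add: 2)
qed simp

section \<open>Tail projections and deformed generators\<close>

text \<open>
  In terms of the word lengths \<open>N\<close> and \<open>N'\<close>, this is the projection onto \<open>N \<ge> k\<close> and \<open>N' \<ge> l\<close>.
\<close>

definition tail_proj :: "nat \<Rightarrow> nat \<Rightarrow> ('n::finite + 'm::finite) free_star_alg" where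
  "tail_proj k l = range_proj s_gen (\<lambda>j. fs_star (s_gen j)) k * range_proj t_gen (\<lambda>r. fs_star (t_gen r)) l"

definition cutoff :: "nat \<Rightarrow> ('n::finite + 'm::finite) free_star_alg" where
  "cutoff L = 1 - tail_proj L L"

text \<open>
  The power of \<open>r\<close> with exponent \<open>min (N + 1 - a) (N' + 1 - b)\<close>, truncated to the range from
  \<open>0\<close> to the last argument.
\<close>

definition grid_phase :: "nat \<Rightarrow> nat \<Rightarrow> complex \<Rightarrow> nat \<Rightarrow> ('n::finite + 'm::finite) free_star_alg" where
  "grid_phase a b r = phase (Poly_Mapping.single 0 r) (\<lambda>i. tail_proj (i + a) (i + b))"

text \<open>
  The exponents are \<open>- min (N + 1) N'\<close> for the first family and \<open>min N N'\<close> for the second one,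
  truncated at \<open>K\<close>; a conjugate replaces the inverse since \<open>r\<close> will have modulus one.
\<close>

definition deform :: "complex \<Rightarrow> nat \<Rightarrow> 'n::finite + 'm::finite \<Rightarrow> ('n + 'm) free_star_alg" where
  "deform r K g = (case g of
      Inl j \<Rightarrow> s_gen j * grid_phase 0 1 (cnj r) K
    | Inr l \<Rightarrow> t_gen l * grid_phase 1 1 r K)"

text \<open>
  For relations that do not involve the parameter.
\<close>

lemma fam_relation_0:
  assumes "\<And>q. x \<in> E_relations q"
  shows "fam x = 0"
  using E_norm_relation[OF assms] by (simp add: fam_eq_iff[of x 0, simplified] E_eq_def)

lemma fam_subst_phase:
  "fam (subst a (phase \<rho> c k)) = phase (fam (subst a \<rho>)) (\<lambda>i. fam (subst a (c i))) k"
  by (induction k) (simp_all add: subst_mult subst_add subst_diff fam_mult fam_add fam_diff)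

lemma fam_phase: "fam (phase \<rho> c k) = phase (fam \<rho>) (\<lambda>i. fam (c i)) k"
  using fam_subst_phase[of fs_gen] by (simp add: subst_fs_gen)

lemma fam_range_proj: "fam (range_proj s s' k) = range_proj (\<lambda>j. fam (s j)) (\<lambda>j. fam (s' j)) k"
  by (induction k) (simp_all add: fam_sum fam_mult)

lemma fam_star_range_proj:
  "fam_star (range_proj s (\<lambda>j. fam_star (s j)) k) = range_proj s (\<lambda>j. fam_star (s j)) k"
  by (induction k) (simp_all add: fam_star_sum fam_star_mult mult.assoc)

lemma fam_star_phase:
  assumes \<rho>: "central \<rho>" and c: "\<And>i j. c i * c j = c j * c i" "\<And>i. fam_star (c i) = c i"
  shows "fam_star (phase \<rho> c k) = phase (fam_star \<rho>) c k"
proof (induction k)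
  case (Suc k)
  note \<rho>' = central_fam_star[OF \<rho>]
  have "c k * fam_star \<rho> = fam_star \<rho> * c k" using \<rho>' by (simp only: central_def)
  then have "fam_star (phase \<rho> c (Suc k)) = (1 + (fam_star \<rho> - 1) * c k) * phase (fam_star \<rho>) c k"
    using Suc by (simp add: fam_star_mult fam_star_add fam_star_diff c(2) algebra_simps)
  also have "\<dots> = phase (fam_star \<rho>) c (Suc k)"
    unfolding phase.simps by (rule phase_commute_factor[OF \<rho>' \<rho>' c(1), symmetric])
  finally show ?case .
qed simp

context
begin

private abbreviation S :: "'n::finite \<Rightarrow> ('n, 'm::finite) E_family" where "S j \<equiv> fam (s_gen j)"
private abbreviation T :: "'m::finite \<Rightarrow> ('n::finite, 'm) E_family" where "T l \<equiv> fam (t_gen l)"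
private abbreviation E :: "nat \<Rightarrow> nat \<Rightarrow> ('n::finite, 'm::finite) E_family" where
  "E k l \<equiv> fam (tail_proj k l)"
private abbreviation G :: "nat \<Rightarrow> ('n::finite, 'm::finite) E_family" where "G k \<equiv> fam (cutoff k)"
private abbreviation H :: "nat \<Rightarrow> nat \<Rightarrow> complex \<Rightarrow> nat \<Rightarrow> ('n::finite, 'm::finite) E_family" where
  "H a b r k \<equiv> fam (grid_phase a b r k)"

lemma fam_s_isometry: "fam_star (S i) * S j = (if i = j then 1 else 0 :: ('n::finite, 'm::finite) E_family)"
proof -
  have "fam (fs_star (s_gen i) * s_gen j - (if i = j then 1 else 0) :: ('n + 'm) free_star_alg) = 0"
    by (rule fam_relation_0) (auto simp: E_relations_def)
  then show ?thesis by (simp add: fam_diff fam_mult fam_fs_star split: if_splits)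
qed

lemma fam_t_isometry: "fam_star (T i) * T j = (if i = j then 1 else 0 :: ('n::finite, 'm::finite) E_family)"
proof -
  have "fam (fs_star (t_gen i) * t_gen j - (if i = j then 1 else 0) :: ('n + 'm) free_star_alg) = 0"
    by (rule fam_relation_0) (auto simp: E_relations_def)
  then show ?thesis by (simp add: fam_diff fam_mult fam_fs_star split: if_splits)
qed

lemma fam_s_star_t:
  fixes j :: "'n::finite" and l :: "'m::finite"
  shows "fam_star (S j) * T l = qvar * T l * fam_star (S j)"
proof -
  have "fs_star (s_gen j) * t_gen l - fs_scale q (t_gen l * fs_star (s_gen j))
      \<in> (E_relations q :: ('n + 'm) free_star_alg set)" for q
    by (auto simp: E_relations_def)
  from E_norm_relation[OF this]
  have "fam (fs_star (s_gen j) * t_gen l) = qvar * fam (t_gen l * fs_star (s_gen j))"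
    by (simp add: fam_eq_qvar_iff E_eq_def)
  then show ?thesis by (simp add: fam_mult fam_fs_star mult.assoc)
qed

lemma qvar_commute: "x * qvar = qvar * x" "x * fam_star qvar = fam_star qvar * x"
  using central_qvar central_fam_star[OF central_qvar] unfolding central_def by metis+

lemma qvar_left_commute:
  "x * (qvar * y) = qvar * (x * y)" "x * (fam_star qvar * y) = fam_star qvar * (x * y)"
  by (simp_all only: qvar_commute flip: mult.assoc)

lemma qvar_cancel: "qvar * (fam_star qvar * x) = x" "fam_star qvar * (qvar * x) = x"
  by (simp_all add: qvar_unitary qvar_commute(2)[of qvar] flip: mult.assoc)

lemma fam_t_star_s:
  fixes j :: "'n::finite" and l :: "'m::finite"
  shows "fam_star (T l) * S j = fam_star qvar * S j * fam_star (T l)"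
  using arg_cong[OF fam_s_star_t[of j l], of fam_star]
  by (simp add: fam_star_mult qvar_commute qvar_left_commute mult.assoc)

text \<open>
  This is not among the defining relations. The difference \<open>x\<close> of the two sides satisfies
  \<open>x\<^sup>* x = 0\<close>, since each of the four products that arise reduces to \<open>1\<close>.
\<close>

lemma fam_t_s:
  fixes j :: "'n::finite" and l :: "'m::finite"
  shows "T l * S j = qvar * S j * T l"
proof -
  let ?x = "T l * S j - qvar * S j * T l"
  have iso: "fam_star (S j) * (S j * x) = x" "fam_star (T l) * (T l * x) = x" for x
    by (simp_all add: fam_s_isometry fam_t_isometry flip: mult.assoc)
  have st: "fam_star (S j) * (T l * x) = qvar * (T l * (fam_star (S j) * x))"
    and ts: "fam_star (T l) * (S j * x) = fam_star qvar * (S j * (fam_star (T l) * x))" for x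
    by (simp_all only: fam_s_star_t fam_t_star_s flip: mult.assoc)
  note pull = qvar_left_commute[of "S j"] qvar_left_commute[of "T l"]
    qvar_left_commute[of "fam_star (S j)"] qvar_left_commute[of "fam_star (T l)"]
    qvar_commute[of "fam_star (S j)"] qvar_commute[of "fam_star (T l)"]
  \<comment> \<open>All scalars are moved to the left, where they cancel.\<close>
  have "fam_star ?x * ?x = 0"
    by (simp add: fam_star_diff fam_star_mult algebra_simps iso st ts pull qvar_cancel
        fam_s_isometry fam_t_isometry)
  then have "?x = 0" by (rule fam_cstar)
  then show ?thesis by simp
qed

lemma fam_s_star_t_star:
  fixes j :: "'n::finite" and l :: "'m::finite"
  shows "fam_star (S j) * fam_star (T l) = fam_star qvar * fam_star (T l) * fam_star (S j)"
  using arg_cong[OF fam_t_s[of l j], of fam_star]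
  by (simp add: fam_star_mult qvar_commute qvar_left_commute mult.assoc)

private abbreviation P :: "nat \<Rightarrow> ('n::finite, 'm::finite) E_family" where
  "P k \<equiv> range_proj S (\<lambda>j. fam_star (S j)) k"
private abbreviation Q :: "nat \<Rightarrow> ('n::finite, 'm::finite) E_family" where
  "Q k \<equiv> range_proj T (\<lambda>j. fam_star (T j)) k"

lemma fam_tail_proj: "E k l = P k * Q l"
  by (simp add: tail_proj_def fam_mult fam_range_proj fam_fs_star)

lemma s_range_proj_t: "P k * T l = T l * P k" "P k * fam_star (T l) = fam_star (T l) * P k"
  by (rule range_proj_commute[OF central_qvar] range_proj_commute[OF central_fam_star[OF central_qvar]];
      simp add: fam_s_star_t fam_t_s fam_s_star_t_star fam_t_star_s)+

lemma t_range_proj_s: "Q k * S l = S l * Q k" "Q k * fam_star (S l) = fam_star (S l) * Q k"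
proof -
  have "S l * T j = fam_star qvar * T j * S l" for j
    by (simp add: fam_t_s mult.assoc qvar_cancel)
  then show "Q k * S l = S l * Q k"
    by (intro range_proj_commute[OF central_fam_star[OF central_qvar]])
      (simp_all add: fam_t_star_s)
  have "fam_star (T j) * fam_star (S l) = qvar * fam_star (S l) * fam_star (T j)" for j
    by (simp add: fam_s_star_t_star mult.assoc qvar_cancel)
  then show "Q k * fam_star (S l) = fam_star (S l) * Q k"
    by (intro range_proj_commute[OF central_qvar]) (simp_all add: fam_s_star_t)
qed

lemma range_projs_commute: "P k * Q l = Q l * P k"
  by (rule range_proj_commute[of 1, symmetric]) (simp_all add: central_def s_range_proj_t)

text \<open>
  Within one family the range projections decrease; between the two families they commute,
  because the constants \<open>q\<close> cancel.
\<close>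

lemma tail_proj_mult: "E k l * E k' l' = E (max k k') (max l l')"
proof -
  have "E k l * E k' l' = (P k * P k') * (Q l * Q l')"
    unfolding fam_tail_proj using range_projs_commute[of k' l] by (metis (no_types) mult.assoc)
  then show ?thesis
    by (simp add: range_proj_mult[OF fam_s_isometry] range_proj_mult[OF fam_t_isometry] fam_tail_proj)
qed

lemma tail_proj_0 [simp]: "E 0 0 = 1"
  by (simp add: fam_tail_proj)

lemma tail_proj_star: "fam_star (E k l) = E k l"
  by (simp add: fam_tail_proj fam_star_mult fam_star_range_proj range_projs_commute)

lemma tail_proj_s: "E (Suc k) l * S j = S j * E k l"
proof -
  have "E (Suc k) l * S j = (P (Suc k) * S j) * Q l"
    by (simp only: fam_tail_proj mult.assoc t_range_proj_s)
  then show ?thesis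
    by (simp only: range_proj_gen[OF fam_s_isometry] fam_tail_proj mult.assoc)
qed

lemma tail_proj_t: "E k (Suc l) * T j = T j * E k l"
proof -
  have "E k (Suc l) * T j = P k * (T j * Q l)"
    by (simp only: fam_tail_proj mult.assoc range_proj_gen[OF fam_t_isometry])
  then show ?thesis
    by (simp only: fam_tail_proj s_range_proj_t flip: mult.assoc)
qed

lemma tail_proj_s_star: "E k l * fam_star (S j) = fam_star (S j) * E (Suc k) l"
  using arg_cong[OF tail_proj_s[of k l j, symmetric], of fam_star] by (simp add: fam_star_mult tail_proj_star)

lemma tail_proj_t_star: "E k l * fam_star (T j) = fam_star (T j) * E k (Suc l)"
  using arg_cong[OF tail_proj_t[of k l j, symmetric], of fam_star] by (simp add: fam_star_mult tail_proj_star)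


private abbreviation R :: "complex \<Rightarrow> ('n::finite, 'm::finite) E_family" where
  "R r \<equiv> fam (Poly_Mapping.single 0 r)"

lemma central_scalar: "central (R r)"
  by (rule central_fam) (simp add: central_def single_0_commute)

lemma scalar_commute: "x * R r = R r * x"
  using central_scalar unfolding central_def by metis

lemma scalar_left_commute: "x * (R r * y) = R r * (x * y)"
  by (simp only: scalar_commute flip: mult.assoc)

lemma scalar_mult: "R r * R r' = R (r * r')"
  by (simp add: mult_single flip: fam_mult)

lemma scalar_star: "fam_star (R r) = R (cnj r)"
  by (simp add: fs_star_scalar flip: fam_fs_star)

lemma scalar_inverse:
  assumes "cmod r = 1"
  shows "R (cnj r) * R r = 1"
proof -
  have "cnj r * r = 1" using assms by (metis complex_norm_square mult.commute of_real_1 power_one)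
  then show ?thesis by (simp add: scalar_mult)
qed

lemma fam_grid_phase: "H a b r k = phase (R r) (\<lambda>i. E (i + a) (i + b)) k"
  by (simp add: grid_phase_def fam_phase)

lemma grid_phase_star: "fam_star (H a b r k) = H a b (cnj r) k"
  unfolding fam_grid_phase scalar_star[symmetric]
  by (rule fam_star_phase[OF central_scalar]) (simp_all add: tail_proj_mult tail_proj_star max.commute)

lemma grid_phase_inverse: "cmod r = 1 \<Longrightarrow> H a b (cnj r) k * H a b r k = 1"
  unfolding fam_grid_phase
  by (rule phase_inverse[OF central_scalar central_scalar scalar_inverse]) (simp_all add: tail_proj_mult max.commute)

lemma grid_phase_inverse': "cmod r = 1 \<Longrightarrow> H a b r k * H a b (cnj r) k = 1"
  using grid_phase_inverse[of "cnj r"] by simp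

lemma grid_phase_tail_proj: "H a b r k * E i j = E i j * H a b r k"
  unfolding fam_grid_phase
  by (rule phase_intertwine[OF central_scalar]) (simp add: tail_proj_mult max.commute)

lemma grid_phase_commute: "H a b r k * H a' b' r' k' = H a' b' r' k' * H a b r k"
  unfolding fam_grid_phase[of a b]
  by (rule phase_intertwine[OF central_scalar]) (simp add: grid_phase_tail_proj)

lemma grid_phase_t: "H a (Suc b) r k * T j = T j * H a b r k"
  unfolding fam_grid_phase by (rule phase_intertwine[OF central_scalar]) (simp add: tail_proj_t)

lemma grid_phase_s_star: "H a b r k * fam_star (S j) = fam_star (S j) * H (Suc a) b r k"
  unfolding fam_grid_phase by (rule phase_intertwine[OF central_scalar]) (simp add: tail_proj_s_star)

lemma grid_phase_t_star: "H a b r k * fam_star (T j) = fam_star (T j) * H a (Suc b) r k"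
  unfolding fam_grid_phase by (rule phase_intertwine[OF central_scalar]) (simp add: tail_proj_t_star)

lemma fam_cutoff: "G L = 1 - E L L"
  by (simp add: cutoff_def fam_diff)

lemma tail_proj_cutoff_eq_0: "L \<le> i \<Longrightarrow> L \<le> j \<Longrightarrow> E i j * G L = 0"
  by (simp add: fam_cutoff algebra_simps tail_proj_mult max_def)

lemma cutoff_mult: "G k * G l = G (min k l)"
  by (cases "k \<le> l") (simp_all add: fam_cutoff algebra_simps tail_proj_mult max_def min_def)

lemma cutoff_star: "fam_star (G L) = G L"
  by (simp add: fam_cutoff fam_star_diff tail_proj_star)

lemma grid_phase_cutoff_commute: "H a b r k * G L = G L * H a b r k"
  by (simp add: fam_cutoff algebra_simps grid_phase_tail_proj)

text \<open>
  The factors of index at least \<open>L\<close> act trivially where \<open>N < L\<close> or \<open>N' < L\<close>; this is the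
  stabilization for which the minimum in the exponents was chosen.
\<close>

lemma grid_phase_cutoff: "L \<le> k \<Longrightarrow> H a b r k * G L = H a b r L * G L"
  unfolding fam_grid_phase by (rule phase_cut) (simp_all add: tail_proj_cutoff_eq_0)

lemma grid_phase_inverse_cutoff:
  assumes "cmod r = 1" "L \<le> k" "L \<le> k'"
  shows "H a b (cnj r) k * H a b r k' * G L = G L"
proof -
  have "H a b (cnj r) k * H a b r k' * G L = (H a b (cnj r) k * G L) * H a b r L"
    by (simp only: mult.assoc grid_phase_cutoff[OF assms(3)]) (simp only: grid_phase_cutoff_commute)
  also have "\<dots> = H a b (cnj r) L * H a b r L * G L"
    by (simp only: mult.assoc grid_phase_cutoff[OF assms(2)]) (simp only: grid_phase_cutoff_commute)
  finally show ?thesis by (simp add: grid_phase_inverse[OF assms(1)])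
qed

lemma deform_s: "fam (deform r K (Inl j)) = S j * H 0 1 (cnj r) K"
  by (simp add: deform_def fam_mult)

lemma deform_t: "fam (deform r K (Inr l)) = T l * H 1 1 r K"
  by (simp add: deform_def fam_mult)

lemma deform_s_star: "fam_star (fam (deform r K (Inl j))) = H 0 1 r K * fam_star (S j)"
  by (simp add: deform_s fam_star_mult grid_phase_star)

lemma deform_t_star: "fam_star (fam (deform r K (Inr l))) = H 1 1 (cnj r) K * fam_star (T l)"
  by (simp add: deform_t fam_star_mult grid_phase_star)

text \<open>
  The phases are unitary, so the relations within one family hold exactly, whatever \<open>K\<close> is.
\<close>

lemma deform_s_isometry:
  assumes "cmod r = 1"
  shows "fam_star (fam (deform r K (Inl i))) * fam (deform r K (Inl j)) = (if i = j then 1 else 0)" (is "?l = _")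
proof -
  have "?l
      = H 0 1 r K * (fam_star (S i) * S j) * H 0 1 (cnj r) K"
    unfolding deform_s_star unfolding deform_s by (simp only: mult.assoc)
  then show ?thesis by (simp add: fam_s_isometry grid_phase_inverse'[OF assms])
qed

lemma deform_t_isometry:
  assumes "cmod r = 1"
  shows "fam_star (fam (deform r K (Inr i))) * fam (deform r K (Inr j)) = (if i = j then 1 else 0)" (is "?l = _")
proof -
  have "?l
      = H 1 1 (cnj r) K * (fam_star (T i) * T j) * H 1 1 r K"
    unfolding deform_t_star unfolding deform_t by (simp only: mult.assoc)
  then show ?thesis by (simp add: fam_t_isometry grid_phase_inverse[OF assms])
qed

text \<open>
  The commutation relation for \<open>q r\<close>. The truncation at \<open>K = Suc k\<close> spoils it only on a tail,
  which the cutoff removes.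
\<close>

lemma deform_s_star_t:
  fixes i :: "'n::finite" and l :: "'m::finite"
  assumes r: "cmod r = 1" and L: "L \<le> Suc k"
  shows "fam_star (fam (deform r (Suc k) (Inl i))) * fam (deform r (Suc k) (Inr l)) * G L
    = qvar * (R r * (fam (deform r (Suc k) (Inr l)) * fam_star (fam (deform r (Suc k) (Inl i))) * G L))"
proof -
  let ?K = "Suc k" and ?T = "T l :: ('n, 'm) E_family" and ?S = "fam_star (S i)" and ?D = "E (Suc k) (Suc k)"
  let ?Z = "H 0 1 r ?K * ?S * G L"
  \<comment> \<open>On the range of \<open>t\<close> the projection onto \<open>N' \<ge> 1\<close> is trivial, so that the first factor of the phase becomes the scalar \<open>r\<close>.\<close>
  have "H 0 1 r ?K * ?T = (1 + (R r - 1) * E 0 1) * (H 1 2 r k * ?T)"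
    unfolding fam_grid_phase phase_Suc_left by (simp add: mult.assoc numeral_2_eq_2)
  also have "H 1 2 r k * ?T = ?T * H 1 1 r k"
    using grid_phase_t[of 1 1] by (simp add: numeral_2_eq_2)
  also have "(1 + (R r - 1) * E 0 1) * (?T * H 1 1 r k) = R r * (?T * H 1 1 r k)"
  proof -
    have "E 0 1 * (?T * x) = ?T * x" for x :: "('n, 'm) E_family"
      unfolding mult.assoc[symmetric] One_nat_def tail_proj_t by simp
    then show ?thesis by (simp add: algebra_simps)
  qed
  finally have HT: "H 0 1 r ?K * ?T = R r * (?T * H 1 1 r k)" .
  have HS: "?S * H 1 1 r ?K = H 0 1 r ?K * ?S" by (simp add: grid_phase_s_star)
  have "H 0 1 r ?K * ?S * (?T * H 1 1 r ?K) = H 0 1 r ?K * (?S * ?T) * H 1 1 r ?K"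
    by (simp only: mult.assoc)
  also have "\<dots> = qvar * (H 0 1 r ?K * ?T * (?S * H 1 1 r ?K))"
    by (simp only: fam_s_star_t mult.assoc qvar_left_commute)
  also have "\<dots> = qvar * (R r * (?T * H 1 1 r k * (H 0 1 r ?K * ?S)))"
    by (simp only: HT HS mult.assoc)
  finally have lhs: "H 0 1 r ?K * ?S * (?T * H 1 1 r ?K) * G L
      = qvar * (R r * (?T * H 1 1 r k * ?Z))"
    by (simp only: mult.assoc)
  have "?D * ?Z = H 0 1 r ?K * (?D * ?S) * G L"
    by (simp only: grid_phase_tail_proj flip: mult.assoc)
  also have "\<dots> = H 0 1 r ?K * ?S * (E (Suc (Suc k)) (Suc k) * G L)"
    by (simp only: tail_proj_s_star mult.assoc)
  finally have DZ: "?D * ?Z = 0" using L by (simp add: tail_proj_cutoff_eq_0)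
  have "H 1 1 r ?K * ?Z = H 1 1 r k * (?Z + (R r - 1) * (?D * ?Z))"
    unfolding fam_grid_phase[of 1 1] by (simp add: algebra_simps)
  then have HZ: "H 1 1 r ?K * ?Z = H 1 1 r k * ?Z" by (simp add: DZ del: One_nat_def)
  show ?thesis
    unfolding deform_s_star deform_t lhs by (simp only: mult.assoc HZ[unfolded mult.assoc])
qed

text \<open>
  Tail projections are diagonal, hence commute with the phases and are not changed by the
  deformation.
\<close>

lemma deform_s_range_proj:
  assumes "cmod r = 1"
  shows "fam (subst (deform r K) (range_proj s_gen (\<lambda>j. fs_star (s_gen j)) k))
    = (P k :: ('n::finite, 'm::finite) E_family)"
proof (induction k)
  case (Suc k)
  have PH: "P k * (H 0 1 r K * x) = H 0 1 r K * (P k * x)" for x :: "('n, 'm) E_family"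
    unfolding mult.assoc[symmetric] grid_phase_tail_proj[of 0 1 r K k 0, unfolded fam_tail_proj range_proj.simps mult_1_right] ..
  have HH: "H 0 1 (cnj r) K * (H 0 1 r K * x) = x" for x :: "('n, 'm) E_family"
    by (simp add: grid_phase_inverse[OF assms] flip: mult.assoc)
  show ?case
    using Suc unfolding range_proj.simps subst_sum subst_mult fam_sum fam_mult subst_star fam_fs_star
      subst_gen[of _ "Inl _", folded s_gen_def] deform_s_star
    by (simp add: deform_s mult.assoc PH HH del: One_nat_def)
qed simp

lemma deform_t_range_proj:
  assumes "cmod r = 1"
  shows "fam (subst (deform r K) (range_proj t_gen (\<lambda>j. fs_star (t_gen j)) k))
    = (Q k :: ('n::finite, 'm::finite) E_family)"
proof (induction k)
  case (Suc k)
  have QH: "Q k * (H 1 1 (cnj r) K * x) = H 1 1 (cnj r) K * (Q k * x)" for x :: "('n, 'm) E_family"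
    unfolding mult.assoc[symmetric] grid_phase_tail_proj[of 1 1 "cnj r" K 0 k, unfolded fam_tail_proj range_proj.simps mult_1_left] ..
  have HH: "H 1 1 r K * (H 1 1 (cnj r) K * x) = x" for x :: "('n, 'm) E_family"
    by (simp add: grid_phase_inverse'[OF assms] flip: mult.assoc)
  show ?case
    using Suc unfolding range_proj.simps subst_sum subst_mult fam_sum fam_mult subst_star fam_fs_star
      subst_gen[of _ "Inr _", folded t_gen_def] deform_t_star
    by (simp add: deform_t mult.assoc QH HH del: One_nat_def)
qed simp

lemma deform_tail_proj: "cmod r = 1 \<Longrightarrow> fam (subst (deform r K) (tail_proj k l)) = E k l"
  by (simp add: tail_proj_def subst_mult fam_mult deform_s_range_proj deform_t_range_proj)
    (simp add: fam_range_proj fam_fs_star)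

lemma deform_cutoff: "cmod r = 1 \<Longrightarrow> fam (subst (deform r K) (cutoff L)) = G L"
  by (simp add: cutoff_def subst_diff fam_diff deform_tail_proj)

lemma deform_grid_phase: "cmod r = 1 \<Longrightarrow> fam (subst (deform r K) (grid_phase a b r' k)) = H a b r' k"
  by (simp add: grid_phase_def fam_subst_phase deform_tail_proj subst_scalar fam_phase)

end

section \<open>Locality of substitutions\<close>

text \<open>
  The two conditions of the following induction over words: two substitutions have the same
  effect on small cutoffs, and a generator moves a cutoff by at most one step.
\<close>

definition agree_up_to ::
  "nat \<Rightarrow> ('n::finite + 'm::finite \<Rightarrow> ('n + 'm) free_star_alg) \<Rightarrow> ('n + 'm \<Rightarrow> ('n + 'm) free_star_alg) \<Rightarrow> bool"
  where
  "agree_up_to K a b \<longleftrightarrow> (\<forall>L\<le>K. \<forall>g.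
     fam (a g) * fam (cutoff L) = fam (b g) * fam (cutoff L) \<and>
     fam_star (fam (a g)) * fam (cutoff L) = fam_star (fam (b g)) * fam (cutoff L))"

definition banded :: "('n::finite + 'm::finite \<Rightarrow> ('n + 'm) free_star_alg) \<Rightarrow> bool" where
  "banded b \<longleftrightarrow> (\<forall>L g.
     fam (cutoff (Suc L)) * (fam (b g) * fam (cutoff L)) = fam (b g) * fam (cutoff L) \<and>
     fam (cutoff (Suc L)) * (fam_star (fam (b g)) * fam (cutoff L)) = fam_star (fam (b g)) * fam (cutoff L))"

lemma agree_up_to_refl: "agree_up_to K a a"
  by (simp add: agree_up_to_def)

lemma cutoff_absorb:
  assumes "fam (cutoff k) * x = x" "k \<le> l"
  shows "fam (cutoff l) * x = x"
proof -
  have "fam (cutoff l) * (fam (cutoff k) * x) = fam (cutoff k) * x"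
    unfolding mult.assoc[symmetric] cutoff_mult using assms(2) by (simp add: min_def)
  then show ?thesis by (simp only: assms(1))
qed

text \<open>
  The number \<open>d\<close> may be thought of as the degree of \<open>x\<close>: every letter of a word raises the
  cutoff by at most one. It must not depend on the substitutions, because these will involve
  words of unbounded length: the phases are polynomials of large degree, but they do not move
  cutoffs.
\<close>

lemma subst_near_cutoff:
  fixes x :: "('n::finite + 'm::finite) free_star_alg"
  shows "\<exists>d. \<forall>a b K L. banded b \<longrightarrow> agree_up_to K a b \<longrightarrow> L + d \<le> K \<longrightarrow>
    fam (subst a x) * fam (cutoff L) = fam (subst b x) * fam (cutoff L) \<and>
    fam (cutoff (L + d)) * (fam (subst b x) * fam (cutoff L)) = fam (subst b x) * fam (cutoff L)"
    (is "\<exists>d. ?P d x")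
proof (induction x rule: free_star_alg_induct)
  case one
  have "?P 0 1" by (simp add: cutoff_mult)
  then show ?case by blast
next
  case (add x y)
  then obtain d e where d: "?P d x" and e: "?P e y" by blast
  have "?P (max d e) (x + y)"
  proof (intro allI impI)
    fix a b :: "'n + 'm \<Rightarrow> ('n + 'm) free_star_alg" and K L
    assume "banded b" "agree_up_to K a b" "L + max d e \<le> K"
    then have x: "fam (subst a x) * fam (cutoff L) = fam (subst b x) * fam (cutoff L)"
        "fam (cutoff (L + d)) * (fam (subst b x) * fam (cutoff L)) = fam (subst b x) * fam (cutoff L)"
      and y: "fam (subst a y) * fam (cutoff L) = fam (subst b y) * fam (cutoff L)"
        "fam (cutoff (L + e)) * (fam (subst b y) * fam (cutoff L)) = fam (subst b y) * fam (cutoff L)"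
      using d[rule_format, of b K a L] e[rule_format, of b K a L] by simp_all
    have "fam (cutoff (L + max d e)) * (fam (subst b x) * fam (cutoff L)) = fam (subst b x) * fam (cutoff L)"
        "fam (cutoff (L + max d e)) * (fam (subst b y) * fam (cutoff L)) = fam (subst b y) * fam (cutoff L)"
      by (rule cutoff_absorb[OF x(2)] cutoff_absorb[OF y(2)]; simp)+
    then show "fam (subst a (x + y)) * fam (cutoff L) = fam (subst b (x + y)) * fam (cutoff L) \<and>
      fam (cutoff (L + max d e)) * (fam (subst b (x + y)) * fam (cutoff L))
        = fam (subst b (x + y)) * fam (cutoff L)"
      using x(1) y(1) by (simp add: subst_add fam_add distrib_right distrib_left)
  qed
  then show ?case by blast
next
  case (scale c x)
  then obtain d where d: "?P d x" by blast
  have "?P d (fs_scale c x)"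
    using d by (simp add: subst_mult subst_scalar fs_scale_def fam_mult scalar_left_commute mult.assoc)
  then show ?case by blast
next
  case (gen g x)
  then obtain d where d: "?P d x" by blast
  have "?P (Suc d) (fs_gen g * x)"
  proof (intro allI impI)
    fix a b :: "'n + 'm \<Rightarrow> ('n + 'm) free_star_alg" and K L
    assume b: "banded b" and ab: "agree_up_to K a b" and K: "L + Suc d \<le> K"
    let ?x = "fam (subst b x) * fam (cutoff L)"
    have x: "fam (subst a x) * fam (cutoff L) = ?x" "fam (cutoff (L + d)) * ?x = ?x"
      using d[rule_format, of b K a L] b ab K by simp_all
    have g: "fam (a g) * fam (cutoff (L + d)) = fam (b g) * fam (cutoff (L + d))"
      "fam (cutoff (Suc (L + d))) * (fam (b g) * fam (cutoff (L + d))) = fam (b g) * fam (cutoff (L + d))"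
      using ab b K by (simp_all add: agree_up_to_def banded_def)
    have "fam (a g) * (fam (cutoff (L + d)) * ?x) = fam (b g) * (fam (cutoff (L + d)) * ?x)"
      by (simp only: g(1) flip: mult.assoc)
    moreover have "fam (cutoff (Suc (L + d))) * (fam (b g) * (fam (cutoff (L + d)) * ?x))
        = fam (b g) * (fam (cutoff (L + d)) * ?x)"
      by (simp only: g(2) flip: mult.assoc[of _ _ ?x] mult.assoc[of _ _ "fam (cutoff (L + d)) * ?x"])
    ultimately show "fam (subst a (fs_gen g * x)) * fam (cutoff L) = fam (subst b (fs_gen g * x)) * fam (cutoff L) \<and>
      fam (cutoff (L + Suc d)) * (fam (subst b (fs_gen g * x)) * fam (cutoff L))
        = fam (subst b (fs_gen g * x)) * fam (cutoff L)"
      by (simp add: subst_mult fam_mult mult.assoc x)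
  qed
  then show ?case by blast
next
  case (star_gen g x)
  then obtain d where d: "?P d x" by blast
  have "?P (Suc d) (fs_star (fs_gen g) * x)"
  proof (intro allI impI)
    fix a b :: "'n + 'm \<Rightarrow> ('n + 'm) free_star_alg" and K L
    assume b: "banded b" and ab: "agree_up_to K a b" and K: "L + Suc d \<le> K"
    let ?x = "fam (subst b x) * fam (cutoff L)"
    have x: "fam (subst a x) * fam (cutoff L) = ?x" "fam (cutoff (L + d)) * ?x = ?x"
      using d[rule_format, of b K a L] b ab K by simp_all
    have g: "fam_star (fam (a g)) * fam (cutoff (L + d)) = fam_star (fam (b g)) * fam (cutoff (L + d))"
      "fam (cutoff (Suc (L + d))) * (fam_star (fam (b g)) * fam (cutoff (L + d))) = fam_star (fam (b g)) * fam (cutoff (L + d))"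
      using ab b K by (simp_all add: agree_up_to_def banded_def)
    have "fam_star (fam (a g)) * (fam (cutoff (L + d)) * ?x) = fam_star (fam (b g)) * (fam (cutoff (L + d)) * ?x)"
      by (simp only: g(1) flip: mult.assoc)
    moreover have "fam (cutoff (Suc (L + d))) * (fam_star (fam (b g)) * (fam (cutoff (L + d)) * ?x))
        = fam_star (fam (b g)) * (fam (cutoff (L + d)) * ?x)"
      by (simp only: g(2) flip: mult.assoc[of _ _ ?x] mult.assoc[of _ _ "fam (cutoff (L + d)) * ?x"])
    ultimately show "fam (subst a (fs_star (fs_gen g) * x)) * fam (cutoff L)
        = fam (subst b (fs_star (fs_gen g) * x)) * fam (cutoff L) \<and>
      fam (cutoff (L + Suc d)) * (fam (subst b (fs_star (fs_gen g) * x)) * fam (cutoff L))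
        = fam (subst b (fs_star (fs_gen g) * x)) * fam (cutoff L)"
      by (simp add: subst_mult subst_star fam_mult fam_fs_star mult.assoc x)
  qed
  then show ?case by blast
qed

lemma cutoff_mult_eq:
  "fam (cutoff l) * x = x" if "fam (tail_proj l l) * x = 0"
  using that by (simp add: fam_cutoff left_diff_distrib)

lemma banded_deform: "banded (deform r K)"
  unfolding banded_def
proof (intro allI conjI)
  fix L :: nat and g :: "'a + 'b"
  show "fam (cutoff (Suc L)) * (fam (deform r K g) * fam (cutoff L)) = fam (deform r K g) * fam (cutoff L)"
  proof (cases g; hypsubst, intro cutoff_mult_eq)
    fix j :: 'a
    have "fam (tail_proj (Suc L) (Suc L)) * (fam (deform r K (Inl j)) * fam (cutoff L))
        = (fam (tail_proj (Suc L) (Suc L)) * fam (s_gen j)) * fam (grid_phase 0 1 (cnj r) K) * fam (cutoff L)"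
      by (simp only: deform_s mult.assoc)
    also have "\<dots> = fam (s_gen j) * (fam (tail_proj L (Suc L)) * fam (grid_phase 0 1 (cnj r) K)) * fam (cutoff L)"
      by (simp only: tail_proj_s mult.assoc)
    also have "\<dots> = fam (s_gen j) * fam (grid_phase 0 1 (cnj r) K) * (fam (tail_proj L (Suc L)) * fam (cutoff L))"
      by (simp only: grid_phase_tail_proj[symmetric] mult.assoc)
    finally show "fam (tail_proj (Suc L) (Suc L)) * (fam (deform r K (Inl j)) * fam (cutoff L)) = 0"
      by (simp add: tail_proj_cutoff_eq_0)
  next
    fix j :: 'b
    have "fam (tail_proj (Suc L) (Suc L)) * (fam (deform r K (Inr j)) * fam (cutoff L))
        = (fam (tail_proj (Suc L) (Suc L)) * fam (t_gen j)) * fam (grid_phase 1 1 r K) * fam (cutoff L)"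
      by (simp only: deform_t mult.assoc)
    also have "\<dots> = fam (t_gen j) * (fam (tail_proj (Suc L) L) * fam (grid_phase 1 1 r K)) * fam (cutoff L)"
      by (simp only: tail_proj_t mult.assoc)
    also have "\<dots> = fam (t_gen j) * fam (grid_phase 1 1 r K) * (fam (tail_proj (Suc L) L) * fam (cutoff L))"
      by (simp only: grid_phase_tail_proj[symmetric] mult.assoc)
    finally show "fam (tail_proj (Suc L) (Suc L)) * (fam (deform r K (Inr j)) * fam (cutoff L)) = 0"
      by (simp add: tail_proj_cutoff_eq_0)
  qed
  show "fam (cutoff (Suc L)) * (fam_star (fam (deform r K g)) * fam (cutoff L)) = fam_star (fam (deform r K g)) * fam (cutoff L)"
  proof (cases g; hypsubst, intro cutoff_mult_eq)
    fix j :: 'a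
    have "fam (tail_proj (Suc L) (Suc L)) * (fam_star (fam (deform r K (Inl j))) * fam (cutoff L))
        = (fam (tail_proj (Suc L) (Suc L)) * fam (grid_phase 0 1 r K)) * fam_star (fam (s_gen j)) * fam (cutoff L)"
      by (simp only: deform_s_star mult.assoc)
    also have "\<dots> = fam (grid_phase 0 1 r K) * fam_star (fam (s_gen j)) * (fam (tail_proj (Suc (Suc L)) (Suc L)) * fam (cutoff L))"
      by (simp only: grid_phase_tail_proj[symmetric] mult.assoc) (simp only: tail_proj_s_star flip: mult.assoc)
    finally show "fam (tail_proj (Suc L) (Suc L)) * (fam_star (fam (deform r K (Inl j))) * fam (cutoff L)) = 0"
      by (simp add: tail_proj_cutoff_eq_0)
  next
    fix j :: 'b
    have "fam (tail_proj (Suc L) (Suc L)) * (fam_star (fam (deform r K (Inr j))) * fam (cutoff L))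
        = (fam (tail_proj (Suc L) (Suc L)) * fam (grid_phase 1 1 (cnj r) K)) * fam_star (fam (t_gen j)) * fam (cutoff L)"
      by (simp only: deform_t_star mult.assoc)
    also have "\<dots> = fam (grid_phase 1 1 (cnj r) K) * fam_star (fam (t_gen j)) * (fam (tail_proj (Suc L) (Suc (Suc L))) * fam (cutoff L))"
      by (simp only: grid_phase_tail_proj[symmetric] mult.assoc) (simp only: tail_proj_t_star flip: mult.assoc)
    finally show "fam (tail_proj (Suc L) (Suc L)) * (fam_star (fam (deform r K (Inr j))) * fam (cutoff L)) = 0"
      by (simp add: tail_proj_cutoff_eq_0)
  qed
qed

lemma deform_0: "deform r 0 = fs_gen"
  by (auto simp: deform_def grid_phase_def s_gen_def t_gen_def fun_eq_iff split: sum.split)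

lemma banded_fs_gen: "banded fs_gen"
  using banded_deform[of _ 0] by (simp add: deform_0)

lemma agree_up_to_deform: "agree_up_to (min K K') (deform r K) (deform r K')"
  unfolding agree_up_to_def
proof (intro allI impI conjI)
  fix L :: nat and g :: "'a + 'b" assume "L \<le> min K K'"
  then have L: "L \<le> K" "L \<le> K'" by simp_all
  show "fam (deform r K g) * fam (cutoff L) = fam (deform r K' g) * fam (cutoff L)"
    by (cases g) (simp_all only: deform_s deform_t mult.assoc grid_phase_cutoff[OF L(1)] grid_phase_cutoff[OF L(2)])
  show "fam_star (fam (deform r K g)) * fam (cutoff L) = fam_star (fam (deform r K' g)) * fam (cutoff L)"
    by (cases g) (simp_all only: deform_s_star deform_t_star grid_phase_s_star grid_phase_t_star mult.assoc
        grid_phase_cutoff[OF L(1)] grid_phase_cutoff[OF L(2)])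
qed

text \<open>
  Deforming by \<open>r\<close> and then by its conjugate multiplies each generator by two phases that are
  inverse to each other up to the truncations. The projections inside the first phase may be
  left alone, by \<open>deform_grid_phase\<close>.
\<close>

lemma agree_up_to_deform_deform:
  assumes r: "cmod r = 1"
  shows "agree_up_to (min K K') (\<lambda>g. subst (deform (cnj r) K') (deform r K g)) fs_gen"
  unfolding agree_up_to_def
proof (intro allI impI)
  fix L :: nat and g :: "'a + 'b" assume "L \<le> min K K'"
  then have L: "L \<le> K'" "L \<le> K" by simp_all
  have r': "cmod (cnj r) = 1" using r by simp
  show "fam (subst (deform (cnj r) K') (deform r K g)) * fam (cutoff L) = fam (fs_gen g) * fam (cutoff L) \<and>
    fam_star (fam (subst (deform (cnj r) K') (deform r K g))) * fam (cutoff L) = fam_star (fam (fs_gen g)) * fam (cutoff L)"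
  proof (cases g)
    case (Inl j)
    have *: "fam (subst (deform (cnj r) K') (deform r K g))
        = fam (s_gen j) * (fam (grid_phase 0 1 r K') * fam (grid_phase 0 1 (cnj r) K))"
      unfolding Inl by (simp add: deform_def[of r] subst_mult fam_mult deform_grid_phase[OF r']
          subst_gen[of _ "Inl _", folded s_gen_def] deform_s mult.assoc del: One_nat_def)
    have **: "fam_star (fam (subst (deform (cnj r) K') (deform r K g)))
        = fam_star (fam (s_gen j)) * (fam (grid_phase (Suc 0) 1 (cnj r) K') * fam (grid_phase (Suc 0) 1 r K))"
      unfolding * fam_star_mult grid_phase_star complex_cnj_cnj grid_phase_commute[of "Suc 0" 1 "cnj r" K']
      by (simp only: grid_phase_s_star mult.assoc) (simp only: grid_phase_s_star flip: mult.assoc)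
    show ?thesis
      unfolding ** unfolding * by (simp add: mult.assoc grid_phase_inverse_cutoff[OF r' L, unfolded mult.assoc complex_cnj_cnj]
          grid_phase_inverse_cutoff[OF r L, unfolded mult.assoc] Inl s_gen_def del: One_nat_def)
  next
    case (Inr j)
    have *: "fam (subst (deform (cnj r) K') (deform r K g))
        = fam (t_gen j) * (fam (grid_phase 1 1 (cnj r) K') * fam (grid_phase 1 1 r K))"
      unfolding Inr by (simp add: deform_def[of r] subst_mult fam_mult deform_grid_phase[OF r']
          subst_gen[of _ "Inr _", folded t_gen_def] deform_t mult.assoc del: One_nat_def)
    have **: "fam_star (fam (subst (deform (cnj r) K') (deform r K g)))
        = fam_star (fam (t_gen j)) * (fam (grid_phase 1 (Suc 1) r K') * fam (grid_phase 1 (Suc 1) (cnj r) K))"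
      unfolding * fam_star_mult grid_phase_star complex_cnj_cnj grid_phase_commute[of 1 "Suc 1" r K']
      by (simp only: grid_phase_t_star mult.assoc) (simp only: grid_phase_t_star flip: mult.assoc)
    show ?thesis
      unfolding ** unfolding * by (simp add: mult.assoc grid_phase_inverse_cutoff[OF r' L, unfolded mult.assoc complex_cnj_cnj]
          grid_phase_inverse_cutoff[OF r L, unfolded mult.assoc] Inr t_gen_def del: One_nat_def)
  qed
qed

section \<open>The C*-seminorm of the deformed generators\<close>

lemma deform_stable:
  fixes x :: "('n::finite + 'm::finite) free_star_alg"
  assumes q: "cmod q = 1"
  obtains d where "\<And>L K K'. L + d \<le> K \<Longrightarrow> L + d \<le> K' \<Longrightarrow>
      E_eq q (subst (deform r K) x * cutoff L) (subst (deform r K') x * cutoff L)"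
    "\<And>L K. E_eq q (cutoff (L + d) * (subst (deform r K) x * cutoff L)) (subst (deform r K) x * cutoff L)"
proof -
  from subst_near_cutoff[of x] obtain d where d: "\<And>a b K L. banded b \<Longrightarrow> agree_up_to K a b \<Longrightarrow> L + d \<le> K \<Longrightarrow>
    fam (subst a x) * fam (cutoff L) = fam (subst b x) * fam (cutoff L) \<and>
    fam (cutoff (L + d)) * (fam (subst b x) * fam (cutoff L)) = fam (subst b x) * fam (cutoff L)"
    by blast
  show ?thesis
  proof
    fix L K K' assume "L + d \<le> K" "L + d \<le> K'"
    then show "E_eq q (subst (deform r K) x * cutoff L) (subst (deform r K') x * cutoff L)"
      using d[OF banded_deform agree_up_to_deform, of L K K' r] by (intro E_eq_fam[OF _ q]) (simp add: fam_mult)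
  next
    fix L K
    show "E_eq q (cutoff (L + d) * (subst (deform r K) x * cutoff L)) (subst (deform r K) x * cutoff L)"
      using d[OF banded_deform agree_up_to_refl order_refl, of r K L] by (intro E_eq_fam[OF _ q]) (simp add: fam_mult)
  qed
qed

lemma deform_inverse:
  fixes x :: "('n::finite + 'm::finite) free_star_alg"
  assumes q: "cmod q = 1" and r: "cmod r = 1"
  obtains d where "\<And>L K K'. L + d \<le> K \<Longrightarrow> L + d \<le> K' \<Longrightarrow>
      E_eq q (subst (deform (cnj r) K') (subst (deform r K) x) * cutoff L) (x * cutoff L)"
    "\<And>L. E_eq q (cutoff (L + d) * (x * cutoff L)) (x * cutoff L)"
proof -
  from subst_near_cutoff[of x] obtain d where d: "\<And>a b K L. banded b \<Longrightarrow> agree_up_to K a b \<Longrightarrow> L + d \<le> K \<Longrightarrow>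
    fam (subst a x) * fam (cutoff L) = fam (subst b x) * fam (cutoff L) \<and>
    fam (cutoff (L + d)) * (fam (subst b x) * fam (cutoff L)) = fam (subst b x) * fam (cutoff L)"
    by blast
  show ?thesis
  proof
    fix L K K' assume "L + d \<le> K" "L + d \<le> K'"
    then show "E_eq q (subst (deform (cnj r) K') (subst (deform r K) x) * cutoff L) (x * cutoff L)"
      using d[OF banded_fs_gen agree_up_to_deform_deform[OF r], of L K K']
      by (intro E_eq_fam[OF _ q]) (simp add: fam_mult subst_subst subst_fs_gen)
  next
    fix L
    show "E_eq q (cutoff (L + d) * (x * cutoff L)) (x * cutoff L)"
      using d[OF banded_fs_gen agree_up_to_refl order_refl, of L]
      by (intro E_eq_fam[OF _ q]) (simp add: fam_mult subst_fs_gen)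
  qed
qed

lemma cstar_seminorm_subst:
  assumes "cstar_seminorm N"
  shows "cstar_seminorm (\<lambda>x. N (subst a x))"
  using assms by (simp add: cstar_seminorm_def subst_add subst_scale subst_mult subst_star)

lemma E_norm_cutoff_le:
  assumes q: "cmod q = 1"
  shows "E_norm q (cutoff L :: ('n::finite + 'm::finite) free_star_alg) \<le> 1" (is "E_norm q ?g \<le> 1")
proof -
  have "fam (fs_star ?g * ?g) = fam ?g"
    by (simp add: fam_mult fam_fs_star cutoff_star cutoff_mult)
  from E_eq_norm[OF E_eq_fam[OF this q]] have "E_norm q ?g = 0 \<or> E_norm q ?g = 1"
    by (simp add: E_norm_cstar power2_eq_square)
  then show ?thesis by auto
qed

lemma deform_gen_relation:
  assumes "cmod r = 1"
  shows "fam (subst (deform r K) (fs_star (fs_gen g) * fs_gen g - 1)) = 0"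
  by (cases g) (simp_all add: subst_diff subst_mult subst_star fam_diff fam_mult fam_fs_star
      deform_s_isometry[OF assms] deform_t_isometry[OF assms])

lemma E_norm_deform_bounded:
  assumes q: "cmod q = 1" and r: "cmod r = 1"
  obtains C where "\<And>K. E_norm q (subst (deform r K) x) \<le> C"
proof -
  let ?R = "range (\<lambda>g. fs_star (fs_gen g) * fs_gen g - 1)"
  have "bdd_above ((\<lambda>p. p x) ` rel_seminorms ?R)"
    by (rule bdd_above_isometric_gens) simp
  then obtain C where C: "\<And>p. p \<in> rel_seminorms ?R \<Longrightarrow> p x \<le> C"
    by (auto simp: bdd_above_def)
  have "(\<lambda>x. E_norm q (subst (deform r K) x)) \<in> rel_seminorms ?R" for K
    unfolding rel_seminorms_def
    by (auto intro: cstar_seminorm_subst[OF cstar_seminorm_E_norm] E_norm_fam_0[OF deform_gen_relation[OF r] q])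
  from C[OF this] show ?thesis by (rule that)
qed

text \<open>
  The norm of the deformed \<open>x\<close> as an operator on the range of a cutoff and, below, on the
  ideal \<open>M\<close>.
\<close>

definition cut_norm :: "complex \<Rightarrow> complex \<Rightarrow> nat \<Rightarrow> ('n::finite + 'm::finite) free_star_alg \<Rightarrow> real" where
  "cut_norm q r L x = lim (\<lambda>K. E_norm q (subst (deform r K) x * cutoff L))"

definition deformed_norm :: "complex \<Rightarrow> complex \<Rightarrow> ('n::finite + 'm::finite) free_star_alg \<Rightarrow> real" where
  "deformed_norm q r x = (SUP L. cut_norm q r L x)"

context
  fixes q r :: complex
  assumes q: "cmod q = 1" and r: "cmod r = 1"
begin

lemma cut_norm_tendsto: "(\<lambda>K. E_norm q (subst (deform r K) x * cutoff L)) \<longlonglongrightarrow> cut_norm q r L x"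
proof -
  obtain d where d: "\<And>L K K'. L + d \<le> K \<Longrightarrow> L + d \<le> K' \<Longrightarrow>
      E_eq q (subst (deform r K) x * cutoff L) (subst (deform r K') x * cutoff L)"
    using deform_stable[OF q, where r = r and x = x] by metis
  have "\<forall>\<^sub>F K in sequentially. E_norm q (subst (deform r (L + d)) x * cutoff L) = E_norm q (subst (deform r K) x * cutoff L)"
    unfolding eventually_sequentially using E_eq_norm[OF d[of L "L + d"]] by blast
  then have "(\<lambda>K. E_norm q (subst (deform r K) x * cutoff L)) \<longlonglongrightarrow> E_norm q (subst (deform r (L + d)) x * cutoff L)"
    by (rule tendsto_eventually[OF eventually_mono]) simp
  then show ?thesis unfolding cut_norm_def by (metis limI)
qed

lemma cut_norm_eqI:
  assumes "\<And>K. K0 \<le> K \<Longrightarrow> E_norm q (subst (deform r K) x * cutoff L) = c"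
  shows "cut_norm q r L x = c"
proof (rule LIMSEQ_unique[OF cut_norm_tendsto])
  show "(\<lambda>K. E_norm q (subst (deform r K) x * cutoff L)) \<longlonglongrightarrow> c"
    using assms by (intro tendsto_eventually) (auto simp: eventually_sequentially)
qed

lemma cut_norm_nonneg: "0 \<le> cut_norm q r L x"
  by (rule LIMSEQ_le_const[OF cut_norm_tendsto]) simp

lemma cut_norm_bdd:
  fixes x :: "('a::finite + 'b::finite) free_star_alg"
  shows "bdd_above (range (\<lambda>L. cut_norm q r L x))"
proof -
  obtain C where C: "\<And>K. E_norm q (subst (deform r K) x) \<le> C"
    using E_norm_deform_bounded[OF q r] by metis
  have "E_norm q (subst (deform r K) x * cutoff L) \<le> C" for K L
  proof -
    let ?x = "subst (deform r K) x"
    have "E_norm q (?x * cutoff L) \<le> E_norm q ?x * E_norm q (cutoff L :: ('a + 'b) free_star_alg)"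
      by (rule E_norm_mult)
    also have "\<dots> \<le> E_norm q ?x" by (rule mult_left_le[OF E_norm_cutoff_le[OF q] E_norm_nonneg])
    also have "\<dots> \<le> C" by (rule C)
    finally show ?thesis .
  qed
  then have "cut_norm q r L x \<le> C" for L
    by (intro LIMSEQ_le_const2[OF cut_norm_tendsto]) auto
  then show ?thesis by (auto simp: bdd_above_def)
qed

lemma cut_norm_le: "cut_norm q r L x \<le> deformed_norm q r x"
  unfolding deformed_norm_def by (rule cSUP_upper[OF UNIV_I cut_norm_bdd])

lemma deformed_norm_least: "(\<And>L. cut_norm q r L x \<le> c) \<Longrightarrow> deformed_norm q r x \<le> c"
  unfolding deformed_norm_def by (rule cSUP_least) auto

lemma deformed_norm_nonneg: "0 \<le> deformed_norm q r x"
  using cut_norm_nonneg cut_norm_le order_trans by blast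

lemma cut_norm_add: "cut_norm q r L (x + y) \<le> cut_norm q r L x + cut_norm q r L y"
  by (rule LIMSEQ_le[OF cut_norm_tendsto tendsto_add[OF cut_norm_tendsto cut_norm_tendsto]])
    (auto simp: subst_add distrib_right E_norm_add)

lemma cut_norm_scale: "cut_norm q r L (fs_scale c x) = cmod c * cut_norm q r L x"
  by (rule LIMSEQ_unique[OF cut_norm_tendsto])
    (simp add: subst_scale fs_scale_mult_left E_norm_scale tendsto_mult_left cut_norm_tendsto)

text \<open>
  The second factor maps the range of a cutoff into the range of a larger one, independently
  of the truncation.
\<close>

lemma cut_norm_mult: "\<exists>L'. cut_norm q r L (x * y) \<le> cut_norm q r L' x * cut_norm q r L y"
proof -
  obtain d where d: "\<And>L K. E_eq q (cutoff (L + d) * (subst (deform r K) y * cutoff L)) (subst (deform r K) y * cutoff L)"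
    using deform_stable[OF q, where r = r and x = y] by metis
  have "E_norm q (subst (deform r K) (x * y) * cutoff L)
      \<le> E_norm q (subst (deform r K) x * cutoff (L + d)) * E_norm q (subst (deform r K) y * cutoff L)" for K
  proof -
    have "E_norm q (subst (deform r K) (x * y) * cutoff L)
        = E_norm q (subst (deform r K) x * (cutoff (L + d) * (subst (deform r K) y * cutoff L)))"
      unfolding subst_mult mult.assoc by (rule E_eq_norm[OF E_eq_mult[OF E_eq_refl E_eq_sym[OF d]]])
    also have "\<dots> \<le> E_norm q (subst (deform r K) x * cutoff (L + d)) * E_norm q (subst (deform r K) y * cutoff L)"
      unfolding mult.assoc[symmetric, of _ "cutoff (L + d)"] by (rule E_norm_mult)
    finally show ?thesis .
  qed
  then have "cut_norm q r L (x * y) \<le> cut_norm q r (L + d) x * cut_norm q r L y"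
    by (intro LIMSEQ_le[OF cut_norm_tendsto tendsto_mult[OF cut_norm_tendsto cut_norm_tendsto]]) auto
  then show ?thesis by blast
qed

lemma cut_norm_cstar:
  fixes x :: "('a::finite + 'b::finite) free_star_alg"
  shows "(cut_norm q r L x)\<^sup>2 \<le> cut_norm q r L (fs_star x * x)"
proof (rule LIMSEQ_le[OF tendsto_power[OF cut_norm_tendsto] cut_norm_tendsto])
  have "(E_norm q (subst (deform r K) x * cutoff L))\<^sup>2 \<le> E_norm q (subst (deform r K) (fs_star x * x) * cutoff L)" for K
  proof -
    let ?x = "subst (deform r K) x" and ?g = "cutoff L :: ('a + 'b) free_star_alg"
    have "(E_norm q (?x * ?g))\<^sup>2 = E_norm q (fs_star ?g * (fs_star ?x * ?x * ?g))"
      by (simp add: fs_star_mult mult.assoc flip: E_norm_cstar)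
    also have "\<dots> \<le> E_norm q ?g * E_norm q (fs_star ?x * ?x * ?g)"
      using E_norm_mult[of q "fs_star ?g" "fs_star ?x * ?x * ?g"] by (simp add: E_norm_star)
    also have "\<dots> \<le> E_norm q (fs_star ?x * ?x * ?g)"
      by (rule mult_left_le_one_le[OF E_norm_nonneg E_norm_nonneg E_norm_cutoff_le[OF q]])
    finally show ?thesis by (simp add: subst_mult subst_star)
  qed
  then show "\<exists>K0. \<forall>K\<ge>K0. (E_norm q (subst (deform r K) x * cutoff L))\<^sup>2 \<le> E_norm q (subst (deform r K) (fs_star x * x) * cutoff L)"
    by blast
qed

lemma deformed_norm_mult: "deformed_norm q r (x * y) \<le> deformed_norm q r x * deformed_norm q r y"
proof (rule deformed_norm_least)
  fix L
  obtain L' where "cut_norm q r L (x * y) \<le> cut_norm q r L' x * cut_norm q r L y"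
    using cut_norm_mult by blast
  also have "\<dots> \<le> deformed_norm q r x * deformed_norm q r y"
    by (intro mult_mono cut_norm_le cut_norm_nonneg deformed_norm_nonneg)
  finally show "cut_norm q r L (x * y) \<le> deformed_norm q r x * deformed_norm q r y" .
qed

lemma deformed_norm_cstar_le: "(deformed_norm q r x)\<^sup>2 \<le> deformed_norm q r (fs_star x * x)"
proof -
  have "cut_norm q r L x \<le> sqrt (deformed_norm q r (fs_star x * x))" for L
    by (rule real_le_rsqrt) (rule order_trans[OF cut_norm_cstar cut_norm_le])
  from deformed_norm_least[OF this] have "deformed_norm q r x \<le> sqrt (deformed_norm q r (fs_star x * x))" .
  then show ?thesis
    using deformed_norm_nonneg by (metis power_mono real_sqrt_pow2)
qed

text \<open>
  The usual argument that the inequality of \<open>deformed_norm_cstar_le\<close> makes the involution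
  isometric.
\<close>

lemma deformed_norm_star_le: "deformed_norm q r (fs_star x) \<le> deformed_norm q r x"
proof (cases "deformed_norm q r (fs_star x) = 0")
  case False
  have "deformed_norm q r (fs_star x) * deformed_norm q r (fs_star x) \<le> deformed_norm q r x * deformed_norm q r (fs_star x)"
    using deformed_norm_cstar_le[of "fs_star x"] deformed_norm_mult[of x "fs_star x"]
    by (simp add: power2_eq_square)
  then show ?thesis
    using False deformed_norm_nonneg[of "fs_star x"] by (simp add: less_le)
qed (simp add: deformed_norm_nonneg)

lemma cstar_seminorm_deformed_norm: "cstar_seminorm (deformed_norm q r)"
  unfolding cstar_seminorm_def
proof (intro conjI allI)
  show "0 \<le> deformed_norm q r x" for x :: "('a + 'b) free_star_alg" by (rule deformed_norm_nonneg)
  show "deformed_norm q r (x + y) \<le> deformed_norm q r x + deformed_norm q r y" for x y :: "('a + 'b) free_star_alg"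
    by (rule deformed_norm_least) (rule order_trans[OF cut_norm_add add_mono[OF cut_norm_le cut_norm_le]])
  have scale: "deformed_norm q r (fs_scale c x) \<le> cmod c * deformed_norm q r x" for c and x :: "('a + 'b) free_star_alg"
    by (rule deformed_norm_least) (simp add: cut_norm_scale cut_norm_le mult_left_mono)
  show "deformed_norm q r (fs_scale c x) = cmod c * deformed_norm q r x" for c and x :: "('a + 'b) free_star_alg"
  proof (rule antisym[OF scale])
    show "cmod c * deformed_norm q r x \<le> deformed_norm q r (fs_scale c x)"
    proof (cases "c = 0")
      case False
      have "deformed_norm q r x \<le> cmod (inverse c) * deformed_norm q r (fs_scale c x)"
        using scale[of "inverse c" "fs_scale c x"] False by (simp flip: fs_scale_scale)
      then show ?thesis using False by (simp add: norm_divide field_simps)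
    qed (simp add: deformed_norm_nonneg)
  qed
  show "deformed_norm q r (x * y) \<le> deformed_norm q r x * deformed_norm q r y" for x y :: "('a + 'b) free_star_alg"
    by (rule deformed_norm_mult)
  show "deformed_norm q r (fs_star x * x) = (deformed_norm q r x)\<^sup>2" for x :: "('a + 'b) free_star_alg"
  proof (rule antisym[OF _ deformed_norm_cstar_le])
    have "deformed_norm q r (fs_star x * x) \<le> deformed_norm q r (fs_star x) * deformed_norm q r x"
      by (rule deformed_norm_mult)
    also have "\<dots> \<le> (deformed_norm q r x)\<^sup>2"
      unfolding power2_eq_square by (rule mult_right_mono[OF deformed_norm_star_le deformed_norm_nonneg])
    finally show "deformed_norm q r (fs_star x * x) \<le> (deformed_norm q r x)\<^sup>2" .
  qed
qed

lemma deformed_norm_eq_0I: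
  assumes "\<And>K L. L \<le> K \<Longrightarrow> 1 \<le> K \<Longrightarrow> E_norm q (subst (deform r K) x * cutoff L) = 0"
  shows "deformed_norm q r x = 0"
proof -
  have "cut_norm q r L x = 0" for L
    by (rule cut_norm_eqI[of "max 1 L"]) (rule assms, simp_all)
  then show ?thesis by (simp add: deformed_norm_def)
qed

lemma deformed_norm_rel_seminorm: "deformed_norm q r \<in> rel_seminorms (E_relations (q * r))"
proof -
  have "deformed_norm q r x = 0" if "x \<in> E_relations (q * r)" for x :: "('a + 'b) free_star_alg"
  proof (rule deformed_norm_eq_0I)
    fix K L :: nat assume K: "L \<le> K" "1 \<le> K"
    then obtain k where k: "K = Suc k" by (cases K) auto
    let ?h = "subst (deform r K)"
    have *: "?h (s_gen i) = deform r K (Inl i)" "?h (t_gen l) = deform r K (Inr l)" for i :: 'a and l :: 'b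
      by (simp_all add: s_gen_def t_gen_def)
    from that consider
      (s) i j where "x = fs_star (s_gen i) * s_gen j - (if i = j then 1 else 0)"
    | (t) i j where "x = fs_star (t_gen i) * t_gen j - (if i = j then 1 else 0)"
    | (st) j l where "x = fs_star (s_gen j) * t_gen l - fs_scale (q * r) (t_gen l * fs_star (s_gen j))"
      by (auto simp: E_relations_def)
    then show "E_norm q (?h x * cutoff L) = 0"
    proof cases
      case s
      have "fam (?h x) = 0"
        by (simp add: s subst_diff subst_mult subst_star * fam_diff fam_mult fam_fs_star deform_s_isometry[OF r])
      then show ?thesis by (intro E_norm_fam_0[OF _ q]) (simp add: fam_mult)
    next
      case t
      have "fam (?h x) = 0"
        by (simp add: t subst_diff subst_mult subst_star * fam_diff fam_mult fam_fs_star deform_t_isometry[OF r])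
      then show ?thesis by (intro E_norm_fam_0[OF _ q]) (simp add: fam_mult)
    next
      case st
      let ?x = "fs_star (deform r K (Inl j)) * deform r K (Inr l) * cutoff L"
        and ?y = "deform r K (Inr l) * fs_star (deform r K (Inl j)) * cutoff L"
      have "fam ?x = qvar * fam (Poly_Mapping.single 0 r * ?y)"
        using deform_s_star_t[OF r, of L k j l] K unfolding k by (simp add: fam_mult fam_fs_star mult.assoc)
      then have "E_eq q ?x (fs_scale q (Poly_Mapping.single 0 r * ?y))"
        using q by (simp add: fam_eq_qvar_iff)
      moreover have "?h x * cutoff L = ?x - fs_scale q (Poly_Mapping.single 0 r * ?y)"
        by (simp add: st subst_diff subst_mult subst_star subst_scale * left_diff_distrib
            fs_scale_mult_left fs_scale_scale flip: fs_scale_def)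
      ultimately show ?thesis by (simp add: E_eq_def)
    qed
  qed
  then show ?thesis by (simp add: rel_seminorms_def cstar_seminorm_deformed_norm)
qed

text \<open>
  Deformation does not increase norms: the norm of \<open>y\<close> is \<open>cut_norm q r L x\<close>, which is at most
  \<open>deformed_norm q r x\<close>, and this seminorm is one of those whose supremum is the norm for
  \<open>q r\<close>.
\<close>

lemma E_norm_deform_le:
  assumes "E_eq q y (y * cutoff L)" and K0: "\<And>K. K0 \<le> K \<Longrightarrow> E_eq q (subst (deform r K) x) y"
  shows "E_norm q y \<le> E_norm (q * r) x"
proof -
  have "cut_norm q r L x = E_norm q y"
    using E_eq_norm[OF E_eq_mult[OF K0 E_eq_refl]] E_eq_norm[OF assms(1)]
    by (intro cut_norm_eqI[of K0]) simp
  moreover have "deformed_norm q r x \<le> E_norm (q * r) x"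
    unfolding E_norm_def by (rule univ_seminorm_upper[OF bdd_above_E_seminorms deformed_norm_rel_seminorm])
  ultimately show ?thesis using cut_norm_le[of L x] by simp
qed

end

section \<open>Isomorphisms from isometric correspondences\<close>

text \<open>
  A *-subalgebra of the product of two C*-algebras that is isometric and has dense projections
  to both factors. Its closure has the same properties with full projections, so it is the
  graph of an isomorphism. The symmetric formulation makes injectivity and surjectivity
  instances of uniqueness and existence for the converse relation.
\<close>

locale isometric_correspondence =
  A: cstar_algebra A + B: cstar_algebra B
  for A :: "('a, 'r) star_algebra_scheme" (structure) and B :: "('b, 's) star_algebra_scheme" (structure) +
  fixes \<Gamma> :: "('a \<times> 'b) set"
  assumes carrier: "(a, b) \<in> \<Gamma> \<Longrightarrow> a \<in> carrier A \<and> b \<in> carrier B"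
    and add: "(a, b) \<in> \<Gamma> \<Longrightarrow> (a', b') \<in> \<Gamma> \<Longrightarrow> (a \<oplus>\<^bsub>A\<^esub> a', b \<oplus>\<^bsub>B\<^esub> b') \<in> \<Gamma>"
    and mult: "(a, b) \<in> \<Gamma> \<Longrightarrow> (a', b') \<in> \<Gamma> \<Longrightarrow> (a \<otimes>\<^bsub>A\<^esub> a', b \<otimes>\<^bsub>B\<^esub> b') \<in> \<Gamma>"
    and smult: "(a, b) \<in> \<Gamma> \<Longrightarrow> (c \<odot>\<^bsub>A\<^esub> a, c \<odot>\<^bsub>B\<^esub> b) \<in> \<Gamma>"
    and adj: "(a, b) \<in> \<Gamma> \<Longrightarrow> (adj A a, adj B b) \<in> \<Gamma>"
    and isometric: "(a, b) \<in> \<Gamma> \<Longrightarrow> nrm A a = nrm B b"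
    and dense_left: "a \<in> carrier A \<Longrightarrow> e > 0 \<Longrightarrow> \<exists>(x, y)\<in>\<Gamma>. nrm A (a \<ominus>\<^bsub>A\<^esub> x) < e"
    and dense_right: "b \<in> carrier B \<Longrightarrow> e > 0 \<Longrightarrow> \<exists>(x, y)\<in>\<Gamma>. nrm B (b \<ominus>\<^bsub>B\<^esub> y) < e"
begin

definition limit_pair :: "'a \<Rightarrow> 'b \<Rightarrow> bool" where
  "limit_pair a b \<longleftrightarrow> (\<exists>u v. (\<forall>k. (u k, v k) \<in> \<Gamma>) \<and> A.has_limit u a \<and> B.has_limit v b)"

lemma limit_pairI:
  "(\<And>k. (u k, v k) \<in> \<Gamma>) \<Longrightarrow> A.has_limit u a \<Longrightarrow> B.has_limit v b \<Longrightarrow> limit_pair a b"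
  unfolding limit_pair_def by blast

lemma converse: "isometric_correspondence B A (\<Gamma>\<inverse>)"
proof (unfold_locales, goal_cases)
  case (7 b e)
  then show ?case using dense_right[of b e] by auto
next
  case (8 a e)
  then show ?case using dense_left[of a e] by auto
qed (use carrier in \<open>auto intro: add mult smult adj isometric[symmetric]\<close>)

lemma minus: "(a, b) \<in> \<Gamma> \<Longrightarrow> (a', b') \<in> \<Gamma> \<Longrightarrow> (a \<ominus>\<^bsub>A\<^esub> a', b \<ominus>\<^bsub>B\<^esub> b') \<in> \<Gamma>"
  using add smult carrier by (simp add: A.minus_eq_smult B.minus_eq_smult)

lemma limit_pair_unique:
  assumes "limit_pair a b" "limit_pair a b'"
  shows "b = b'"
proof -
  obtain u v where uv: "\<And>k. (u k, v k) \<in> \<Gamma>" "A.has_limit u a" "B.has_limit v b"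
    using assms(1) unfolding limit_pair_def by blast
  obtain u' v' where uv': "\<And>k. (u' k, v' k) \<in> \<Gamma>" "A.has_limit u' a" "B.has_limit v' b'"
    using assms(2) unfolding limit_pair_def by blast
  have a: "a \<in> carrier A" using uv(2) by (simp add: A.has_limit_def)
  have "B.has_limit v b'"
  proof (rule B.has_limit_sandwich)
    show c: "v k \<in> carrier B" "b' \<in> carrier B" for k
      using carrier uv(1) uv'(3) by (auto simp: B.has_limit_def)
    show "nrm B (v k \<ominus>\<^bsub>B\<^esub> b') \<le> nrm A (u k \<ominus>\<^bsub>A\<^esub> a) + nrm A (u' k \<ominus>\<^bsub>A\<^esub> a) + nrm B (v' k \<ominus>\<^bsub>B\<^esub> b')" for k
    proof -
      have "nrm B (v k \<ominus>\<^bsub>B\<^esub> b') \<le> nrm B (v k \<ominus>\<^bsub>B\<^esub> v' k) + nrm B (v' k \<ominus>\<^bsub>B\<^esub> b')"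
        using c carrier[OF uv'(1)[of k]] by (intro B.nrm_triangle) auto
      also have "nrm B (v k \<ominus>\<^bsub>B\<^esub> v' k) = nrm A (u k \<ominus>\<^bsub>A\<^esub> u' k)"
        using isometric[OF minus[OF uv(1) uv'(1)]] by simp
      also have "\<dots> \<le> nrm A (u k \<ominus>\<^bsub>A\<^esub> a) + nrm A (u' k \<ominus>\<^bsub>A\<^esub> a)"
        using A.nrm_triangle[of "u k" a "u' k"] A.nrm_minus_commute[of a "u' k"] a
          carrier[OF uv(1)[of k]] carrier[OF uv'(1)[of k]] by simp
      finally show ?thesis by simp
    qed
    have "(\<lambda>k. nrm A (u k \<ominus>\<^bsub>A\<^esub> a) + nrm A (u' k \<ominus>\<^bsub>A\<^esub> a) + nrm B (v' k \<ominus>\<^bsub>B\<^esub> b')) \<longlonglongrightarrow> 0 + 0 + 0"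
      using uv uv' unfolding A.has_limit_def B.has_limit_def by (intro tendsto_add) auto
    then show "(\<lambda>k. nrm A (u k \<ominus>\<^bsub>A\<^esub> a) + nrm A (u' k \<ominus>\<^bsub>A\<^esub> a) + nrm B (v' k \<ominus>\<^bsub>B\<^esub> b')) \<longlonglongrightarrow> 0"
      by simp
  qed
  then show ?thesis using B.has_limit_unique uv(3) by blast
qed

lemma limit_pair_total:
  assumes a: "a \<in> carrier A"
  shows "\<exists>b\<in>carrier B. limit_pair a b"
proof -
  have "\<exists>x y. (x, y) \<in> \<Gamma> \<and> nrm A (a \<ominus>\<^bsub>A\<^esub> x) < inverse (real (Suc k))" for k
    using dense_left[OF a, of "inverse (real (Suc k))"] by auto
  then obtain u v where uv: "\<And>k. (u k, v k) \<in> \<Gamma>"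
    and u: "\<And>k. nrm A (a \<ominus>\<^bsub>A\<^esub> u k) < inverse (real (Suc k))" by metis
  note c = carrier[OF uv]
  have lim: "A.has_limit u a"
    using c a A.nrm_minus_commute[OF a] u
    by (intro A.has_limit_sandwich[OF _ _ _ LIMSEQ_inverse_real_of_nat]) (auto intro: less_imp_le)
  have "\<forall>e>0. \<exists>K. \<forall>i\<ge>K. \<forall>j\<ge>K. nrm B (v i \<ominus>\<^bsub>B\<^esub> v j) < e"
  proof (intro allI impI)
    fix e :: real assume "e > 0"
    then have "\<exists>K. \<forall>k\<ge>K. nrm A (u k \<ominus>\<^bsub>A\<^esub> a) < e/2"
      using lim unfolding A.has_limit_def LIMSEQ_iff by (metis A.nrm_nonneg abs_of_nonneg diff_zero
          half_gt_zero real_norm_def A.minus_closed)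
    then obtain K where K: "\<And>k. K \<le> k \<Longrightarrow> nrm A (u k \<ominus>\<^bsub>A\<^esub> a) < e/2" by blast
    have "nrm B (v i \<ominus>\<^bsub>B\<^esub> v j) < e" if "K \<le> i" "K \<le> j" for i j
      using isometric[OF minus[OF uv uv], of i j] A.nrm_triangle[of "u i" a "u j"] a c
        A.nrm_minus_commute[of a "u j"] K[OF that(1)] K[OF that(2)] by simp
    then show "\<exists>K. \<forall>i\<ge>K. \<forall>j\<ge>K. nrm B (v i \<ominus>\<^bsub>B\<^esub> v j) < e" by blast
  qed
  then obtain b where "b \<in> carrier B" "(\<lambda>k. nrm B (v k \<ominus>\<^bsub>B\<^esub> b)) \<longlonglongrightarrow> 0"
    using B.nrm_complete[of v] c by blast
  then show ?thesis
    using uv lim c unfolding limit_pair_def B.has_limit_def by blast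
qed

lemma cstar_isomorphic: "A \<simeq>\<^sub>C B"
proof -
  interpret inv: isometric_correspondence B A "\<Gamma>\<inverse>" by (rule converse)
  have inv: "inv.limit_pair b a \<longleftrightarrow> limit_pair a b" for a b
    unfolding limit_pair_def inv.limit_pair_def converse_iff by blast
  define f where "f a = (SOME b. b \<in> carrier B \<and> limit_pair a b)" for a
  have f: "f a \<in> carrier B" "limit_pair a (f a)" if "a \<in> carrier A" for a
    using someI_ex[of "\<lambda>b. b \<in> carrier B \<and> limit_pair a b"] limit_pair_total[OF that]
    unfolding f_def by blast+
  have f_eq: "f a = b" if "limit_pair a b" for a b
  proof (rule limit_pair_unique[OF _ that])
    have "a \<in> carrier A" using that unfolding limit_pair_def A.has_limit_def by blast
    then show "limit_pair a (f a)" by (rule f(2))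
  qed
  have "cstar_hom A B f"
    unfolding cstar_hom_def
  proof (intro conjI ballI allI funcsetI)
    fix a assume a: "a \<in> carrier A"
    show "f a \<in> carrier B" by (rule f(1)[OF a])
    from f(2)[OF a] obtain u v where uv: "\<And>k. (u k, v k) \<in> \<Gamma>" "A.has_limit u a" "B.has_limit v (f a)"
      unfolding limit_pair_def by auto
    have "limit_pair (c \<odot>\<^bsub>A\<^esub> a) (c \<odot>\<^bsub>B\<^esub> f a)" for c
      by (rule limit_pairI[OF smult[OF uv(1)] A.has_limit_smult[OF uv(2)] B.has_limit_smult[OF uv(3)]])
    then show "f (c \<odot>\<^bsub>A\<^esub> a) = c \<odot>\<^bsub>B\<^esub> f a" for c by (rule f_eq)
    have "limit_pair (adj A a) (adj B (f a))"
      by (rule limit_pairI[OF adj[OF uv(1)] A.has_limit_adj[OF uv(2)] B.has_limit_adj[OF uv(3)]])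
    then show "f (adj A a) = adj B (f a)" by (rule f_eq)
    fix a' assume a': "a' \<in> carrier A"
    from f(2)[OF a'] obtain u' v' where uv': "\<And>k. (u' k, v' k) \<in> \<Gamma>" "A.has_limit u' a'" "B.has_limit v' (f a')"
      unfolding limit_pair_def by blast
    have "limit_pair (a \<oplus>\<^bsub>A\<^esub> a') (f a \<oplus>\<^bsub>B\<^esub> f a')"
      by (rule limit_pairI[OF add[OF uv(1) uv'(1)] A.has_limit_add[OF uv(2) uv'(2)] B.has_limit_add[OF uv(3) uv'(3)]])
    then show "f (a \<oplus>\<^bsub>A\<^esub> a') = f a \<oplus>\<^bsub>B\<^esub> f a'" by (rule f_eq)
    have "limit_pair (a \<otimes>\<^bsub>A\<^esub> a') (f a \<otimes>\<^bsub>B\<^esub> f a')"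
      by (rule limit_pairI[OF mult[OF uv(1) uv'(1)] A.has_limit_mult[OF uv(2) uv'(2)] B.has_limit_mult[OF uv(3) uv'(3)]])
    then show "f (a \<otimes>\<^bsub>A\<^esub> a') = f a \<otimes>\<^bsub>B\<^esub> f a'" by (rule f_eq)
  qed
  moreover have "bij_betw f (carrier A) (carrier B)"
    unfolding bij_betw_def
  proof
    show "inj_on f (carrier A)"
      by (rule inj_onI) (metis f(2) inv inv.limit_pair_unique)
    show "f ` carrier A = carrier B"
    proof
      show "carrier B \<subseteq> f ` carrier A"
      proof
        fix b assume "b \<in> carrier B"
        then obtain a where "a \<in> carrier A" "limit_pair a b" using inv.limit_pair_total inv by blast
        then show "b \<in> f ` carrier A" using f_eq by blast
      qed
    qed (use f(1) in blast)
  qed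
  ultimately show ?thesis unfolding cstar_isomorphic_def by blast
qed

end

section \<open>Elements supported on a cutoff\<close>

abbreviation emb :: "complex \<Rightarrow> ('n + 'm) free_star_alg \<Rightarrow> (nat \<Rightarrow> ('n + 'm) free_star_alg) set" where
  "emb q \<equiv> univ_embed (E_relations q)"

lemma emb_closed: "emb q x \<in> carrier (E_alg q)"
  and emb_add: "emb q x \<oplus>\<^bsub>E_alg q\<^esub> emb q y = emb q (x + y)"
  and emb_mult: "emb q x \<otimes>\<^bsub>E_alg q\<^esub> emb q y = emb q (x * y)"
  and emb_smult: "c \<odot>\<^bsub>E_alg q\<^esub> emb q x = emb q (fs_scale c x)"
  and emb_adj: "adj (E_alg q) (emb q x) = emb q (fs_star x)"
  and emb_zero: "\<zero>\<^bsub>E_alg q\<^esub> = emb q 0"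
  and nrm_emb: "nrm (E_alg q) (emb q x) = E_norm q x"
proof -
  note N = cstar_seminorm_univ[of "E_relations q", OF bdd_above_E_seminorms] and C = Cau_const[OF N]
  note d = E_alg_def univ_cstar_algebra_def univ_embed_def E_norm_def
  show "emb q x \<in> carrier (E_alg q)"
    unfolding d by (rule cls_carrier[OF N C])
  show "emb q x \<oplus>\<^bsub>E_alg q\<^esub> emb q y = emb q (x + y)"
    unfolding d by (rule add_completion[OF N C C])
  show "emb q x \<otimes>\<^bsub>E_alg q\<^esub> emb q y = emb q (x * y)"
    unfolding d by (rule mult_completion[OF N C C])
  show "c \<odot>\<^bsub>E_alg q\<^esub> emb q x = emb q (fs_scale c x)"
    unfolding d by (rule smult_completion[OF N C])
  show "adj (E_alg q) (emb q x) = emb q (fs_star x)"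
    unfolding d by (rule adj_completion[OF N C])
  show "\<zero>\<^bsub>E_alg q\<^esub> = emb q 0"
    unfolding d by (rule zero_completion[OF N])
  show "nrm (E_alg q) (emb q x) = E_norm q x"
    unfolding d by (rule nrm_const[OF N])
qed

lemma emb_eq:
  assumes "E_eq q x y"
  shows "emb q x = emb q y"
proof -
  note N = cstar_seminorm_univ[of "E_relations q", OF bdd_above_E_seminorms] and C = Cau_const[OF N]
  show ?thesis
    unfolding univ_embed_def by (rule cls_eqI[OF N C C]) (use assms in \<open>simp add: E_eq_def E_norm_def\<close>)
qed

lemma emb_dense:
  assumes a: "a \<in> carrier (E_alg q)" and e: "e > 0"
  shows "\<exists>x. nrm (E_alg q) (a \<ominus>\<^bsub>E_alg q\<^esub> emb q x) < e"
proof -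
  have "e/2 > 0" using e by simp
  with a obtain x where "nrm (E_alg q) (a \<ominus>\<^bsub>E_alg q\<^esub> emb q x) \<le> e/2"
    unfolding E_alg_def univ_cstar_algebra_def univ_embed_def
    using completion_dense[OF cstar_seminorm_univ[OF bdd_above_E_seminorms]] by metis
  then have "nrm (E_alg q) (a \<ominus>\<^bsub>E_alg q\<^esub> emb q x) < e" using e by linarith
  then show ?thesis by blast
qed

definition supported :: "complex \<Rightarrow> nat \<Rightarrow> ('n::finite + 'm::finite) free_star_alg \<Rightarrow> bool" where
  "supported q L x \<longleftrightarrow> E_eq q (cutoff L * x) x \<and> E_eq q (x * cutoff L) x"

context
  fixes q :: complex
  assumes q: "cmod q = 1"
begin

lemma supported_mono:
  fixes x :: "('n::finite + 'm::finite) free_star_alg"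
  assumes x: "supported q L x" and "L \<le> M"
  shows "supported q M x"
proof -
  let ?g = "cutoff :: nat \<Rightarrow> ('n + 'm) free_star_alg"
  have g: "E_eq q (?g M * ?g L) (?g L)" "E_eq q (?g L * ?g M) (?g L)"
    using \<open>L \<le> M\<close> by (auto intro!: E_eq_fam[OF _ q] simp: fam_mult cutoff_mult min_def)
  have "E_eq q (?g M * x) (?g M * ?g L * x)"
    unfolding mult.assoc using x by (intro E_eq_mult[OF E_eq_refl E_eq_sym]) (simp add: supported_def)
  also have "E_eq q (?g M * ?g L * x) (?g L * x)" by (intro E_eq_mult g E_eq_refl)
  also have "E_eq q (?g L * x) x" using x by (simp add: supported_def)
  finally have 1: "E_eq q (?g M * x) x" .
  have "E_eq q (x * ?g M) (x * ?g L * ?g M)"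
    using x by (intro E_eq_mult[OF E_eq_sym E_eq_refl]) (simp add: supported_def)
  also have "E_eq q (x * ?g L * ?g M) (x * ?g L)" unfolding mult.assoc by (intro E_eq_mult g E_eq_refl)
  also have "E_eq q (x * ?g L) x" using x by (simp add: supported_def)
  finally show ?thesis using 1 by (simp add: supported_def)
qed

lemma supported_add: "supported q L x \<Longrightarrow> supported q L y \<Longrightarrow> supported q L (x + y)"
  by (simp add: supported_def distrib_left distrib_right E_eq_add)

lemma supported_scale: "supported q L x \<Longrightarrow> supported q L (fs_scale c x)"
  by (simp add: supported_def fs_scale_mult_left fs_scale_mult_right E_eq_scale)

lemma E_eq_star_cutoff: "E_eq q (fs_star (cutoff L)) (cutoff L)"
  by (rule E_eq_fam[OF _ q]) (simp add: fam_fs_star cutoff_star)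

lemma supported_star:
  assumes "supported q L x"
  shows "supported q L (fs_star x)"
proof -
  have "E_eq q (cutoff L * fs_star x) (fs_star (cutoff L) * fs_star x)"
    by (intro E_eq_mult E_eq_refl E_eq_sym[OF E_eq_star_cutoff])
  also have "E_eq q (fs_star (cutoff L) * fs_star x) (fs_star x)"
    using assms unfolding fs_star_mult[symmetric] supported_def by (intro E_eq_star) simp
  finally have 1: "E_eq q (cutoff L * fs_star x) (fs_star x)" .
  have "E_eq q (fs_star x * cutoff L) (fs_star x * fs_star (cutoff L))"
    by (intro E_eq_mult E_eq_refl E_eq_sym[OF E_eq_star_cutoff])
  also have "E_eq q (fs_star x * fs_star (cutoff L)) (fs_star x)"
    using assms unfolding fs_star_mult[symmetric] supported_def by (intro E_eq_star) simp
  finally show ?thesis using 1 by (simp add: supported_def)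
qed

lemma supported_left_mult:
  assumes x: "supported q L x"
  shows "\<exists>M. supported q M (y * x)"
proof -
  obtain d where d: "\<And>L. E_eq q (cutoff (L + d) * (y * cutoff L)) (y * cutoff L)"
    using deform_inverse[OF q q, where x = y] by metis
  have x': "E_eq q (cutoff L * x) x" "E_eq q (x * cutoff (L + d)) x"
    using x supported_mono[OF x, of "L + d"] by (simp_all add: supported_def)
  have "E_eq q (cutoff (L + d) * (y * x)) (cutoff (L + d) * (y * (cutoff L * x)))"
    by (intro E_eq_mult E_eq_refl E_eq_sym[OF x'(1)])
  also have "E_eq q \<dots> (y * cutoff L * x)"
    using E_eq_mult[OF d[of L] E_eq_refl[of q x]] by (simp add: mult.assoc)
  also have "E_eq q \<dots> (y * x)"
    unfolding mult.assoc by (intro E_eq_mult E_eq_refl x')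
  finally have "E_eq q (cutoff (L + d) * (y * x)) (y * x)" .
  moreover have "E_eq q (y * x * cutoff (L + d)) (y * x)"
    unfolding mult.assoc by (intro E_eq_mult E_eq_refl x')
  ultimately show ?thesis by (auto simp: supported_def)
qed

lemma supported_right_mult:
  assumes "supported q L x"
  shows "\<exists>M. supported q M (x * y)"
  using supported_left_mult[OF supported_star[OF assms], of "fs_star y"] supported_star
  by (metis fs_star_fs_star fs_star_mult)

lemma supported_sandwich: "supported q L (cutoff L * x * cutoff L)"
proof -
  have "fam (cutoff L * (cutoff L * x * cutoff L)) = fam (cutoff L * x * cutoff L)"
    by (simp add: fam_mult cutoff_mult flip: mult.assoc)
  moreover have "fam (cutoff L * x * cutoff L * cutoff L) = fam (cutoff L * x * cutoff L)"
    by (simp add: fam_mult cutoff_mult mult.assoc)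
  ultimately show ?thesis unfolding supported_def using E_eq_fam[OF _ q] by blast
qed

end

section \<open>Density in the ideal M\<close>

lemma has_limit_iff_approx:
  assumes "cstar_algebra A" "D \<subseteq> carrier A" "a \<in> carrier A"
  shows "(\<exists>u. (\<forall>k. u k \<in> D) \<and> cstar_algebra.has_limit A u a) \<longleftrightarrow> (\<forall>e>0. \<exists>x\<in>D. nrm A (a \<ominus>\<^bsub>A\<^esub> x) < e)"
proof -
  interpret cstar_algebra A by (rule assms(1))
  show ?thesis
  proof
    assume "\<exists>u. (\<forall>k. u k \<in> D) \<and> has_limit u a"
    then obtain u where u: "\<And>k. u k \<in> D" "has_limit u a" by blast
    show "\<forall>e>0. \<exists>x\<in>D. nrm A (a \<ominus>\<^bsub>A\<^esub> x) < e"
    proof (intro allI impI)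
      fix e :: real assume "e > 0"
      then have "\<forall>\<^sub>F k in sequentially. nrm A (u k \<ominus>\<^bsub>A\<^esub> a) < e"
        using u(2) unfolding has_limit_def by (auto intro: order_tendstoD)
      then obtain k where "nrm A (u k \<ominus>\<^bsub>A\<^esub> a) < e" by (auto simp: eventually_sequentially)
      then show "\<exists>x\<in>D. nrm A (a \<ominus>\<^bsub>A\<^esub> x) < e"
        using u(1)[of k] assms(2,3) nrm_minus_commute[of a "u k"] by (auto intro!: bexI[of _ "u k"])
    qed
  next
    assume "\<forall>e>0. \<exists>x\<in>D. nrm A (a \<ominus>\<^bsub>A\<^esub> x) < e"
    then have "\<exists>x\<in>D. nrm A (a \<ominus>\<^bsub>A\<^esub> x) < inverse (real (Suc k))" for k by simp
    then obtain u where u: "\<And>k. u k \<in> D" "\<And>k. nrm A (a \<ominus>\<^bsub>A\<^esub> u k) < inverse (real (Suc k))" by metis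
    have "u k \<in> carrier A" for k using u(1) assms(2) by blast
    then have "has_limit u a"
      using nrm_minus_commute[OF assms(3)] u(2) assms(3)
      by (intro has_limit_sandwich[OF _ _ _ LIMSEQ_inverse_real_of_nat]) (auto intro: less_imp_le)
    then show "\<exists>u. (\<forall>k. u k \<in> D) \<and> has_limit u a" using u(1) by blast
  qed
qed

context
  fixes q :: complex
  assumes q: "cmod q = 1"
begin

definition M_dense :: "(nat \<Rightarrow> ('n::finite + 'm::finite) free_star_alg) set set" where
  "M_dense = {emb q x | x L. supported q L x}"

definition M_closure :: "(nat \<Rightarrow> ('n::finite + 'm::finite) free_star_alg) set set" where
  "M_closure = {a. \<exists>u. (\<forall>k. u k \<in> M_dense) \<and> cstar_algebra.has_limit (E_alg q) u a}"

lemma M_dense_carrier: "M_dense \<subseteq> carrier (E_alg q)"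
  by (auto simp: M_dense_def emb_closed)

text \<open>
  Elements supported on a cutoff form a two-sided ideal of the free *-algebra, since
  multiplication by a word enlarges the cutoff only; the closure of its image is then a closed
  ideal.
\<close>

lemma M_closure_ideal: "closed_ideal (M_closure :: (nat \<Rightarrow> ('n::finite + 'm::finite) free_star_alg) set set) (E_alg q)"
proof -
  let ?E = "E_alg q :: ('n + 'm) univ_cstar"
  let ?D = "M_dense :: (nat \<Rightarrow> ('n + 'm) free_star_alg) set set"
  interpret cstar_algebra ?E by (rule cstar_algebra_E_alg)
  have closure: "a \<in> M_closure" if "\<And>k. u k \<in> ?D" "has_limit u a" for u a
    using that unfolding M_closure_def by blast
  have approx: "a \<in> M_closure \<longleftrightarrow> a \<in> carrier ?E \<and> (\<forall>e>0. \<exists>x\<in>?D. nrm ?E (a \<ominus>\<^bsub>?E\<^esub> x) < e)" for a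
    using has_limit_iff_approx[OF cstar_algebra_E_alg M_dense_carrier, of a]
    unfolding M_closure_def by (auto simp: has_limit_def)
  have dense: "\<exists>u. (\<forall>k. u k \<in> range (emb q)) \<and> has_limit u y" if "y \<in> carrier ?E" for y
    unfolding has_limit_iff_approx[OF cstar_algebra_E_alg image_subsetI[OF emb_closed] that]
    using emb_dense[OF that] by blast
  have D_add: "x \<oplus>\<^bsub>?E\<^esub> y \<in> ?D" if xD: "x \<in> ?D" and yD: "y \<in> ?D" for x y
  proof -
    obtain x' K y' L where x: "x = emb q x'" "supported q K x'" and y: "y = emb q y'" "supported q L y'"
      using xD yD unfolding M_dense_def by blast
    have "supported q (max K L) (x' + y')"
      by (intro supported_add[OF q] supported_mono[OF q x(2)] supported_mono[OF q y(2)]) simp_all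
    then show ?thesis unfolding M_dense_def x(1) y(1) emb_add by blast
  qed
  have D_smult: "c \<odot>\<^bsub>?E\<^esub> x \<in> ?D" if xD: "x \<in> ?D" for x c
  proof -
    obtain x' L where x: "x = emb q x'" "supported q L x'"
      using xD unfolding M_dense_def by blast
    show ?thesis
      using supported_scale[OF q x(2)] unfolding M_dense_def x(1) emb_smult by blast
  qed
  have D_mult: "emb q y \<otimes>\<^bsub>?E\<^esub> x \<in> ?D" "x \<otimes>\<^bsub>?E\<^esub> emb q y \<in> ?D" if "x \<in> ?D" for x y
    using that supported_left_mult[OF q] supported_right_mult[OF q] unfolding M_dense_def
    by (clarsimp simp: emb_mult, metis)+
  have "ideal M_closure ?E"
  proof (rule idealI[OF ring_E_alg])
    show "subgroup M_closure (add_monoid ?E)"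
    proof (rule add.subgroupI)
      show "M_closure \<subseteq> carrier ?E" using approx by blast
      have "supported q 0 (0 :: ('n + 'm) free_star_alg)" by (simp add: supported_def)
      then have "emb q 0 \<in> ?D" unfolding M_dense_def by blast
      from closure[OF this has_limit_const[OF emb_closed]] show "(M_closure :: (nat \<Rightarrow> ('n + 'm) free_star_alg) set set) \<noteq> {}"
        by blast
    next
      fix a assume "a \<in> (M_closure :: (nat \<Rightarrow> ('n + 'm) free_star_alg) set set)"
      then obtain u where u: "\<And>k. u k \<in> ?D" "has_limit u a" unfolding M_closure_def by blast
      have "a \<in> carrier ?E" using u(2) by (simp add: has_limit_def)
      then show "\<ominus>\<^bsub>?E\<^esub> a \<in> M_closure"
        using closure[OF D_smult[OF u(1)] has_limit_smult[OF u(2)]] by (simp add: a_inv_eq_smult)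
    next
      fix a b assume a: "a \<in> (M_closure :: (nat \<Rightarrow> ('n + 'm) free_star_alg) set set)"
        and b: "b \<in> (M_closure :: (nat \<Rightarrow> ('n + 'm) free_star_alg) set set)"
      obtain u where u: "\<And>k. u k \<in> ?D" "has_limit u a" using a unfolding M_closure_def by blast
      obtain v where v: "\<And>k. v k \<in> ?D" "has_limit v b" using b unfolding M_closure_def by blast
      show "a \<oplus>\<^bsub>?E\<^esub> b \<in> M_closure"
        by (rule closure[OF D_add[OF u(1) v(1)] has_limit_add[OF u(2) v(2)]])
    qed
  next
    fix a y assume a: "a \<in> (M_closure :: (nat \<Rightarrow> ('n + 'm) free_star_alg) set set)" and y: "y \<in> carrier ?E"
    obtain u where u: "\<And>k. u k \<in> ?D" "has_limit u a" using a unfolding M_closure_def by blast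
    obtain v where v: "\<And>k. v k \<in> range (emb q)" "has_limit v y" using dense[OF y] by blast
    have D: "v k \<otimes>\<^bsub>?E\<^esub> u k \<in> ?D" "u k \<otimes>\<^bsub>?E\<^esub> v k \<in> ?D" for k
      using D_mult[OF u(1)] v(1)[of k] by auto
    show "y \<otimes>\<^bsub>?E\<^esub> a \<in> M_closure"
      by (rule closure[OF D(1) has_limit_mult[OF v(2) u(2)]])
    show "a \<otimes>\<^bsub>?E\<^esub> y \<in> M_closure"
      by (rule closure[OF D(2) has_limit_mult[OF u(2) v(2)]])
  qed
  moreover have "l \<in> M_closure" if u: "\<And>k. u k \<in> M_closure" and l: "has_limit u l" for u l
  proof -
    have lc: "l \<in> carrier ?E" using l by (simp add: has_limit_def)
    have M: "M_closure \<subseteq> carrier ?E" using approx by blast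
    have "\<exists>x\<in>?D. nrm ?E (l \<ominus>\<^bsub>?E\<^esub> x) < e" if "e > 0" for e
    proof -
      have e: "e/2 > 0" using that by simp
      obtain a where a: "a \<in> M_closure" "nrm ?E (l \<ominus>\<^bsub>?E\<^esub> a) < e/2"
        using has_limit_iff_approx[OF cstar_algebra_E_alg M lc] u l e by blast
      then obtain x where x: "x \<in> ?D" "nrm ?E (a \<ominus>\<^bsub>?E\<^esub> x) < e/2" using approx e by blast
      have "nrm ?E (l \<ominus>\<^bsub>?E\<^esub> x) < e"
        using nrm_triangle[OF lc, of a x] a x M M_dense_carrier by (auto simp: subset_iff)
      then show ?thesis using x by blast
    qed
    then show ?thesis using lc approx by blast
  qed
  ultimately show ?thesis unfolding closed_ideal_iff_has_limit by blast
qed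

lemma defects_supported:
  "supported q 1 (1 - (\<Sum>j\<in>UNIV. s_gen j * fs_star (s_gen j)) :: ('n::finite + 'm::finite) free_star_alg)"
  "supported q 1 (1 - (\<Sum>j\<in>UNIV. t_gen j * fs_star (t_gen j)) :: ('n::finite + 'm::finite) free_star_alg)"
proof -
  have tail: "tail_proj 1 0 = (\<Sum>j\<in>UNIV. s_gen j * fs_star (s_gen j) :: ('n + 'm) free_star_alg)"
    "tail_proj 0 1 = (\<Sum>j\<in>UNIV. t_gen j * fs_star (t_gen j) :: ('n + 'm) free_star_alg)"
    by (simp_all add: tail_proj_def)
  show "supported q 1 (1 - (\<Sum>j\<in>UNIV. s_gen j * fs_star (s_gen j)) :: ('n + 'm) free_star_alg)"
    "supported q 1 (1 - (\<Sum>j\<in>UNIV. t_gen j * fs_star (t_gen j)) :: ('n + 'm) free_star_alg)"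
    unfolding tail[symmetric] supported_def
    by (auto intro!: E_eq_fam[OF _ q] simp: fam_mult fam_diff fam_cutoff tail_proj_mult algebra_simps)
qed

lemma M_alg_subset: "carrier (M_alg q :: ('n::finite + 'm::finite) univ_cstar) \<subseteq> M_closure"
proof -
  interpret cstar_algebra "E_alg q :: ('n + 'm) univ_cstar" by (rule cstar_algebra_E_alg)
  have "emb q x \<in> M_closure" if "supported q 1 x" for x :: "('n + 'm) free_star_alg"
  proof -
    have "emb q x \<in> M_dense" using that unfolding M_dense_def by blast
    moreover have "has_limit (\<lambda>_. emb q x) (emb q x)" by (rule has_limit_const[OF emb_closed])
    ultimately show ?thesis unfolding M_closure_def by (auto intro!: exI[of _ "\<lambda>_. emb q x"])
  qed
  then show ?thesis
    unfolding M_alg_def gen_closed_ideal_def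
    using M_closure_ideal defects_supported by auto
qed

text \<open>
  Conversely, every cutoff lies in the ideal generated by the two defects:
  \<open>1 - p q = (1 - p) + p (1 - q)\<close>, where \<open>1 - p\<close> and \<open>1 - q\<close> telescope.
\<close>

lemma emb_supported_mem:
  fixes x :: "('n::finite + 'm::finite) free_star_alg"
  assumes "supported q L x"
  shows "emb q x \<in> carrier (M_alg q)"
proof -
  let ?E = "E_alg q :: ('n + 'm) univ_cstar" and ?M = "carrier (M_alg q :: ('n + 'm) univ_cstar)"
  let ?S = "{emb q (1 - (\<Sum>j\<in>UNIV. s_gen j * fs_star (s_gen j))),
    emb q (1 - (\<Sum>r\<in>UNIV. t_gen r * fs_star (t_gen r)))} :: (nat \<Rightarrow> ('n + 'm) free_star_alg) set set"
  define I where "I = {x :: ('n + 'm) free_star_alg. emb q x \<in> ?M}"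
  have S: "?S \<subseteq> carrier ?E" by (simp add: emb_closed)
  have M: "?M = gen_closed_ideal ?E ?S" by (simp add: M_alg_def)
  interpret ideal ?M ?E
    using closed_ideal_gen(1)[OF ring_E_alg S] unfolding M closed_ideal_def by blast
  have defects: "1 - (\<Sum>j\<in>UNIV. s_gen j * fs_star (s_gen j)) \<in> I" "1 - (\<Sum>r\<in>UNIV. t_gen r * fs_star (t_gen r)) \<in> I"
    using closed_ideal_gen(2)[OF ring_E_alg S] unfolding I_def M by auto
  have add: "x + y \<in> I" if "x \<in> I" "y \<in> I" for x y
    using that a_closed unfolding I_def by (simp flip: emb_add)
  have zero: "0 \<in> I"
    using zero_closed unfolding I_def by (simp flip: emb_zero)
  have left: "y * x \<in> I" and right: "x * y \<in> I" if "x \<in> I" for x y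
    using that I_l_closed[OF _ emb_closed] I_r_closed[OF _ emb_closed]
    unfolding I_def by (simp_all flip: emb_mult)
  let ?P = "range_proj s_gen (\<lambda>j. fs_star (s_gen j)) L :: ('n + 'm) free_star_alg"
    and ?Q = "range_proj t_gen (\<lambda>r. fs_star (t_gen r)) L :: ('n + 'm) free_star_alg"
  have "1 - ?P \<in> I" "1 - ?Q \<in> I"
    by (rule one_minus_range_proj_mem; use add zero left right defects in blast)+
  moreover have "cutoff L = (1 - ?P) + ?P * (1 - ?Q)"
    by (simp add: cutoff_def tail_proj_def algebra_simps)
  ultimately have "cutoff L * x \<in> I" using add left right by metis
  moreover have "emb q (cutoff L * x) = emb q x"
    using assms unfolding supported_def by (intro emb_eq) blast
  ultimately show ?thesis unfolding I_def by simp
qed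

lemma M_alg_dense:
  assumes a: "a \<in> carrier (M_alg q :: ('n::finite + 'm::finite) univ_cstar)" and "e > 0"
  shows "\<exists>x L. nrm (E_alg q) (a \<ominus>\<^bsub>E_alg q\<^esub> emb q (cutoff L * x * cutoff L)) < e"
proof -
  have "a \<in> M_closure" using a M_alg_subset by blast
  then obtain u where u: "\<forall>k. u k \<in> M_dense" "cstar_algebra.has_limit (E_alg q) u a"
    unfolding M_closure_def by blast
  have "a \<in> carrier (E_alg q)"
    using u(2) unfolding cstar_algebra.has_limit_def[OF cstar_algebra_E_alg] by blast
  then obtain x L where x: "supported q L x" "nrm (E_alg q) (a \<ominus>\<^bsub>E_alg q\<^esub> emb q x) < e"
    using has_limit_iff_approx[OF cstar_algebra_E_alg M_dense_carrier] u \<open>e > 0\<close>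
    unfolding M_dense_def by blast
  have "E_eq q (cutoff L * x * cutoff L) (x * cutoff L)"
    using x(1) by (intro E_eq_mult E_eq_refl) (simp add: supported_def)
  also have "E_eq q (x * cutoff L) x" using x(1) by (simp add: supported_def)
  finally have "emb q (cutoff L * x * cutoff L) = emb q x" by (rule emb_eq)
  then show ?thesis using x(2) by (intro exI[of _ x] exI[of _ L]) simp
qed

end

section \<open>The correspondence between two of the ideals\<close>

text \<open>
  Asking for both limits makes the relation symmetric, so that one norm inequality and one
  density statement suffice. As \<open>q\<close> and \<open>q'\<close> have modulus one, \<open>q * cnj q'\<close> is the quotient
  \<open>q / q'\<close>.
\<close>

definition corresponding ::
  "complex \<Rightarrow> complex \<Rightarrow> ('n::finite + 'm::finite) free_star_alg \<Rightarrow> ('n + 'm) free_star_alg \<Rightarrow> bool" where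
  "corresponding q q' x y \<longleftrightarrow>
     (\<exists>L. supported q L x \<and> supported q' L y) \<and>
     (\<forall>\<^sub>F K in sequentially. E_eq q' (subst (deform (q * cnj q') K) x) y) \<and>
     (\<forall>\<^sub>F K in sequentially. E_eq q (subst (deform (q' * cnj q) K) y) x)"

lemma corresponding_sym: "corresponding q q' x y \<longleftrightarrow> corresponding q' q y x"
  unfolding corresponding_def by blast

context
  fixes q q' :: complex
  assumes q: "cmod q = 1" and q': "cmod q' = 1"
begin

lemma unit_mult_cnj: "q' * (q * cnj q') = q"
proof -
  have "q' * cnj q' = 1" using q' by (metis complex_norm_square of_real_1 power_one)
  then show ?thesis by (simp add: mult.left_commute)
qed

lemma corresponding_norm_le:
  assumes "corresponding q q' x y"
  shows "E_norm q' y \<le> E_norm q x"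
proof -
  obtain L K0 where y: "supported q' L y"
    and K: "\<And>K. K0 \<le> K \<Longrightarrow> E_eq q' (subst (deform (q * cnj q') K) x) y"
    using assms unfolding corresponding_def eventually_sequentially by blast
  have r: "cmod (q * cnj q') = 1" using q q' by (simp add: norm_mult)
  have "E_eq q' y (y * cutoff L)" using y by (auto simp: supported_def intro: E_eq_sym)
  then have "E_norm q' y \<le> E_norm (q' * (q * cnj q')) x"
    by (rule E_norm_deform_le[OF q' r _ K])
  then show ?thesis by (simp only: unit_mult_cnj)
qed

text \<open>
  The partner is the deformation of \<open>x\<close> at a fixed large truncation \<open>N\<close>, again between
  cutoffs. The cutoffs are written out rather than deformed: a deformed cutoff equals the
  cutoff for one parameter only, and a second deformation, which starts from the other
  parameter, need not respect that equality.
\<close>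

lemma corresponding_sandwich:
  fixes x :: "('n::finite + 'm::finite) free_star_alg"
  shows "\<exists>y. corresponding q q' (cutoff L * x * cutoff L) y"
proof -
  let ?r = "q * cnj q'" and ?g = "cutoff L :: ('n + 'm) free_star_alg"
  have r: "cmod ?r = 1" "cmod (q' * cnj q) = 1" using q q' by (simp_all add: norm_mult)
  have r': "q' * cnj q = cnj ?r" by simp
  obtain d where d: "\<And>L K K'. L + d \<le> K \<Longrightarrow> L + d \<le> K' \<Longrightarrow>
      E_eq q' (subst (deform ?r K) x * cutoff L) (subst (deform ?r K') x * cutoff L)"
    using deform_stable[OF q', where r = ?r and x = x] by metis
  obtain e where e: "\<And>L K K'. L + e \<le> K \<Longrightarrow> L + e \<le> K' \<Longrightarrow>
      E_eq q (subst (deform (cnj ?r) K') (subst (deform ?r K) x) * cutoff L) (x * cutoff L)"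
    using deform_inverse[OF q r(1), where x = x] by metis
  define N where "N = L + d + e"
  let ?y = "subst (deform ?r N) x"
  have g: "E_eq p (subst (deform s K) ?g) ?g" if "cmod p = 1" "cmod s = 1" for p s K
    using deform_cutoff[OF that(2)] by (intro E_eq_fam[OF _ that(1)])
  have "E_eq q' (subst (deform ?r K) (?g * x * ?g)) (?g * ?y * ?g)" if "N \<le> K" for K
  proof -
    have "E_eq q' (subst (deform ?r K) (?g * x * ?g)) (?g * (subst (deform ?r K) x * ?g))"
      unfolding subst_mult mult.assoc by (intro E_eq_mult g q' r E_eq_refl)
    also have "E_eq q' \<dots> (?g * (?y * ?g))"
      using that by (intro E_eq_mult E_eq_refl d) (simp_all add: N_def)
    finally show ?thesis by (simp only: mult.assoc)
  qed
  moreover have "E_eq q (subst (deform (q' * cnj q) K) (?g * ?y * ?g)) (?g * x * ?g)" if "N \<le> K" for K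
  proof -
    have "E_eq q (subst (deform (q' * cnj q) K) (?g * ?y * ?g)) (?g * (subst (deform (q' * cnj q) K) ?y * ?g))"
      unfolding subst_mult mult.assoc by (intro E_eq_mult g q r E_eq_refl)
    also have "E_eq q \<dots> (?g * (x * ?g))"
      unfolding r' using that by (intro E_eq_mult E_eq_refl e) (simp_all add: N_def)
    finally show ?thesis by (simp only: mult.assoc)
  qed
  ultimately have "corresponding q q' (?g * x * ?g) (?g * ?y * ?g)"
    unfolding corresponding_def eventually_sequentially
    using supported_sandwich[OF q] supported_sandwich[OF q'] by blast
  then show ?thesis by blast
qed

lemma supported_common:
  assumes "corresponding q q' x y" "corresponding q q' x' y'"
  obtains L where "supported q L x" "supported q' L y" "supported q L x'" "supported q' L y'"
proof -
  obtain L L' where "supported q L x" "supported q' L y" "supported q L' x'" "supported q' L' y'"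
    using assms unfolding corresponding_def by blast
  then have "supported q (max L L') x" "supported q' (max L L') y"
      "supported q (max L L') x'" "supported q' (max L L') y'"
    by (auto elim: supported_mono[OF q] supported_mono[OF q'])
  then show ?thesis by (rule that)
qed

lemma supported_mult:
  assumes "cmod p = 1" "supported p L x" "supported p L y"
  shows "supported p L (x * y)"
proof -
  have "E_eq p (cutoff L * x * y) (x * y)" "E_eq p (x * (y * cutoff L)) (x * y)"
    using assms by (intro E_eq_mult E_eq_refl; simp add: supported_def)+
  then show ?thesis by (simp add: supported_def mult.assoc)
qed

lemma corresponding_add:
  assumes "corresponding q q' x y" "corresponding q q' x' y'"
  shows "corresponding q q' (x + x') (y + y')"
proof -
  obtain L where "supported q L x" "supported q' L y" "supported q L x'" "supported q' L y'"
    using supported_common[OF assms] by blast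
  then have "\<exists>L. supported q L (x + x') \<and> supported q' L (y + y')"
    by (blast intro: supported_add[OF q] supported_add[OF q'])
  moreover have "\<forall>\<^sub>F K in sequentially. E_eq q' (subst (deform (q * cnj q') K) (x + x')) (y + y')"
    using assms[unfolded corresponding_def, THEN conjunct2, THEN conjunct1]
    by eventually_elim (simp add: subst_add E_eq_add)
  moreover have "\<forall>\<^sub>F K in sequentially. E_eq q (subst (deform (q' * cnj q) K) (y + y')) (x + x')"
    using assms[unfolded corresponding_def, THEN conjunct2, THEN conjunct2]
    by eventually_elim (simp add: subst_add E_eq_add)
  ultimately show ?thesis unfolding corresponding_def by blast
qed

lemma corresponding_mult:
  assumes "corresponding q q' x y" "corresponding q q' x' y'"
  shows "corresponding q q' (x * x') (y * y')"
proof -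
  obtain L where "supported q L x" "supported q' L y" "supported q L x'" "supported q' L y'"
    using supported_common[OF assms] by blast
  then have "\<exists>L. supported q L (x * x') \<and> supported q' L (y * y')"
    by (blast intro: supported_mult[OF q] supported_mult[OF q'])
  moreover have "\<forall>\<^sub>F K in sequentially. E_eq q' (subst (deform (q * cnj q') K) (x * x')) (y * y')"
    using assms[unfolded corresponding_def, THEN conjunct2, THEN conjunct1]
    by eventually_elim (simp add: subst_mult E_eq_mult)
  moreover have "\<forall>\<^sub>F K in sequentially. E_eq q (subst (deform (q' * cnj q) K) (y * y')) (x * x')"
    using assms[unfolded corresponding_def, THEN conjunct2, THEN conjunct2]
    by eventually_elim (simp add: subst_mult E_eq_mult)
  ultimately show ?thesis unfolding corresponding_def by blast
qed

lemma corresponding_scale: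
  "corresponding q q' x y \<Longrightarrow> corresponding q q' (fs_scale c x) (fs_scale c y)"
proof -
  assume xy: "corresponding q q' x y"
  have "\<exists>L. supported q L (fs_scale c x) \<and> supported q' L (fs_scale c y)"
    using xy supported_scale[OF q] supported_scale[OF q'] unfolding corresponding_def by blast
  moreover have "\<forall>\<^sub>F K in sequentially. E_eq q' (subst (deform (q * cnj q') K) (fs_scale c x)) (fs_scale c y)"
    using xy[unfolded corresponding_def, THEN conjunct2, THEN conjunct1]
    by eventually_elim (simp add: subst_scale E_eq_scale)
  moreover have "\<forall>\<^sub>F K in sequentially. E_eq q (subst (deform (q' * cnj q) K) (fs_scale c y)) (fs_scale c x)"
    using xy[unfolded corresponding_def, THEN conjunct2, THEN conjunct2]
    by eventually_elim (simp add: subst_scale E_eq_scale)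
  ultimately show ?thesis unfolding corresponding_def by blast
qed

lemma corresponding_star:
  "corresponding q q' x y \<Longrightarrow> corresponding q q' (fs_star x) (fs_star y)"
proof -
  assume xy: "corresponding q q' x y"
  have "\<exists>L. supported q L (fs_star x) \<and> supported q' L (fs_star y)"
    using xy supported_star[OF q] supported_star[OF q'] unfolding corresponding_def by blast
  moreover have "\<forall>\<^sub>F K in sequentially. E_eq q' (subst (deform (q * cnj q') K) (fs_star x)) (fs_star y)"
    using xy[unfolded corresponding_def, THEN conjunct2, THEN conjunct1]
    by eventually_elim (simp add: subst_star E_eq_star)
  moreover have "\<forall>\<^sub>F K in sequentially. E_eq q (subst (deform (q' * cnj q) K) (fs_star y)) (fs_star x)"
    using xy[unfolded corresponding_def, THEN conjunct2, THEN conjunct2]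
    by eventually_elim (simp add: subst_star E_eq_star)
  ultimately show ?thesis unfolding corresponding_def by blast
qed

end

lemma M_alg_minus:
  assumes "a \<in> carrier (M_alg q :: ('n::finite + 'm::finite) univ_cstar)" "b \<in> carrier (M_alg q :: ('n + 'm) univ_cstar)"
  shows "a \<ominus>\<^bsub>M_alg q :: ('n + 'm) univ_cstar\<^esub> b = a \<ominus>\<^bsub>E_alg q\<^esub> b"
proof -
  have "closed_ideal (carrier (M_alg q :: ('n + 'm) univ_cstar)) (E_alg q)"
    unfolding M_alg_def partial_object.simps
    by (rule closed_ideal_gen(1)[OF ring_E_alg, THEN back_subst[of "\<lambda>I. closed_ideal I (E_alg q)"]])
      (simp_all add: emb_closed)
  then have "ideal (carrier (M_alg q :: ('n + 'm) univ_cstar)) (E_alg q)"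
    by (simp add: closed_ideal_def)
  then have "b \<in> carrier (E_alg q)"
    using assms(2) additive_subgroup.a_subset[OF ideal.axioms(1)] by blast
  then have "a \<ominus>\<^bsub>E_alg q\<^esub> b = a \<oplus>\<^bsub>E_alg q\<^esub> (-1) \<odot>\<^bsub>E_alg q\<^esub> b"
    by (rule cstar_algebra.minus_eq_smult[OF cstar_algebra_E_alg])
  moreover have "a \<ominus>\<^bsub>M_alg q :: ('n + 'm) univ_cstar\<^esub> b = a \<oplus>\<^bsub>M_alg q\<^esub> (-1) \<odot>\<^bsub>M_alg q\<^esub> b"
    by (rule cstar_algebra.minus_eq_smult[OF cstar_algebra_M_alg assms(2)])
  ultimately show ?thesis by (simp add: M_alg_def)
qed

lemma M_alg_corresponding_dense:
  assumes q: "cmod q = 1" and q': "cmod q' = 1"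
    and a: "a \<in> carrier (M_alg q :: ('n::finite + 'm::finite) univ_cstar)" and "e > 0"
  shows "\<exists>x y. corresponding q q' x y \<and> nrm (M_alg q) (a \<ominus>\<^bsub>M_alg q\<^esub> emb q x) < e"
proof -
  obtain x L where x: "nrm (E_alg q) (a \<ominus>\<^bsub>E_alg q\<^esub> emb q (cutoff L * x * cutoff L)) < e"
    using M_alg_dense[OF q a \<open>e > 0\<close>] by blast
  have "emb q (cutoff L * x * cutoff L) \<in> carrier (M_alg q)"
    by (rule emb_supported_mem[OF q supported_sandwich[OF q]])
  then have "nrm (M_alg q) (a \<ominus>\<^bsub>M_alg q\<^esub> emb q (cutoff L * x * cutoff L)) < e"
    using x M_alg_minus[OF a] by (simp add: M_alg_def)
  then show ?thesis using corresponding_sandwich[OF q q'] by blast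
qed

lemma M_alg_isomorphic:
  assumes q: "cmod q = 1" and q': "cmod q' = 1"
  shows "(M_alg q :: ('n::finite + 'm::finite) univ_cstar) \<simeq>\<^sub>C (M_alg q' :: ('n + 'm) univ_cstar)"
proof -
  let ?A = "M_alg q :: ('n + 'm) univ_cstar" and ?B = "M_alg q' :: ('n + 'm) univ_cstar"
  let ?\<Gamma> = "{(emb q x, emb q' y) | x y. corresponding q q' (x :: ('n + 'm) free_star_alg) y}"
  interpret A: cstar_algebra ?A by (rule cstar_algebra_M_alg)
  interpret B: cstar_algebra ?B by (rule cstar_algebra_M_alg)
  have ops: "x \<oplus>\<^bsub>M_alg p\<^esub> y = x \<oplus>\<^bsub>E_alg p\<^esub> y" "x \<otimes>\<^bsub>M_alg p\<^esub> y = x \<otimes>\<^bsub>E_alg p\<^esub> y"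
    "c \<odot>\<^bsub>M_alg p\<^esub> x = c \<odot>\<^bsub>E_alg p\<^esub> x" "adj (M_alg p) x = adj (E_alg p) x" "nrm (M_alg p) x = nrm (E_alg p) x"
    for c p and x y :: "(nat \<Rightarrow> ('n + 'm) free_star_alg) set"
    by (simp_all add: M_alg_def)
  interpret isometric_correspondence ?A ?B ?\<Gamma>
  proof
    show "a \<in> carrier ?A \<and> b \<in> carrier ?B" if "(a, b) \<in> ?\<Gamma>" for a b
      using that emb_supported_mem[OF q] emb_supported_mem[OF q'] unfolding corresponding_def by blast
    show "(a \<oplus>\<^bsub>?A\<^esub> a', b \<oplus>\<^bsub>?B\<^esub> b') \<in> ?\<Gamma>" if "(a, b) \<in> ?\<Gamma>" "(a', b') \<in> ?\<Gamma>" for a b a' b'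
      using that corresponding_add[OF q q'] by (clarsimp simp: ops emb_add) blast
    show "(a \<otimes>\<^bsub>?A\<^esub> a', b \<otimes>\<^bsub>?B\<^esub> b') \<in> ?\<Gamma>" if "(a, b) \<in> ?\<Gamma>" "(a', b') \<in> ?\<Gamma>" for a b a' b'
      using that corresponding_mult[OF q q'] by (clarsimp simp: ops emb_mult) blast
    show "(c \<odot>\<^bsub>?A\<^esub> a, c \<odot>\<^bsub>?B\<^esub> b) \<in> ?\<Gamma>" if "(a, b) \<in> ?\<Gamma>" for a b c
      using that corresponding_scale[OF q q'] by (clarsimp simp: ops emb_smult) blast
    show "(adj ?A a, adj ?B b) \<in> ?\<Gamma>" if "(a, b) \<in> ?\<Gamma>" for a b
      using that corresponding_star[OF q q'] by (clarsimp simp: ops emb_adj) blast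
    show "nrm ?A a = nrm ?B b" if ab: "(a, b) \<in> ?\<Gamma>" for a b
    proof -
      obtain x y where xy: "a = emb q x" "b = emb q' y" "corresponding q q' x y" using ab by blast
      have "E_norm q x = E_norm q' y"
        using corresponding_norm_le[OF q q' xy(3)] corresponding_norm_le[OF q' q] xy(3)
        by (metis corresponding_sym antisym)
      then show ?thesis by (simp add: xy ops nrm_emb)
    qed
    show "\<exists>(x, y)\<in>?\<Gamma>. nrm ?A (a \<ominus>\<^bsub>?A\<^esub> x) < e" if "a \<in> carrier ?A" "e > 0" for a e
      using M_alg_corresponding_dense[OF q q' that] by fast
    show "\<exists>(x, y)\<in>?\<Gamma>. nrm ?B (b \<ominus>\<^bsub>?B\<^esub> y) < e" if "b \<in> carrier ?B" "e > 0" for b e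
      using M_alg_corresponding_dense[OF q' q that] corresponding_sym[of q q'] by fast
  qed
  show ?thesis by (rule cstar_isomorphic)
qed

theorem theorem3p35:
  fixes q :: complex
  assumes "CARD('n::finite) \<ge> 2" and "CARD('m::finite) \<ge> 2"
    and "cmod q = 1"
  shows "(M_alg q :: ('n + 'm) univ_cstar) \<simeq>\<^sub>C (M_alg 1 :: ('n + 'm) univ_cstar)"
  using assms(3) by (rule M_alg_isomorphic) simp

end
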